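(* Let $M$ be a real $d\times d$ dilation matrix, $j\in\mathbb{Z}$, $N\in\mathbb{Z}_+$, and let $L$ be the differential operator $Lf=\sum_{[\beta]\le N}a_\beta D^\beta f$, where $a_\beta\in\mathbb{C}$ and $a_{\mathbf 0}\neq0$. Let $\widetilde\varphi$ be the distribution associated with $L$, let $\varphi\in\mathcal{B}$, and suppose that $\widetilde\varphi$ and $\varphi$ are strictly compatible, with parameter $\delta\in(0,1/2)$. If $f\in C(\mathbb{R}^d)$ with $\widehat f\in L_1(\mathbb{R}^d)$ is such that $\widehat f$ is supported in $\{\xi:\ |M^{*-j}\xi|<\delta\}$, then $$f(x)=m^{-j/2}\sum_{k\in\mathbb{Z}^d}Lf(M^{-j}\cdot)(-k)\,\varphi_{jk}(x)\quad\text{for all }x\in\mathbb{R}^d, \qquad ( * )$$ where the series is considered as the limit of cubic partial sums (over $\|k\|_\infty\le R$, $R\to\infty$). If, moreover, $\widehat\varphi$ is supported in $[-1/2,1/2]^d$ and $\widehat\varphi(\xi)\overline{\widehat{\widetilde\varphi}(\xi)}=1$ for all $\xi\in[-1/2,1/2]^d$, then $( * )$ holds for every $f\in C(\mathbb{R}^d)$ with $\widehat f\in L_1(\mathbb{R}^d)$ whose Fourier transform is supported in $M^{*j}[-1/2,1/2]^d$.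
   Context: A dilation matrix is a real $d\times d$ matrix all of whose eigenvalues are bigger than $1$ in modulus; $m=|\det M|$, $M^*$ is the conjugate (transpose) matrix, $M^{*-j}=(M^* )^{-j}$. $[\beta]=\beta_1+\dots+\beta_d$ for $\beta\in\mathbb{Z}_+^d$, $\widehat f(\xi)=\int_{\mathbb{R}^d}f(x)e^{-2\pi i(x,\xi)}\,dx$ (in the sense of tempered distributions in general), and $\varphi_{jk}(x)=m^{j/2}\varphi(M^jx+k)$. $Lf(M^{-j}\cdot)(-k)$ denotes the value at $-k$ of $L$ applied to the function $x\mapsto f(M^{-j}x)$. The distribution associated with $L$ is $\widetilde\varphi=\sum_{[\beta]\le N}\overline{a_\beta}(-1)^{[\beta]}D^\beta\delta$, where $\delta$ here is the Dirac delta; thus $\widehat{\widetilde\varphi}(\xi)=\sum_{[\beta]\le N}\overline{a_\beta}(-2\pi i\xi)^\beta$. $\mathcal{B}=\mathcal{B}(\mathbb{R}^d)$ is the class of functions $\varphi(x)=\int_{\mathbb{R}^d}\theta(\xi)e^{2\pi i(x,\xi)}\,d\xi$, where $\theta$ is supported on a parallelepiped $S=[a_1,b_1]\times\dots\times[a_d,b_d]$ and $\theta|_S\in C^d(S)$ (so $\widehat\varphi=\theta$). A tempered distribution $\widetilde\varphi$ and a function $\varphi$ are strictly compatible (with parameter $\delta$) if there is $\delta\in(0,1/2)$ such that $\overline{\widehat\varphi(\xi)}\,\widehat{\widetilde\varphi}(\xi)=1$ for a.e. $\xi$ with $|\xi|<\delta$, and $\widehat\varphi(\xi)=0$ for a.e.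 $\xi$ with $|l-\xi|<\delta$, for all $l\in\mathbb{Z}^d\setminus\{0\}$. *)

theory Defs
  imports "HOL-Analysis.Analysis"
begin

definition complex_matrix :: "real^'d^'d \<Rightarrow> complex^'d^'d" where
  "complex_matrix M = (\<chi> r c. complex_of_real (M $ r $ c))"

definition matrix_eigenvalue :: "complex^'d^'d \<Rightarrow> complex \<Rightarrow> bool" where
  "matrix_eigenvalue A z \<longleftrightarrow> (\<exists>v. v \<noteq> 0 \<and> A *v v = z *s v)"

definition dilation_matrix :: "real^'d^'d \<Rightarrow> bool" where
  "dilation_matrix M \<longleftrightarrow> (\<forall>z. matrix_eigenvalue (complex_matrix M) z \<longrightarrow> 1 < cmod z)"

definition matrix_power :: "real^'d^'d \<Rightarrow> nat \<Rightarrow> real^'d^'d" where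
  "matrix_power A n = (((**) A) ^^ n) (mat 1)"

text \<open>Integer powers; meaningful for invertible matrices, which dilation matrices are.\<close>

definition matrix_powi :: "real^'d^'d \<Rightarrow> int \<Rightarrow> real^'d^'d" where
  "matrix_powi A j =
     (if 0 \<le> j then matrix_power A (nat j) else matrix_power (matrix_inv A) (nat (- j)))"

definition int_vec :: "int^'d \<Rightarrow> real^'d" where
  "int_vec k = (\<chi> i. real_of_int (k $ i))"

definition mi_order :: "nat^'d \<Rightarrow> nat" where
  "mi_order \<beta> = (\<Sum>i\<in>UNIV. \<beta> $ i)"

definition mi_power :: "real^'d \<Rightarrow> nat^'d \<Rightarrow> real" where
  "mi_power x \<alpha> = (\<Prod>i\<in>UNIV. (x $ i) ^ (\<alpha> $ i))"

definition partial_deriv :: "'d \<Rightarrow> (real^'d \<Rightarrow> complex) \<Rightarrow> real^'d \<Rightarrow> complex" where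
  "partial_deriv i f x = vector_derivative (\<lambda>t. f (x + t *\<^sub>R axis i 1)) (at 0)"

text \<open>The index type carries no order, so an arbitrary order of differentiation in which
  direction \<open>i\<close> occurs \<open>\<beta> $ i\<close> times is fixed.  For functions that are \<open>mi_order \<beta>\<close> times
  continuously differentiable the order does not matter.\<close>

definition mi_deriv :: "nat^'d \<Rightarrow> (real^'d \<Rightarrow> complex) \<Rightarrow> real^'d \<Rightarrow> complex" where
  "mi_deriv \<beta> f = foldr partial_deriv (SOME is. \<forall>i. count_list is i = \<beta> $ i) f"

text \<open>\<open>k\<close> times continuously differentiable on \<open>S\<close>.  It is used for \<open>S\<close> the whole space and for
  \<open>S\<close> a closed box with nonempty interior, where the derivatives at boundary points are
  one-sided.\<close>

primrec Ck_on :: "nat \<Rightarrow> (real^'d) set \<Rightarrow> (real^'d \<Rightarrow> complex) \<Rightarrow> bool" where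
  "Ck_on 0 S f \<longleftrightarrow> continuous_on S f"
| "Ck_on (Suc k) S f \<longleftrightarrow> continuous_on S f \<and>
     (\<forall>i. \<exists>f'. (\<forall>x\<in>S. ((\<lambda>t. f (x + t *\<^sub>R axis i 1)) has_vector_derivative f' x)
                        (at 0 within {t. x + t *\<^sub>R axis i 1 \<in> S}))
             \<and> Ck_on k S f')"

definition schwartz :: "(real^'d \<Rightarrow> complex) set" where
  "schwartz = {\<psi>. (\<forall>k. Ck_on k UNIV \<psi>) \<and>
     (\<forall>\<alpha> \<beta>. bounded (range (\<lambda>x. mi_power x \<alpha> *\<^sub>R mi_deriv \<beta> \<psi> x)))}"

text \<open>A distribution is a functional of which only the values on Schwartz functions matter.\<close>

type_synonym 'd distr = "(real^'d \<Rightarrow> complex) \<Rightarrow> complex"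

definition tempered_distribution :: "('d::finite) distr \<Rightarrow> bool" where
  "tempered_distribution u \<longleftrightarrow>
     (\<forall>\<psi>\<in>schwartz. \<forall>\<eta>\<in>schwartz. \<forall>c. u (\<lambda>x. c * \<psi> x + \<eta> x) = c * u \<psi> + u \<eta>) \<and>
     (\<exists>C n. \<forall>\<psi>\<in>schwartz. cmod (u \<psi>) \<le>
        C * (\<Sum>\<alpha>\<in>{\<alpha>. mi_order \<alpha> \<le> n}. \<Sum>\<beta>\<in>{\<beta>. mi_order \<beta> \<le> n}.
               SUP x. cmod (mi_power x \<alpha> *\<^sub>R mi_deriv \<beta> \<psi> x)))"

definition regular_distr :: "(real^'d \<Rightarrow> complex) \<Rightarrow> ('d::finite) distr" where
  "regular_distr f \<psi> = (\<integral>x. f x * \<psi> x \<partial>lborel)"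

definition tempered_function :: "(real^'d \<Rightarrow> complex) \<Rightarrow> bool" where
  "tempered_function f \<longleftrightarrow>
     (\<forall>\<psi>\<in>schwartz. integrable lborel (\<lambda>x. f x * \<psi> x)) \<and> tempered_distribution (regular_distr f)"

definition fourier :: "(real^'d \<Rightarrow> complex) \<Rightarrow> real^'d \<Rightarrow> complex" where
  "fourier \<psi> \<xi> = (\<integral>x. \<psi> x * cis (- 2 * pi * (x \<bullet> \<xi>)) \<partial>lborel)"

definition fourier_distr :: "('d::finite) distr \<Rightarrow> ('d::finite) distr" where
  "fourier_distr u \<psi> = u (fourier \<psi>)"

text \<open>The Fourier transform of the distribution \<open>u\<close> is (represented by) the function \<open>g\<close>, which is
  thereby determined almost everywhere.\<close>

definition has_fourier_function :: "('d::finite) distr \<Rightarrow> (real^'d \<Rightarrow> complex) \<Rightarrow> bool" where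
  "has_fourier_function u g \<longleftrightarrow>
     tempered_distribution u \<and> tempered_function g \<and>
     (\<forall>\<psi>\<in>schwartz. fourier_distr u \<psi> = regular_distr g \<psi>)"

definition fun_has_fourier :: "(real^'d \<Rightarrow> complex) \<Rightarrow> (real^'d \<Rightarrow> complex) \<Rightarrow> bool" where
  "fun_has_fourier f g \<longleftrightarrow> tempered_function f \<and> has_fourier_function (regular_distr f) g"

definition fourier_L1_supported_in :: "(real^'d \<Rightarrow> complex) \<Rightarrow> (real^'d) set \<Rightarrow> bool" where
  "fourier_L1_supported_in f A \<longleftrightarrow>
     (\<exists>g. fun_has_fourier f g \<and> integrable lborel g \<and> (AE \<xi> in lborel. \<xi> \<notin> A \<longrightarrow> g \<xi> = 0))"

definition dirac :: "('d::finite) distr" where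
  "dirac \<psi> = \<psi> 0"

definition distr_deriv :: "nat^'d \<Rightarrow> ('d::finite) distr \<Rightarrow> ('d::finite) distr" where
  "distr_deriv \<beta> u \<psi> = (-1) ^ mi_order \<beta> * u (mi_deriv \<beta> \<psi>)"

definition diff_op :: "nat \<Rightarrow> (nat^'d \<Rightarrow> complex) \<Rightarrow> (real^'d \<Rightarrow> complex) \<Rightarrow> real^'d \<Rightarrow> complex" where
  "diff_op N a f x = (\<Sum>\<beta>\<in>{\<beta>. mi_order \<beta> \<le> N}. a \<beta> * mi_deriv \<beta> f x)"

text \<open>Its Fourier transform is the polynomial \<open>\<Sum> cnj (a \<beta>) * (- 2 * pi * \<i> * \<xi>) ^ \<beta>\<close>, whose conjugate is the
  symbol of \<open>diff_op N a\<close>.\<close>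

definition assoc_distr :: "nat \<Rightarrow> (nat^'d \<Rightarrow> complex) \<Rightarrow> ('d::finite) distr" where
  "assoc_distr N a \<psi> =
     (\<Sum>\<beta>\<in>{\<beta>. mi_order \<beta> \<le> N}. cnj (a \<beta>) * (-1) ^ mi_order \<beta> * distr_deriv \<beta> dirac \<psi>)"

definition class_B :: "(real^'d \<Rightarrow> complex) set" where
  "class_B = {\<phi>. \<exists>\<theta> l u. (\<forall>i. l $ i < u $ i) \<and> (\<forall>\<xi>. \<xi> \<notin> cbox l u \<longrightarrow> \<theta> \<xi> = 0) \<and>
     Ck_on CARD('d) (cbox l u) \<theta> \<and>
     (\<forall>x. \<phi> x = (\<integral>\<xi>. \<theta> \<xi> * cis (2 * pi * (x \<bullet> \<xi>)) \<partial>lborel))}"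

definition strictly_compatible :: "('d::finite) distr \<Rightarrow> (real^'d \<Rightarrow> complex) \<Rightarrow> real \<Rightarrow> bool" where
  "strictly_compatible \<phi>t \<phi> \<delta> \<longleftrightarrow> 0 < \<delta> \<and> \<delta> < 1 / 2 \<and>
     (\<exists>g gt. fun_has_fourier \<phi> g \<and> has_fourier_function \<phi>t gt \<and>
        (AE \<xi> in lborel. norm \<xi> < \<delta> \<longrightarrow> cnj (g \<xi>) * gt \<xi> = 1) \<and>
        (\<forall>l. l \<noteq> 0 \<longrightarrow> (AE \<xi> in lborel. norm (int_vec l - \<xi>) < \<delta> \<longrightarrow> g \<xi> = 0)))"

definition unit_cube :: "(real^'d) set" where
  "unit_cube = cbox (\<chi> i. - 1 / 2) (\<chi> i. 1 / 2)"

text \<open>Pointwise conditions on Fourier transforms are conditions on a suitable representative.\<close>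

definition cube_dual :: "('d::finite) distr \<Rightarrow> (real^'d \<Rightarrow> complex) \<Rightarrow> bool" where
  "cube_dual \<phi>t \<phi> \<longleftrightarrow>
     (\<exists>g gt. fun_has_fourier \<phi> g \<and> has_fourier_function \<phi>t gt \<and>
        (\<forall>\<xi>. \<xi> \<notin> unit_cube \<longrightarrow> g \<xi> = 0) \<and>
        (\<forall>\<xi>\<in>unit_cube. g \<xi> * cnj (gt \<xi>) = 1))"

definition dilate_shift ::
    "real^'d^'d \<Rightarrow> (real^'d \<Rightarrow> complex) \<Rightarrow> int \<Rightarrow> int^'d \<Rightarrow> real^'d \<Rightarrow> complex" where
  "dilate_shift M \<phi> j k x =
     of_real (\<bar>det M\<bar> powr (of_int j / 2)) * \<phi> (matrix_powi M j *v x + int_vec k)"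

definition sampling_partial_sum ::
    "real^'d^'d \<Rightarrow> int \<Rightarrow> nat \<Rightarrow> (nat^'d \<Rightarrow> complex) \<Rightarrow> (real^'d \<Rightarrow> complex) \<Rightarrow>
     (real^'d \<Rightarrow> complex) \<Rightarrow> nat \<Rightarrow> real^'d \<Rightarrow> complex" where
  "sampling_partial_sum M j N a \<phi> f R x =
     of_real (\<bar>det M\<bar> powr (- of_int j / 2)) *
     (\<Sum>k\<in>{k. \<forall>i. \<bar>k $ i\<bar> \<le> int R}.
        diff_op N a (\<lambda>y. f (matrix_powi M (- j) *v y)) (- int_vec k) * dilate_shift M \<phi> j k x)"

end

theory Submission
  imports Defs "HOL-Probability.Probability" "HOL-Real_Asymp.Real_Asymp"
begin

text \<open>
  Fourier inversion gives \<open>f x = \<integral> g \<xi> e(x \<bullet> \<xi>) d\<xi>\<close>, where \<open>e t = exp (2\<pi>\<i>t)\<close> and \<open>g\<close> is the Fourier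
  transform of \<open>f\<close>, so that the sampled values
  are \<open>\<integral> g \<xi> A(T\<xi>) e(- k \<bullet> T\<xi>) d\<xi>\<close>, where \<open>A\<close> is the symbol of \<open>L\<close> and \<open>T = M\<^sup>*\<^sup>-\<^sup>j\<close>.  With \<open>y = M\<^sup>j x\<close> the
  cubic partial sum is \<open>\<integral> g \<xi> A(T\<xi>) S\<^sub>R(T\<xi>) d\<xi>\<close>, where \<open>S\<^sub>R\<close> is the cubic partial sum of the Fourier series
  of the periodization of \<open>\<eta> s = \<theta> s e(y \<bullet> s)\<close> and \<open>\<theta>\<close> is the Fourier transform of \<open>\<phi>\<close>.  As
  \<open>g\<close> is merely integrable, one needs \<open>S\<^sub>R\<close> to be uniformly bounded and to converge almost everywhere.
  Since \<open>\<theta>\<close> is \<open>d\<close> times continuously differentiable on its box, \<open>\<eta>\<close> is on that box the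
  distribution function of an integrable density.  Hence \<open>S\<^sub>R\<close> is a superposition of products of
  one-dimensional partial sums for indicator functions of intervals, and these reduce to the
  boundedly convergent sawtooth series.  Compatibility leaves only the translate \<open>0\<close> of the
  periodization on the relevant set, where \<open>\<theta> A = 1\<close>, so the limit is \<open>\<integral> g \<xi> e(y \<bullet> T\<xi>) d\<xi> = f x\<close>.

  The Fourier transforms of distributions are identified with concrete functions by testing against
  Gaussians only, which are Schwartz functions with explicit transforms.
\<close>

section \<open>The sawtooth series and the Dirichlet kernel\<close>

text \<open>The obstacle is that \<open>\<theta>\<close> may jump across the faces of its box. The
  samples of \<open>\<phi>\<close> then need not be absolutely summable, and
  \<open>S\<^sub>R\<close> shows the Gibbs phenomenon: it does not converge uniformly and may miss
  the intended value on the integer translates of the faces. These form a null set, so a uniform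
  bound is what remains to be found. Boundedness of \<open>\<eta>\<close> cannot supply it, because
  the L1 norms of the Dirichlet kernels are unbounded. The integral of a kernel over an interval,
  however, is bounded independently of the interval's position and of \<open>R\<close>, which is an
  argument by bounded variation. In several variables it needs a density obtained by differentiating
  once in each coordinate, hence the order \<open>d\<close> of smoothness, and it needs kernels that
  are products, which is what summation over cubes provides. In the limit each interval integral
  counts the integer translates of a point that fall into the interval; multiplying the counts and
  integrating against the density gives back the sum of the values of \<open>\<eta>\<close> at these
  translates.\<close>

definition saw :: "nat \<Rightarrow> real \<Rightarrow> real" where
  "saw R x = (\<Sum>k=1..R. sin (2 * pi * real k * x) / (pi * real k))"

text \<open>Multiplied by the sine the sum telescopes. The product form avoids a division at
  integers \<open>x\<close>.\<close>

lemma cos_sum_dirichlet: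
  "sin (pi * x) * (1 + (\<Sum>k=1..R. 2 * cos (2 * pi * real k * x))) = sin ((2 * real R + 1) * pi * x)"
proof (induction R)
  case 0
  show ?case by simp
next
  case (Suc R)
  have "sin (pi * x) * (2 * cos (2 * pi * real (Suc R) * x))
      = sin ((2 * real (Suc R) + 1) * pi * x) - sin ((2 * real R + 1) * pi * x)"
    using sin_diff_sin[of "(2 * real (Suc R) + 1) * pi * x" "(2 * real R + 1) * pi * x"]
    by (simp add: algebra_simps add_divide_distrib diff_divide_distrib)
  with Suc show ?case
    by (simp add: algebra_simps)
qed

lemma saw_deriv:
  "(saw R has_real_derivative (\<Sum>k=1..R. 2 * cos (2 * pi * real k * x))) (at x within S)"
proof -
  have "((\<lambda>x. sin (2 * pi * real k * x) / (pi * real k)) has_real_derivative 2 * cos (2 * pi * real k * x))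
      (at x within S)" if "k \<in> {1..R}" for k
    using that by (auto intro!: derivative_eq_intros simp: field_simps)
  then have "((\<lambda>x. \<Sum>k=1..R. sin (2 * pi * real k * x) / (pi * real k)) has_real_derivative
      (\<Sum>k=1..R. 2 * cos (2 * pi * real k * x))) (at x within S)"
    by (intro DERIV_sum)
  then show ?thesis
    by (simp add: saw_def[abs_def])
qed

lemma sin_pi_mult_pos: "0 < x \<Longrightarrow> x \<le> 1/2 \<Longrightarrow> 0 < sin (pi * x)"
  by (intro sin_gt_zero) (auto simp: field_simps)

text \<open>The difference vanishes at \<open>1/2\<close> and has derivative
  \<open>sin (r * pi * x) / sin (pi * x)\<close> with \<open>r = 2 * real R + 1\<close>, so
  integration by parts gains a factor \<open>1 / r\<close>. Here \<open>e\<close> is the difference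
  without the boundary term of that integration, and \<open>b\<close> is chosen so that its decrease
  dominates the derivative of \<open>e\<close>. Monotonicity of \<open>e + b\<close> and
  \<open>e - b\<close> then takes the place of estimating an integral.\<close>

lemma saw_estimate:
  assumes x: "0 < x" "x \<le> 1/2"
  shows "\<bar>saw R x - (1/2 - x)\<bar> \<le> 2 / (pi * (2 * real R + 1) * sin (pi * x))"
proof -
  define r where "r = 2 * real R + 1"
  have r: "r > 0" by (simp add: r_def)
  define e where "e = (\<lambda>x. saw R x - (1/2 - x) + cos (r * pi * x) / (r * pi * sin (pi * x)))"
  define b where "b = (\<lambda>x. 1 / (r * pi * sin (pi * x)))"
  have de: "(e has_real_derivative - (cos (r * pi * y) * cos (pi * y) / (r * (sin (pi * y))\<^sup>2))) (at y)"
    and db: "(b has_real_derivative - (cos (pi * y) / (r * (sin (pi * y))\<^sup>2))) (at y)"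
    if y: "0 < y" "y \<le> 1/2" for y
  proof -
    have s: "sin (pi * y) > 0" using y by (rule sin_pi_mult_pos)
    have D: "(\<Sum>k=1..R. 2 * cos (2 * pi * real k * y)) + 1 = sin (r * pi * y) / sin (pi * y)"
      using cos_sum_dirichlet[of y R] s by (simp add: r_def field_simps)
    have "(e has_real_derivative (\<Sum>k=1..R. 2 * cos (2 * pi * real k * y)) + 1
        + ((- sin (r * pi * y) * (r * pi)) * (r * pi * sin (pi * y))
           - cos (r * pi * y) * (r * pi * (cos (pi * y) * pi))) / (r * pi * sin (pi * y))\<^sup>2) (at y)"
      unfolding e_def using s r
      by (auto intro!: derivative_eq_intros saw_deriv simp: power2_eq_square)
    also have "(\<Sum>k=1..R. 2 * cos (2 * pi * real k * y)) + 1
        + ((- sin (r * pi * y) * (r * pi)) * (r * pi * sin (pi * y))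
           - cos (r * pi * y) * (r * pi * (cos (pi * y) * pi))) / (r * pi * sin (pi * y))\<^sup>2
        = - (cos (r * pi * y) * cos (pi * y) / (r * (sin (pi * y))\<^sup>2))"
      unfolding D using s r by (simp add: field_simps power2_eq_square)
    finally show "(e has_real_derivative - (cos (r * pi * y) * cos (pi * y) / (r * (sin (pi * y))\<^sup>2))) (at y)" .
    show "(b has_real_derivative - (cos (pi * y) / (r * (sin (pi * y))\<^sup>2))) (at y)"
      unfolding b_def using s r
      by (auto intro!: derivative_eq_intros simp: field_simps power2_eq_square)
  qed
  have c: "\<bar>cos (r * pi * y) * cos (pi * y) / (r * (sin (pi * y))\<^sup>2)\<bar> \<le> cos (pi * y) / (r * (sin (pi * y))\<^sup>2)"
    if y: "0 < y" "y \<le> 1/2" for y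
  proof -
    have "- (pi / 2) \<le> 0" "0 \<le> pi * y" using y by auto
    then have "- (pi / 2) \<le> pi * y" by (rule order.trans)
    then have "cos (pi * y) \<ge> 0" using y by (intro cos_ge_zero) (auto simp: field_simps)
    moreover have "\<bar>cos (r * pi * y)\<bar> * cos (pi * y) \<le> 1 * cos (pi * y)"
      using calculation by (intro mult_right_mono) auto
    ultimately show ?thesis
      using r by (simp add: abs_mult divide_right_mono)
  qed
  have "e x + b x \<ge> e (1/2) + b (1/2)"
  proof (rule DERIV_nonpos_imp_nonincreasing[OF x(2)])
    fix y assume "x \<le> y" "y \<le> 1/2"
    then have y: "0 < y" "y \<le> 1/2" using x by auto
    show "\<exists>d. ((\<lambda>x. e x + b x) has_real_derivative d) (at y) \<and> d \<le> 0"
      using DERIV_add[OF de[OF y] db[OF y]] c[OF y, unfolded abs_le_iff] by (intro exI conjI) auto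
  qed
  moreover have "e x - b x \<le> e (1/2) - b (1/2)"
  proof (rule DERIV_nonneg_imp_nondecreasing[OF x(2)])
    fix y assume "x \<le> y" "y \<le> 1/2"
    then have y: "0 < y" "y \<le> 1/2" using x by auto
    show "\<exists>d. ((\<lambda>x. e x - b x) has_real_derivative d) (at y) \<and> d \<ge> 0"
      using DERIV_diff[OF de[OF y] db[OF y]] c[OF y, unfolded abs_le_iff] by (intro exI conjI) auto
  qed
  \<comment> \<open>The number \<open>r\<close> is odd, so the cosine vanishes at
    \<open>1/2\<close>; the sines in \<open>saw R (1/2)\<close> are taken at multiples of
    \<open>pi\<close>.\<close>
  moreover have "e (1/2) = 0"
  proof -
    have "saw R (1/2) = 0"
      by (simp add: saw_def sin_npi2 mult.commute)
    moreover have "cos (r * pi * (1/2)) = 0"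
      unfolding cos_zero_iff_int by (rule exI[of _ "2 * int R + 1"]) (simp add: r_def)
    ultimately show ?thesis by (simp add: e_def)
  qed
  moreover have "b (1/2) > 0" using r by (simp add: b_def)
  ultimately have eb: "\<bar>e x\<bar> \<le> b x" by linarith
  have s: "sin (pi * x) > 0" using x by (rule sin_pi_mult_pos)
  have cb: "\<bar>cos (r * pi * x) / (r * pi * sin (pi * x))\<bar> \<le> b x"
    unfolding b_def using s r by (simp add: abs_mult divide_right_mono)
  \<comment> \<open>Restoring the boundary term costs a second \<open>b x\<close>; hence the 2 in
    the claim.\<close>
  have "saw R x - (1/2 - x) = e x - cos (r * pi * x) / (r * pi * sin (pi * x))"
    by (simp add: e_def)
  also have "\<bar>\<dots>\<bar> \<le> \<bar>e x\<bar> + \<bar>cos (r * pi * x) / (r * pi * sin (pi * x))\<bar>"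
    by (rule abs_triangle_ineq4)
  also have "\<dots> \<le> b x + b x"
    by (rule add_mono[OF eb cb])
  also have "b x + b x = 2 / (pi * r * sin (pi * x))"
    by (simp add: b_def mult_ac)
  finally show ?thesis by (simp add: r_def)
qed

text \<open>The Taylor polynomial with its cubic error suffices, since \<open>y^2 \<le> 3\<close> on
  this range.\<close>

lemma sin_ge_half:
  fixes y :: real
  assumes "0 \<le> y" "y \<le> pi / 2"
  shows "y / 2 \<le> sin y"
proof -
  have "\<bar>sin y - (\<Sum>m<3. sin_coeff m * y ^ m)\<bar> \<le> inverse (fact 3) * \<bar>y\<bar> ^ 3"
    by (rule Maclaurin_sin_bound)
  moreover have "(\<Sum>m<3. sin_coeff m * y ^ m) = y"
    by (simp add: numeral_3_eq_3 sin_coeff_def)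
  moreover have "inverse (fact 3) * \<bar>y\<bar> ^ 3 \<le> y / 2"
  proof -
    have "y \<le> 1.6" using assms pi_approx by simp
    then have "y * y \<le> 1.6 * 1.6" using assms by (intro mult_mono) auto
    then have "y * (y * y) \<le> y * 3" using assms by (intro mult_left_mono) auto
    then show ?thesis using assms by (simp add: power3_eq_cube fact_numeral mult_ac)
  qed
  ultimately show ?thesis by linarith
qed

text \<open>By \<open>sin_ge_half\<close> and \<open>pi^2 \<ge> 8\<close>, the product
  \<open>pi * sin (pi * x)\<close> is at least \<open>4 * x\<close>.\<close>

lemma saw_estimate':
  assumes x: "0 < x" "x \<le> 1/2"
  shows "\<bar>saw R x - (1/2 - x)\<bar> \<le> 1 / (2 * (2 * real R + 1) * x)"
proof -
  have s: "pi * x / 2 \<le> sin (pi * x)"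
    using x by (intro sin_ge_half) (auto simp: field_simps)
  have "8 * x \<le> (pi * pi) * x"
    using x mult_mono[of 3 pi 3 pi] pi_gt3 by (intro mult_right_mono) auto
  moreover have "pi * (pi * x / 2) \<le> pi * sin (pi * x)"
    using s by (intro mult_left_mono) auto
  ultimately have "4 * x \<le> pi * sin (pi * x)"
    by argo
  then have "(2 * real R + 1) * (4 * x) \<le> (2 * real R + 1) * (pi * sin (pi * x))"
    by (intro mult_left_mono) auto
  then have "2 / ((2 * real R + 1) * (pi * sin (pi * x))) \<le> 2 / ((2 * real R + 1) * (4 * x))"
    using x by (intro divide_left_mono mult_pos_pos) (auto intro!: sin_pi_mult_pos)
  moreover have "2 / (r * (4 * x)) = 1 / (2 * r * x)" for r
    by simp
  ultimately show ?thesis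
    using saw_estimate[OF x, of R] by (simp add: mult.assoc mult.left_commute[of pi])
qed

text \<open>If \<open>(2 * real R + 1) * x \<ge> 1\<close>, the error against \<open>1/2 - x\<close>
  is at most \<open>1/2\<close>, and so is \<open>1/2 - x\<close>. Otherwise few terms matter: each
  of the \<open>R\<close> terms is at most \<open>2 * x\<close>.\<close>

lemma saw_bound_half:
  assumes x: "0 < x" "x \<le> 1/2"
  shows "\<bar>saw R x\<bar> \<le> 1"
proof (cases "(2 * real R + 1) * x \<ge> 1")
  case True
  have "1 / (2 * ((2 * real R + 1) * x)) \<le> 1 / 2"
    using True by (simp add: field_simps)
  with saw_estimate'[OF x, of R] have "\<bar>saw R x - (1/2 - x)\<bar> \<le> 1 / 2"
    by (simp add: mult_ac)
  then show ?thesis using x by argo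
next
  case False
  have "\<bar>saw R x\<bar> \<le> (\<Sum>k=1..R. 2 * x)"
    unfolding saw_def
  proof (rule order.trans[OF sum_abs sum_mono])
    fix k assume "k \<in> {1..R}"
    then show "\<bar>sin (2 * pi * real k * x) / (pi * real k)\<bar> \<le> 2 * x"
      using abs_sin_x_le_abs_x[of "2 * pi * real k * x"] x
      by (auto simp: field_simps abs_mult)
  qed
  also have "\<dots> = 2 * real R * x" by simp
  also have "\<dots> \<le> 1" using False x by (simp add: algebra_simps)
  finally show ?thesis .
qed

lemma saw_tendsto_half:
  assumes x: "0 < x" "x \<le> 1/2"
  shows "(\<lambda>R. saw R x) \<longlonglongrightarrow> 1/2 - x"
proof -
  have "(\<lambda>R. 1 / (2 * (2 * real R + 1) * x)) \<longlonglongrightarrow> 0"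
    using x by real_asymp
  then have "(\<lambda>R. saw R x - (1/2 - x)) \<longlonglongrightarrow> 0"
    by (rule Lim_null_comparison[rotated]) (use saw_estimate'[OF x] in auto)
  then show ?thesis
    by (simp add: LIM_zero_iff)
qed

lemma saw_one_minus: "saw R (1 - x) = - saw R x"
proof -
  have "sin (2 * pi * real k * (1 - x)) = - sin (2 * pi * real k * x)" for k
    using sin_diff[of "2 * pi * real k" "2 * pi * real k * x"] sin_2npi[of k] cos_2npi[of k]
    by (simp add: algebra_simps)
  then show ?thesis
    by (simp add: saw_def sum_negf)
qed

lemma saw_frac: "saw R (frac x) = saw R x"
proof -
  have "sin (2 * pi * real k * frac x) = sin (2 * pi * real k * x)" for k
  proof -
    have "2 * pi * real k * frac x = 2 * pi * real k * x - 2 * pi * of_int (int k * \<lfloor>x\<rfloor>)"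
      by (simp add: frac_def algebra_simps)
    also have "sin \<dots> = sin (2 * pi * real k * x)"
      using sin_int_2pin[of "int k * \<lfloor>x\<rfloor>"] cos_int_2pin[of "int k * \<lfloor>x\<rfloor>"]
      by (simp only: sin_diff mult_1_right mult_zero_right diff_zero)
    finally show ?thesis .
  qed
  then show ?thesis
    by (simp add: saw_def)
qed

text \<open>Periodicity and the antisymmetry about \<open>1/2\<close> reduce to the half period; at
  integers every term vanishes.\<close>

lemma saw_bound: "\<bar>saw R x\<bar> \<le> 1"
proof (cases "frac x = 0")
  case True
  then have "saw R x = saw R 0" using saw_frac[of R x] by metis
  then show ?thesis by (simp add: saw_def)
next
  case False
  then have "frac x > 0" using frac_ge_0[of x] by linarith
  then have "\<bar>saw R (frac x)\<bar> \<le> 1"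
    using saw_bound_half[of "frac x" R] saw_bound_half[of "1 - frac x" R] saw_one_minus[of R "frac x"]
      frac_lt_1[of x] by (cases "frac x \<le> 1/2") auto
  then show ?thesis by (simp add: saw_frac)
qed

lemma saw_tendsto:
  assumes "x \<notin> \<int>"
  shows "(\<lambda>R. saw R x) \<longlonglongrightarrow> 1/2 - frac x"
proof -
  have 0: "frac x > 0" using assms by (simp add: frac_gt_0_iff)
  have "(\<lambda>R. saw R (frac x)) \<longlonglongrightarrow> 1/2 - frac x"
  proof (cases "frac x \<le> 1/2")
    case True
    with 0 show ?thesis by (rule saw_tendsto_half)
  next
    case False
    then have "(\<lambda>R. saw R (1 - frac x)) \<longlonglongrightarrow> 1/2 - (1 - frac x)"
      using frac_lt_1[of x] by (intro saw_tendsto_half) auto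
    then have "(\<lambda>R. - (- saw R (frac x))) \<longlonglongrightarrow> - (1/2 - (1 - frac x))"
      unfolding saw_one_minus by (rule tendsto_minus)
    then show ?thesis by simp
  qed
  then show ?thesis by (simp add: saw_frac)
qed

definition dirichlet :: "nat \<Rightarrow> real \<Rightarrow> complex" where
  "dirichlet R z = (\<Sum>k=-int R..int R. cis (2 * pi * of_int k * z))"

lemma dirichlet_eq: "dirichlet R z = of_real (1 + (\<Sum>k=1..R. 2 * cos (2 * pi * real k * z)))"
proof (induction R)
  case 0
  show ?case by (simp add: dirichlet_def)
next
  case (Suc R)
  have "{-int (Suc R)..int (Suc R)} = insert (- int (Suc R)) (insert (int (Suc R)) {-int R..int R})"
    by auto
  then have "dirichlet (Suc R) z = cis (2 * pi * of_int (- int (Suc R)) * z)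
      + (cis (2 * pi * of_int (int (Suc R)) * z) + dirichlet R z)"
    unfolding dirichlet_def by simp
  moreover have "cis (2 * pi * of_int (- int (Suc R)) * z) = cis (- (2 * pi * real (Suc R) * z))"
    by (simp only: of_int_minus of_int_of_nat_eq mult_minus_right mult_minus_left)
  moreover have "cis (2 * pi * of_int (int (Suc R)) * z) = cis (2 * pi * real (Suc R) * z)"
    by (simp only: of_int_of_nat_eq)
  moreover have "cis (- y) + (cis y + c) = of_real (2 * cos y) + c" for y c
    by (simp add: complex_eq_iff)
  ultimately have "dirichlet (Suc R) z = of_real (2 * cos (2 * pi * real (Suc R) * z)) + dirichlet R z"
    by (simp only:)
  then show ?case
    by (simp add: Suc)
qed

lemma continuous_on_dirichlet [continuous_intros]:
  "continuous_on S f \<Longrightarrow> continuous_on S (\<lambda>x. dirichlet R (f x))"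
  unfolding dirichlet_def by (intro continuous_intros)

text \<open>By \<open>saw_deriv\<close> and \<open>dirichlet_eq\<close>, \<open>x + saw R x\<close>
  is a primitive of the kernel.\<close>

lemma dirichlet_integral:
  assumes "t \<le> u"
  shows "(\<integral>s. indicator {t..u} s *\<^sub>R dirichlet R (x - s) \<partial>lborel)
    = of_real ((u - t) + saw R (x - t) - saw R (x - u))"
proof -
  have "(\<integral>s. indicator {t..u} s *\<^sub>R dirichlet R (x - s) \<partial>lborel)
      = of_real (- ((x - u) + saw R (x - u))) - of_real (- ((x - t) + saw R (x - t)))"
  proof (rule integral_FTC_atLeastAtMost[OF assms])
    fix s
    have "((\<lambda>s. - ((x - s) + saw R (x - s))) has_real_derivative
        1 + (\<Sum>k=1..R. 2 * cos (2 * pi * real k * (x - s)))) (at s within {t..u})"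
    proof -
      have d: "((\<lambda>s. x - s) has_real_derivative -1) (at s within {t..u})"
        by (auto intro!: derivative_eq_intros)
      from DERIV_add[OF d DERIV_chain2[where f="saw R", OF saw_deriv d], THEN DERIV_minus]
      show ?thesis by (simp add: add.commute)
    qed
    then show "((\<lambda>s. complex_of_real (- ((x - s) + saw R (x - s)))) has_vector_derivative
        dirichlet R (x - s)) (at s within {t..u})"
      unfolding dirichlet_eq by (rule has_vector_derivative_of_real)
  qed (auto intro!: continuous_intros)
  then show ?thesis by simp
qed

text \<open>The limit counts the integer translates of \<open>x\<close> in \<open>[t, u]\<close>.\<close>

lemma dirichlet_integral_tendsto:
  assumes "x - t \<notin> \<int>" "x - u \<notin> \<int>"
  shows "(\<lambda>R. (u - t) + saw R (x - t) - saw R (x - u)) \<longlonglongrightarrow> of_int (\<lfloor>x - t\<rfloor> - \<lfloor>x - u\<rfloor>)"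
proof -
  have "(\<lambda>R. (u - t) + saw R (x - t) - saw R (x - u)) \<longlonglongrightarrow>
      (u - t) + (1/2 - frac (x - t)) - (1/2 - frac (x - u))"
    by (intro tendsto_intros saw_tendsto assms)
  then show ?thesis
    by (simp add: frac_def)
qed

section \<open>Lebesgue measure in coordinates\<close>

lemma Basis_vec_real: "(Basis :: (real^'d) set) = range (\<lambda>i. axis i 1)"
  by (auto simp: Basis_vec_def)

lemma prod_Basis_vec: "(\<Prod>b\<in>(Basis :: (real^'d) set). f b) = (\<Prod>i\<in>UNIV. f (axis i 1))"
  unfolding Basis_vec_real by (subst prod.reindex) (auto simp: inj_on_def axis_eq_axis)

lemma borel_measurable_vec_lambda [measurable (raw)]:
  fixes f :: "'a \<Rightarrow> 'd::finite \<Rightarrow> real"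
  assumes "\<And>i. (\<lambda>x. f x i) \<in> borel_measurable M"
  shows "(\<lambda>x. \<chi> i. f x i) \<in> borel_measurable M"
  unfolding borel_measurable_euclidean_space[where f="\<lambda>x. \<chi> i. f x i"]
  using assms by (auto simp: Basis_vec_real inner_axis)

lemma borel_measurable_vec_component [measurable (raw)]:
  fixes f :: "'a \<Rightarrow> real^'d"
  assumes "f \<in> borel_measurable M"
  shows "(\<lambda>x. f x $ i) \<in> borel_measurable M"
  using measurable_compose[OF assms borel_measurable_continuous_onI[OF continuous_on_component[OF continuous_on_id]]]
  by simp

interpretation lborel_family: product_sigma_finite "\<lambda>_::'i. lborel :: real measure"
  by standard

text \<open>Comparing the measures of boxes suffices. This transfers the theorems on finite product
  measures, in particular the factorization of integrals of products, to
  \<open>real^'d\<close>.\<close>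

lemma lborel_vec_eq:
  "(lborel :: (real^'d) measure) = distr (\<Pi>\<^sub>M i\<in>UNIV. lborel) borel (\<lambda>t. \<chi> i. t i)"
proof (rule lborel_eqI)
  fix l u :: "real^'d"
  assume le: "\<And>b. b \<in> Basis \<Longrightarrow> l \<bullet> b \<le> u \<bullet> b"
  then have le': "l $ i \<le> u $ i" for i
    by (metis Basis_vec_real inner_axis' mult.right_neutral rangeI inner_commute real_inner_1_right inner_axis)
  have "emeasure (distr (\<Pi>\<^sub>M i\<in>UNIV. lborel) borel (\<lambda>t. \<chi> i. t i)) (box l u)
      = emeasure (\<Pi>\<^sub>M i\<in>(UNIV::'d set). lborel) (\<Pi>\<^sub>E i\<in>UNIV. {l $ i<..<u $ i})"
    by (subst emeasure_distr)
      (auto intro!: arg_cong2[where f=emeasure] simp: space_PiM PiE_def Pi_def mem_box_cart)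
  also have "\<dots> = (\<Prod>i\<in>UNIV. emeasure lborel {l $ i<..<u $ i})"
    by (subst lborel_family.emeasure_PiM) auto
  also have "\<dots> = ennreal (\<Prod>i\<in>UNIV. u $ i - l $ i)"
    using le' by (simp add: prod_ennreal)
  finally show "emeasure (distr (\<Pi>\<^sub>M i\<in>UNIV. lborel) borel (\<lambda>t. \<chi> i. t i)) (box l u)
      = (\<Prod>b\<in>Basis. (u - l) \<bullet> b)"
    by (simp add: prod_Basis_vec inner_axis)
qed simp

lemma integral_lborel_vec:
  fixes f :: "real^'d \<Rightarrow> 'b::{banach, second_countable_topology}"
  assumes "f \<in> borel_measurable borel"
  shows "(\<integral>x. f x \<partial>lborel) = (\<integral>t. f (\<chi> i. t i) \<partial>(\<Pi>\<^sub>M i\<in>UNIV. lborel))"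
  by (subst lborel_vec_eq, subst integral_distr) (use assms in auto)

lemma integrable_lborel_vec:
  fixes f :: "real^'d \<Rightarrow> 'b::{banach, second_countable_topology}"
  assumes "f \<in> borel_measurable borel"
  shows "integrable lborel f \<longleftrightarrow> integrable (\<Pi>\<^sub>M i\<in>UNIV. lborel) (\<lambda>t. f (\<chi> i. t i))"
  by (subst lborel_vec_eq, subst integrable_distr_eq) (use assms in auto)

lemma integral_prod_vec:
  fixes f :: "'d::finite \<Rightarrow> real \<Rightarrow> complex"
  assumes "\<And>i. integrable lborel (f i)"
  shows "(\<integral>x. (\<Prod>i\<in>UNIV. f i (x $ i)) \<partial>(lborel :: (real^'d) measure)) = (\<Prod>i\<in>UNIV. \<integral>x. f i x \<partial>lborel)"
proof -
  have [measurable]: "f i \<in> borel_measurable borel" for i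
    using assms[of i] by auto
  show ?thesis
    by (subst integral_lborel_vec) (simp_all add: lborel_family.product_integral_prod[OF finite assms])
qed

lemma integrable_prod_vec:
  fixes f :: "'d::finite \<Rightarrow> real \<Rightarrow> 'b::{real_normed_field, banach, second_countable_topology}"
  assumes "\<And>i. integrable lborel (f i)"
  shows "integrable lborel (\<lambda>x::real^'d. \<Prod>i\<in>UNIV. f i (x $ i))"
proof -
  have [measurable]: "f i \<in> borel_measurable borel" for i
    using assms[of i] by auto
  show ?thesis
    by (subst integrable_lborel_vec) (simp_all add: lborel_family.product_integrable_prod[OF finite assms])
qed

text \<open>The new coordinate is integrated last. In the induction that builds the density, the
  inner integral is then the one of the induction hypothesis, and the fundamental theorem of
  calculus acts in the outer variable.\<close>

lemma (in product_sigma_finite) product_integral_insert_rev: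
  fixes f :: "_ \<Rightarrow> _::{banach, second_countable_topology}"
  assumes I: "finite I" "i \<notin> I"
    and f: "integrable (Pi\<^sub>M (insert i I) M) f"
  shows "integral\<^sup>L (Pi\<^sub>M (insert i I) M) f = (\<integral>y. (\<integral>x. f (x(i:=y)) \<partial>Pi\<^sub>M I M) \<partial>M i)"
proof -
  interpret I: finite_product_sigma_finite M I by standard fact
  have f_borel [measurable]: "f \<in> borel_measurable (Pi\<^sub>M (insert i I) M)"
    using f by auto
  have m: "(\<lambda>y. \<integral>x. f (x(i := y)) \<partial>Pi\<^sub>M I M) \<in> borel_measurable (M i)"
  proof (rule I.borel_measurable_lebesgue_integral)
    have "(\<lambda>(y, x). x(i := y)) \<in> M i \<Otimes>\<^sub>M Pi\<^sub>M I M \<rightarrow>\<^sub>M Pi\<^sub>M (insert i I) M"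
      by (simp add: split_beta')
    from measurable_comp[OF this f_borel]
    show "(\<lambda>(y, x). f (x(i := y))) \<in> borel_measurable (M i \<Otimes>\<^sub>M Pi\<^sub>M I M)"
      by (simp add: comp_def split_beta')
  qed
  have "integral\<^sup>L (Pi\<^sub>M (insert i I) M) f = integral\<^sup>L (Pi\<^sub>M ({i} \<union> I) M) f"
    by simp
  also have "\<dots> = (\<integral>y. (\<integral>x. f (merge {i} I (y, x)) \<partial>Pi\<^sub>M I M) \<partial>Pi\<^sub>M {i} M)"
    using f I by (intro product_integral_fold) auto
  also have "\<dots> = (\<integral>y. (\<integral>x. f (x(i := y i)) \<partial>Pi\<^sub>M I M) \<partial>Pi\<^sub>M {i} M)"
    by (intro Bochner_Integration.integral_cong refl arg_cong[where f=f])
      (use I in \<open>auto simp: merge_def space_PiM extensional_def PiE_def fun_eq_iff\<close>)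
  also have "\<dots> = (\<integral>y. (\<integral>x. f (x(i := y)) \<partial>Pi\<^sub>M I M) \<partial>M i)"
    by (rule product_integral_singleton[OF m])
  finally show ?thesis .
qed

text \<open>An intermediate stage of an induction on coordinates: those in \<open>I\<close> have
  become integration variables, the others are still arguments of the function.\<close>

definition vec_merge :: "'d set \<Rightarrow> ('d \<Rightarrow> real) \<Rightarrow> real^'d \<Rightarrow> real^'d" where
  "vec_merge I t s = (\<chi> i. if i \<in> I then t i else s $ i)"

definition vec_upd :: "real^'d \<Rightarrow> 'd \<Rightarrow> real \<Rightarrow> real^'d" where
  "vec_upd s i a = (\<chi> j. if j = i then a else s $ j)"

lemma vec_upd_nth [simp]: "vec_upd s i a $ j = (if j = i then a else s $ j)"
  by (simp add: vec_upd_def)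

lemma vec_upd_same [simp]: "vec_upd s i (s $ i) = s"
  by (simp add: vec_eq_iff)

lemma vec_upd_measurable [measurable]: "(\<lambda>s. vec_upd s i a) \<in> borel_measurable borel"
  unfolding vec_upd_def by (rule borel_measurable_vec_lambda) measurable

lemma vec_merge_measurable [measurable]:
  "(\<lambda>t. vec_merge I t s) \<in> borel_measurable (\<Pi>\<^sub>M i\<in>I. lborel)"
  unfolding vec_merge_def
proof (rule borel_measurable_vec_lambda)
  show "(\<lambda>t. if i \<in> I then t i else s $ i) \<in> borel_measurable (\<Pi>\<^sub>M i\<in>I. lborel)" for i
    by (cases "i \<in> I") auto
qed

lemma integrable_bounded_box:
  fixes w :: "real^'d \<Rightarrow> complex"
  assumes [measurable]: "w \<in> borel_measurable borel" and C: "\<And>s. norm (w s) \<le> C"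
    and supp: "\<And>s i. w s \<noteq> 0 \<Longrightarrow> i \<in> I \<Longrightarrow> l i \<le> s $ i \<and> s $ i \<le> u i"
  shows "integrable (\<Pi>\<^sub>M i\<in>I. lborel) (\<lambda>t. w (vec_merge I t s) * (\<Prod>i\<in>I. indicator {..s $ i} (t i)))"
proof (rule integrableI_bounded_set[where A="\<Pi>\<^sub>E i\<in>I. {l i..u i}" and B=C])
  have "emeasure (\<Pi>\<^sub>M i\<in>I. lborel) (\<Pi>\<^sub>E i\<in>I. {l i..u i}) = (\<Prod>i\<in>I. emeasure lborel {l i..u i})"
    by (subst lborel_family.emeasure_PiM) auto
  also have "\<dots> < \<infinity>"
    by (simp add: less_top[symmetric] ennreal_prod_eq_top emeasure_lborel_Icc_eq)
  finally show "emeasure (\<Pi>\<^sub>M i\<in>I. lborel) (\<Pi>\<^sub>E i\<in>I. {l i..u i}) < \<infinity>" .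
  have C0: "C \<ge> 0" using C[of 0] norm_ge_zero order_trans by blast
  have "norm (\<Prod>i\<in>I. indicator {..s $ i} (t i) :: complex) \<le> 1" for t
    unfolding prod_norm[symmetric] by (rule prod_le_1) (auto simp: indicator_def)
  then have "norm (w (vec_merge I t s)) * norm (\<Prod>i\<in>I. indicator {..s $ i} (t i) :: complex) \<le> C * 1" for t
    using C C0 by (intro mult_mono) auto
  then show "AE t in (\<Pi>\<^sub>M i\<in>I. lborel). t \<in> (\<Pi>\<^sub>E i\<in>I. {l i..u i}) \<longrightarrow>
      norm (w (vec_merge I t s) * (\<Prod>i\<in>I. indicator {..s $ i} (t i))) \<le> C"
    by (simp add: norm_mult)
  show "AE t in (\<Pi>\<^sub>M i\<in>I. lborel). t \<notin> (\<Pi>\<^sub>E i\<in>I. {l i..u i}) \<longrightarrow>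
      w (vec_merge I t s) * (\<Prod>i\<in>I. indicator {..s $ i} (t i)) = 0"
  proof (rule AE_I2, rule impI)
    fix t :: "'d \<Rightarrow> real"
    assume t: "t \<in> space (\<Pi>\<^sub>M i\<in>I. lborel)" "t \<notin> (\<Pi>\<^sub>E i\<in>I. {l i..u i})"
    then obtain i where "i \<in> I" "\<not> (l i \<le> t i \<and> t i \<le> u i)"
      by (auto simp: space_PiM PiE_def Pi_def)
    with supp[of "vec_merge I t s" i] show "w (vec_merge I t s) * (\<Prod>i\<in>I. indicator {..s $ i} (t i)) = 0"
      by (auto simp: vec_merge_def)
  qed
qed (auto intro!: sets_PiM_I_finite)

section \<open>Smooth functions on a box as distribution functions of integrable densities\<close>

lemma Ck_on_imp_continuous_on: "Ck_on k S f \<Longrightarrow> continuous_on S f"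
  by (cases k) auto

lemma Ck_on_Suc_imp: "Ck_on (Suc k) S f \<Longrightarrow> Ck_on k S f"
proof (induction k arbitrary: f)
  case (Suc k)
  from Suc.prems have "\<exists>f'. (\<forall>x\<in>S. ((\<lambda>t. f (x + t *\<^sub>R axis i 1)) has_vector_derivative f' x)
                        (at 0 within {t. x + t *\<^sub>R axis i 1 \<in> S})) \<and> Ck_on (Suc k) S f'" for i
    unfolding Ck_on.simps(2)[of "Suc k"] by blast
  with Suc.IH have "\<exists>f'. (\<forall>x\<in>S. ((\<lambda>t. f (x + t *\<^sub>R axis i 1)) has_vector_derivative f' x)
                        (at 0 within {t. x + t *\<^sub>R axis i 1 \<in> S})) \<and> Ck_on k S f'" for i
    by blast
  moreover have "continuous_on S f" using Suc.prems by (rule Ck_on_imp_continuous_on)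
  ultimately show ?case by simp
qed auto

lemma vec_upd_mem_cbox:
  assumes "s \<in> cbox l u" "l $ i \<le> a" "a \<le> u $ i"
  shows "vec_upd s i a \<in> cbox l u"
  using assms by (auto simp: mem_box_cart)

lemma continuous_on_vec_upd [continuous_intros]:
  "continuous_on A f \<Longrightarrow> continuous_on A (\<lambda>y. vec_upd s i (f y))"
  unfolding vec_upd_def
proof (rule continuous_on_vec_lambda)
  show "continuous_on A (\<lambda>y. if j = i then f y else s $ j)" if "continuous_on A f" for j
    using that by (cases "j = i") auto
qed

text \<open>The derivative in \<open>Ck_on\<close> is taken at parameter 0 along the line through
  each point; translating the parameter by \<open>y\<close> turns it into the derivative of one
  function of \<open>y\<close> on the interval, one-sided at the faces.\<close>

lemma coordinate_FTC:
  assumes lu: "l $ i \<le> u $ i" and s: "s \<in> cbox l u"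
    and d: "\<forall>x\<in>cbox l u. ((\<lambda>t. \<eta> (x + t *\<^sub>R axis i 1)) has_vector_derivative \<eta>' x)
                        (at 0 within {t. x + t *\<^sub>R axis i 1 \<in> cbox l u})"
    and c: "continuous_on (cbox l u) \<eta>'"
  shows "(\<integral>y. indicator {l $ i..s $ i} y *\<^sub>R \<eta>' (vec_upd s i y) \<partial>lborel)
      = \<eta> s - (\<eta> (vec_upd s i (l $ i)) :: complex)"
proof -
  have si: "l $ i \<le> s $ i" "s $ i \<le> u $ i" using s by (auto simp: mem_box_cart)
  have "(\<integral>y. indicator {l $ i..s $ i} y *\<^sub>R \<eta>' (vec_upd s i y) \<partial>lborel)
      = \<eta> (vec_upd s i (s $ i)) - \<eta> (vec_upd s i (l $ i))"
  proof (rule integral_FTC_atLeastAtMost[OF si(1)])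
    fix y assume y: "l $ i \<le> y" "y \<le> s $ i"
    define x where "x = vec_upd s i y"
    have x: "x + (z - y) *\<^sub>R axis i 1 = vec_upd s i z" for z
      by (auto simp: vec_eq_iff x_def axis_def)
    have "((\<lambda>t. \<eta> (x + t *\<^sub>R axis i 1)) has_vector_derivative \<eta>' x)
        (at 0 within {t. x + t *\<^sub>R axis i 1 \<in> cbox l u})"
      using d y si s by (auto simp: x_def intro!: vec_upd_mem_cbox bspec[OF d])
    then have "((\<lambda>t. \<eta> (x + t *\<^sub>R axis i 1)) has_vector_derivative \<eta>' x)
        (at ((\<lambda>z. z - y) y) within ((\<lambda>z. z - y) ` {l $ i..s $ i}))"
      unfolding diff_self using y si s
      by (elim has_vector_derivative_within_subset) (auto simp: x[of "_ + y", simplified] x intro!: vec_upd_mem_cbox)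
    moreover have "((\<lambda>z. z - y) has_vector_derivative 1) (at y within {l $ i..s $ i})"
      by (auto intro!: derivative_eq_intros)
    ultimately have "((\<lambda>t. \<eta> (x + t *\<^sub>R axis i 1)) \<circ> (\<lambda>z. z - y) has_vector_derivative 1 *\<^sub>R \<eta>' x)
        (at y within {l $ i..s $ i})"
      by (rule vector_diff_chain_within[rotated])
    then show "((\<lambda>y. \<eta> (vec_upd s i y)) has_vector_derivative \<eta>' (vec_upd s i y)) (at y within {l $ i..s $ i})"
      by (simp add: comp_def x x_def[symmetric])
  next
    show "continuous_on {l $ i..s $ i} (\<lambda>y. \<eta>' (vec_upd s i y))"
      by (rule continuous_on_compose2[OF c]) (use s si in \<open>auto intro!: continuous_intros vec_upd_mem_cbox\<close>)
  qed
  then show ?thesis by simp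
qed

text \<open>On \<open>[l - 1, l)\<close> the density carries the boundary value of the function, so that no
  point masses are needed.\<close>

lemma Ck_on_coordinate_density:
  fixes \<eta> :: "real^'d \<Rightarrow> complex"
  assumes lu: "\<And>i. l $ i \<le> u $ i"
  shows "finite I \<Longrightarrow> Ck_on (card I) (cbox l u) \<eta> \<Longrightarrow>
    \<exists>w C. w \<in> borel_measurable borel \<and> (\<forall>s. norm (w s) \<le> C) \<and>
      (\<forall>s i. w s \<noteq> 0 \<longrightarrow> i \<in> I \<longrightarrow> l $ i - 1 \<le> s $ i \<and> s $ i \<le> u $ i) \<and>
      (\<forall>s\<in>cbox l u. \<eta> s =
        (\<integral>t. w (vec_merge I t s) * (\<Prod>i\<in>I. indicator {..s $ i} (t i)) \<partial>(\<Pi>\<^sub>M i\<in>I. lborel)))"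
proof (induction I arbitrary: \<eta> rule: finite_induct)
  case empty
  then have c: "continuous_on (cbox l u) \<eta>" by simp
  then have "bounded (\<eta> ` cbox l u)"
    by (intro compact_imp_bounded compact_continuous_image) auto
  then obtain C where C: "\<And>s. s \<in> cbox l u \<Longrightarrow> norm (\<eta> s) \<le> C"
    by (auto simp: bounded_iff)
  let ?w = "\<lambda>s. indicator (cbox l u) s *\<^sub>R \<eta> s"
  have "?w \<in> borel_measurable borel"
    using borel_measurable_continuous_on_indicator[OF _ c] by simp
  moreover have "norm (?w s) \<le> max 0 C" for s
    using C[of s] by (auto simp: indicator_def)
  moreover have "(\<integral>t. ?w (vec_merge {} t s) \<partial>(\<Pi>\<^sub>M i\<in>{}. (lborel::real measure))) = ?w s" for s
    by (simp add: PiM_empty vec_merge_def lebesgue_integral_count_space_finite)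
  ultimately show ?case
    by (intro exI[of _ ?w] exI[of _ "max 0 C"]) auto
next
  case (insert i I)
  from insert.prems insert.hyps have Suc: "Ck_on (Suc (card I)) (cbox l u) \<eta>" by simp
  then obtain \<eta>' where d: "\<forall>x\<in>cbox l u. ((\<lambda>t. \<eta> (x + t *\<^sub>R axis i 1)) has_vector_derivative \<eta>' x)
                        (at 0 within {t. x + t *\<^sub>R axis i 1 \<in> cbox l u})"
    and ck': "Ck_on (card I) (cbox l u) \<eta>'"
    by auto
  \<comment> \<open>The hypothesis serves twice: for \<open>\<eta>\<close>, of which only the values
    on the face where coordinate \<open>i\<close> equals \<open>l $ i\<close> will matter, and for
    the derivative \<open>\<eta>'\<close>. Each coordinate thus consumes one order of
    smoothness.\<close>
  from insert.IH[OF Ck_on_Suc_imp[OF Suc]] obtain w0 C0 where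
    [measurable]: "w0 \<in> borel_measurable borel" and C0: "\<And>s. norm (w0 s) \<le> C0"
    and s0: "\<And>s i. w0 s \<noteq> 0 \<Longrightarrow> i \<in> I \<Longrightarrow> l $ i - 1 \<le> s $ i \<and> s $ i \<le> u $ i"
    and e0: "\<And>s. s \<in> cbox l u \<Longrightarrow> \<eta> s =
        (\<integral>t. w0 (vec_merge I t s) * (\<Prod>i\<in>I. indicator {..s $ i} (t i)) \<partial>(\<Pi>\<^sub>M i\<in>I. lborel))"
    by blast
  from insert.IH[OF ck'] obtain w1 C1 where
    [measurable]: "w1 \<in> borel_measurable borel" and C1: "\<And>s. norm (w1 s) \<le> C1"
    and s1: "\<And>s i. w1 s \<noteq> 0 \<Longrightarrow> i \<in> I \<Longrightarrow> l $ i - 1 \<le> s $ i \<and> s $ i \<le> u $ i"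
    and e1: "\<And>s. s \<in> cbox l u \<Longrightarrow> \<eta>' s =
        (\<integral>t. w1 (vec_merge I t s) * (\<Prod>i\<in>I. indicator {..s $ i} (t i)) \<partial>(\<Pi>\<^sub>M i\<in>I. lborel))"
    by blast
  \<comment> \<open>The strip below \<open>l $ i\<close> has width 1, so integrating the constant
    continuation of \<open>w0\<close> over it in coordinate \<open>i\<close> reproduces the face
    value exactly.\<close>
  define w where "w = (\<lambda>p. if l $ i - 1 \<le> p $ i \<and> p $ i < l $ i then w0 (vec_upd p i (l $ i))
     else if l $ i \<le> p $ i \<and> p $ i \<le> u $ i then w1 p else 0)"
  have w_meas [measurable]: "w \<in> borel_measurable borel"
    unfolding w_def by measurable
  have C: "norm (w s) \<le> max 0 (max C0 C1)" for s
    using C0[of "vec_upd s i (l $ i)"] C1[of s] by (auto simp: w_def)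
  have supp: "l $ k - 1 \<le> s $ k \<and> s $ k \<le> u $ k" if "w s \<noteq> 0" "k \<in> insert i I" for s k
  proof (cases "k = i")
    case True
    then show ?thesis using that lu[of i] by (auto simp: w_def split: if_splits)
  next
    case False
    then show ?thesis
      using that s0[of "vec_upd s i (l $ i)" k] s1[of s k] by (auto simp: w_def split: if_splits)
  qed
  have "\<eta> s = (\<integral>t. w (vec_merge (insert i I) t s) * (\<Prod>j\<in>insert i I. indicator {..s $ j} (t j))
      \<partial>(\<Pi>\<^sub>M j\<in>insert i I. lborel))" if s: "s \<in> cbox l u" for s
  proof -
    have si: "l $ i \<le> s $ i" "s $ i \<le> u $ i" using s by (auto simp: mem_box_cart)
    have sl: "vec_upd s i (l $ i) \<in> cbox l u" using lu s by (intro vec_upd_mem_cbox) auto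
    have "(\<integral>t. w (vec_merge (insert i I) t s) * (\<Prod>j\<in>insert i I. indicator {..s $ j} (t j))
        \<partial>(\<Pi>\<^sub>M j\<in>insert i I. lborel))
      = (\<integral>y. \<integral>x. w (vec_merge (insert i I) (x(i := y)) s) *
          (\<Prod>j\<in>insert i I. indicator {..s $ j} ((x(i := y)) j)) \<partial>(\<Pi>\<^sub>M j\<in>I. lborel) \<partial>lborel)"
      by (rule lborel_family.product_integral_insert_rev[OF insert.hyps])
        (rule integrable_bounded_box[OF w_meas C supp], auto)
    also have "\<dots> = (\<integral>y. indicator {l $ i - 1..<l $ i} y *\<^sub>R \<eta> (vec_upd s i (l $ i))
        + indicator {l $ i..s $ i} y *\<^sub>R \<eta>' (vec_upd s i y) \<partial>lborel)"
    proof (intro Bochner_Integration.integral_cong refl)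
      fix y :: real
      have pr: "(\<Prod>j\<in>insert i I. indicator {..s $ j} ((x(i := y)) j) :: complex)
          = indicator {..s $ i} y * (\<Prod>j\<in>I. indicator {..s $ j} (x j))" for x
        using insert.hyps by (simp add: prod.insert) (intro disjI2 prod.cong, auto)
      have vm: "vec_merge (insert i I) (x(i := y)) s = vec_merge I x (vec_upd s i y)" for x
        using insert.hyps by (auto simp: vec_merge_def vec_eq_iff)
      have vu: "vec_upd (vec_merge I x (vec_upd s i y)) i a = vec_merge I x (vec_upd s i a)" for x a
        using insert.hyps by (auto simp: vec_merge_def vec_eq_iff)
      have vi: "vec_merge I x (vec_upd s i y) $ i = y" for x
        using insert.hyps by (simp add: vec_merge_def)
      have pu: "(\<Prod>j\<in>I. indicator {..vec_upd s i a $ j} (x j) :: complex) = (\<Prod>j\<in>I. indicator {..s $ j} (x j))" for x a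
        using insert.hyps by (intro prod.cong) auto
      \<comment> \<open>As \<open>l $ i \<le> s $ i\<close>, the indicator is 1 on the whole strip;
        above \<open>s $ i\<close> the indicator vanishes, below the strip the density does.\<close>
      consider "l $ i - 1 \<le> y" "y < l $ i" | "l $ i \<le> y" "y \<le> s $ i" | "s $ i < y" | "y < l $ i - 1"
        by linarith
      then show "(\<integral>x. w (vec_merge (insert i I) (x(i := y)) s) *
          (\<Prod>j\<in>insert i I. indicator {..s $ j} ((x(i := y)) j)) \<partial>(\<Pi>\<^sub>M j\<in>I. lborel))
        = indicator {l $ i - 1..<l $ i} y *\<^sub>R \<eta> (vec_upd s i (l $ i))
        + indicator {l $ i..s $ i} y *\<^sub>R \<eta>' (vec_upd s i y)"
      proof cases
        case 1
        then show ?thesis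
          unfolding pr vm w_def vi vu using si e0[OF sl, unfolded pu] by (simp add: indicator_def)
      next
        case 2
        then have "vec_upd s i y \<in> cbox l u" using si s by (intro vec_upd_mem_cbox) auto
        from e1[OF this, unfolded pu] show ?thesis
          unfolding pr vm w_def vi vu using si 2 by (simp add: indicator_def)
      next
        case 3
        then show ?thesis
          unfolding pr vm w_def vi vu using si by (simp add: indicator_def)
      next
        case 4
        then show ?thesis
          unfolding pr vm w_def vi vu using si by (simp add: indicator_def)
      qed
    qed
    also have "\<dots> = (\<integral>y. indicator {l $ i - 1..<l $ i} y *\<^sub>R \<eta> (vec_upd s i (l $ i)) \<partial>lborel)
        + (\<integral>y. indicator {l $ i..s $ i} y *\<^sub>R \<eta>' (vec_upd s i y) \<partial>lborel)"
    proof (rule Bochner_Integration.integral_add)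
      have "continuous_on {l $ i..s $ i} (\<lambda>y. \<eta>' (vec_upd s i y))"
        by (rule continuous_on_compose2[OF Ck_on_imp_continuous_on[OF ck']])
          (use s si in \<open>auto intro!: continuous_intros vec_upd_mem_cbox\<close>)
      from borel_integrable_atLeastAtMost'[OF this]
      show "integrable lborel (\<lambda>y. indicator {l $ i..s $ i} y *\<^sub>R \<eta>' (vec_upd s i y))"
        by (simp add: set_integrable_def)
    qed (intro integrable_scaleR_left integrable_real_indicator, auto)
    also have "\<dots> = \<eta> s"
      by (subst coordinate_FTC[OF lu s d Ck_on_imp_continuous_on[OF ck']]) simp
    finally show ?thesis ..
  qed
  with w_meas C supp show ?case
    by (intro exI[of _ w] exI[of _ "max 0 (max C0 C1)"]) blast
qed

text \<open>The bounded density lives on the box enlarged by one unit downwards and is therefore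
  integrable. The upper bound on its support is kept because the counting limit below needs
  \<open>t \<le> u\<close>.\<close>

lemma Ck_on_density:
  fixes \<eta> :: "real^'d \<Rightarrow> complex"
  assumes lu: "\<And>i. l $ i \<le> u $ i" and "Ck_on CARD('d) (cbox l u) \<eta>"
  obtains w where "integrable lborel w"
    "\<And>s. s \<in> cbox l u \<Longrightarrow> \<eta> s = (\<integral>t. w t * (\<Prod>i\<in>UNIV. indicator {..s $ i} (t $ i)) \<partial>lborel)"
    "\<And>s i. w s \<noteq> 0 \<Longrightarrow> s $ i \<le> u $ i"
proof -
  obtain w C where [measurable]: "w \<in> borel_measurable borel" and C: "\<And>s. norm (w s) \<le> C"
    and supp: "\<And>s i. w s \<noteq> 0 \<Longrightarrow> l $ i - 1 \<le> s $ i \<and> s $ i \<le> u $ i"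
    and e: "\<And>s. s \<in> cbox l u \<Longrightarrow> \<eta> s =
        (\<integral>t. w (vec_merge UNIV t s) * (\<Prod>i\<in>UNIV. indicator {..s $ i} (t i)) \<partial>(\<Pi>\<^sub>M i\<in>UNIV. lborel))"
    using Ck_on_coordinate_density[where I=UNIV, OF lu finite assms(2)]
    unfolding all_simps by blast
  have "integrable lborel w"
  proof (rule integrableI_bounded_set[where A="cbox (l - 1) u" and B=C])
    show "AE s in lborel. s \<notin> cbox (l - 1) u \<longrightarrow> w s = 0"
      using supp by (intro AE_I2) (force simp: mem_box_cart one_vec_def)
    show "emeasure lborel (cbox (l - 1) u) < \<infinity>"
      by (rule emeasure_lborel_cbox_finite)
  qed (use C in auto)
  moreover have "\<eta> s = (\<integral>t. w t * (\<Prod>i\<in>UNIV. indicator {..s $ i} (t $ i)) \<partial>lborel)" if "s \<in> cbox l u" for s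
    by (subst integral_lborel_vec) (simp_all add: e[OF that] vec_merge_def)
  ultimately show ?thesis using supp by (intro that[of w]) auto
qed

section \<open>Cubic Fourier partial sums\<close>

lemma integrable_pair_mult:
  fixes p :: "'a::euclidean_space \<Rightarrow> real" and q :: "'b::euclidean_space \<Rightarrow> real"
  assumes p: "integrable lborel p" and q: "integrable lborel q"
  shows "integrable (lborel \<Otimes>\<^sub>M lborel) (\<lambda>(x, y). p x * q y)"
proof (rule lborel_pair.Fubini_integrable)
  have [measurable]: "p \<in> borel_measurable borel" "q \<in> borel_measurable borel"
    using p q by auto
  show "(\<lambda>(x, y). p x * q y) \<in> borel_measurable (lborel \<Otimes>\<^sub>M lborel)"
    by measurable
  show "integrable lborel (\<lambda>x. \<integral>y. norm (case (x, y) of (x, y) \<Rightarrow> p x * q y) \<partial>lborel)"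
    using p q by (simp add: abs_mult)
  show "AE x in lborel. integrable lborel (\<lambda>y. case (x, y) of (x, y) \<Rightarrow> p x * q y)"
    using q by simp
qed

text \<open>Wherever integrals are interchanged below, the integrand is dominated by a product of
  integrable functions of the separate variables.\<close>

lemma Fubini_bounded:
  fixes f :: "'a::euclidean_space \<Rightarrow> 'b::euclidean_space \<Rightarrow> complex"
  assumes [measurable]: "case_prod f \<in> borel_measurable (borel \<Otimes>\<^sub>M borel)"
    and "integrable lborel p" "integrable lborel q"
    and "\<And>x y. norm (f x y) \<le> p x * q y"
  shows "(\<integral>y. (\<integral>x. f x y \<partial>lborel) \<partial>lborel) = (\<integral>x. (\<integral>y. f x y \<partial>lborel) \<partial>lborel)"
proof (rule lborel_pair.Fubini_integral)
  show "integrable (lborel \<Otimes>\<^sub>M lborel) (case_prod f)"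
    by (rule Bochner_Integration.integrable_bound[OF integrable_pair_mult[OF assms(2,3)]])
      (use assms(4) in \<open>auto intro!: AE_I2 order.trans[OF assms(4)]\<close>)
qed

lemma prod_sum_vec:
  fixes f :: "'d::finite \<Rightarrow> 'a \<Rightarrow> complex"
  assumes "\<And>i. finite (F i)"
  shows "(\<Prod>i\<in>UNIV. \<Sum>k\<in>F i. f i k) = (\<Sum>k\<in>{k. \<forall>i. k $ i \<in> F i}. \<Prod>i\<in>UNIV. f i (k $ i))"
  unfolding prod_sum_PiE[OF finite assms]
  by (rule sum.reindex_bij_witness[of _ "vec_nth" "vec_lambda"]) (auto simp: PiE_UNIV_domain Pi_def)

lemma finite_vec_set:
  assumes "\<And>i. finite (F i)"
  shows "finite {k::'a^'d. \<forall>i. k $ i \<in> F i}"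
proof -
  have "{k::'a^'d. \<forall>i. k $ i \<in> F i} = vec_lambda ` (PiE UNIV F)"
    by (auto simp: image_iff PiE_UNIV_domain Pi_def) (metis vec_nth_inverse)
  then show ?thesis
    using assms by (simp add: finite_PiE)
qed

text \<open>The exceptional set is a countable union of hyperplanes. It contains all points at which
  some one-dimensional sawtooth series is evaluated at a jump.\<close>

lemma AE_component_notin_Ints:
  "AE x in (lborel :: (real^'d) measure). \<forall>i. c i - x $ i \<notin> \<int>"
proof -
  have "AE x in (lborel :: (real^'d) measure). x $ i \<noteq> c i - of_int n" for i n
  proof -
    have "negligible {x::real^'d. x $ i = c i - of_int n}"
      using negligible_hyperplane[of "axis i 1 :: real^'d" "c i - of_int n"]
      by (simp add: inner_axis' axis_eq_0_iff)
    then have "{x::real^'d. x $ i = c i - of_int n} \<in> null_sets lborel"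
      by (subst (asm) negligible_iff_null_sets, subst (asm) null_sets_completion_iff) measurable
    from AE_not_in[OF this] show ?thesis
      by simp
  qed
  then have "AE x in (lborel :: (real^'d) measure). \<forall>i n. x $ i \<noteq> c i - of_int n"
    by (simp add: AE_all_countable)
  then show ?thesis
  proof eventually_elim
    case (elim x)
    show ?case
    proof (intro allI notI)
      fix i assume "c i - x $ i \<in> \<int>"
      then obtain n where "c i - x $ i = of_int n" by (elim Ints_cases)
      then have "x $ i = c i - of_int n" by simp
      with elim show False by blast
    qed
  qed
qed

text \<open>The density representation is inserted and the integrals are interchanged. For fixed
  \<open>t\<close> the conditions on \<open>s\<close> cut out a box, possibly empty, so the integral
  over \<open>s\<close> factors into integrals in one variable.\<close>

lemma cbox_integral_dirichlet:
  fixes w \<eta> :: "real^'d \<Rightarrow> complex" and \<xi> l u :: "real^'d"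
  defines "E \<equiv> \<lambda>R i t. \<integral>s. indicator {max t (l $ i)..u $ i} s *\<^sub>R dirichlet R (\<xi> $ i - s) \<partial>lborel"
  assumes w: "integrable lborel w"
    and eta: "\<And>s. s \<in> cbox l u \<Longrightarrow> \<eta> s = (\<integral>t. w t * (\<Prod>i\<in>UNIV. indicator {..s $ i} (t $ i)) \<partial>lborel)"
    and zero: "\<And>s. s \<notin> cbox l u \<Longrightarrow> \<eta> s = 0"
  shows "(\<integral>s. \<eta> s * (\<Prod>i\<in>UNIV. dirichlet R (\<xi> $ i - s $ i)) \<partial>lborel)
    = (\<integral>t. w t * (\<Prod>i\<in>UNIV. E R i (t $ i)) \<partial>lborel)"
proof -
  have w_meas [measurable]: "w \<in> borel_measurable borel" using w by auto
  have [measurable]: "dirichlet R \<in> borel_measurable borel"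
    by (intro borel_measurable_continuous_onI continuous_intros)
  define D where "D = (\<lambda>s::real^'d. \<Prod>i\<in>UNIV. dirichlet R (\<xi> $ i - s $ i))"
  have D_cont: "continuous_on A D" for A
    unfolding D_def by (intro continuous_intros)
  have [measurable]: "D \<in> borel_measurable borel"
    by (intro borel_measurable_continuous_onI D_cont)
  have "compact (D ` cbox l u)"
    by (intro compact_continuous_image D_cont compact_cbox)
  then obtain C where C: "\<And>s. s \<in> cbox l u \<Longrightarrow> norm (D s) \<le> C"
    using compact_imp_bounded bounded_iff by (metis imageI)
  define f where "f = (\<lambda>t s. w t * (\<Prod>i\<in>UNIV. indicator {..s $ i} (t $ i)) * (indicator (cbox l u) s * D s))"
  have "\<eta> s * D s = (\<integral>t. f t s \<partial>lborel)" for s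
  proof (cases "s \<in> cbox l u")
    case True
    then show ?thesis by (simp add: f_def eta)
  next
    case False
    then show ?thesis by (simp add: f_def zero)
  qed
  then have "(\<integral>s. \<eta> s * D s \<partial>lborel) = (\<integral>s. \<integral>t. f t s \<partial>lborel \<partial>lborel)"
    by simp
  also have "\<dots> = (\<integral>t. \<integral>s. f t s \<partial>lborel \<partial>lborel)"
  proof (rule Fubini_bounded[where p="\<lambda>t. norm (w t)" and q="\<lambda>s. indicator (cbox l u) s * C"])
    have eq: "(indicator {..s} t :: complex) = (if t \<le> s then 1 else 0)" for s t :: real
      by (simp add: indicator_def)
    show "case_prod f \<in> borel_measurable (borel \<Otimes>\<^sub>M borel)"
      unfolding f_def eq by measurable
    show "integrable lborel (\<lambda>s. indicator (cbox l u) s * C)"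
      by (intro integrable_mult_left integrable_real_indicator)
        (auto simp: emeasure_lborel_cbox_finite[unfolded infinity_ennreal_def])
    show "norm (f t s) \<le> norm (w t) * (indicator (cbox l u) s * C)" for t s
    proof -
      have "norm (\<Prod>i\<in>UNIV. indicator {..s $ i} (t $ i) :: complex) \<le> 1"
        unfolding prod_norm[symmetric] by (rule prod_le_1) (auto simp: indicator_def)
      then have "norm (w t * (\<Prod>i\<in>UNIV. indicator {..s $ i} (t $ i))) \<le> norm (w t) * 1"
        unfolding norm_mult by (intro mult_left_mono) auto
      then have "norm (f t s) \<le> (norm (w t) * 1) * norm (indicator (cbox l u) s * D s)"
        unfolding f_def norm_mult[of "w t * _"] by (rule mult_right_mono) auto
      also have "\<dots> \<le> (norm (w t) * 1) * (indicator (cbox l u) s * C)"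
        using C[of s] by (intro mult_left_mono) (auto simp: indicator_def)
      finally show ?thesis by simp
    qed
  qed (use w in auto)
  also have "\<dots> = (\<integral>t. w t * (\<Prod>i\<in>UNIV. E R i (t $ i)) \<partial>lborel)"
  proof (intro Bochner_Integration.integral_cong refl)
    fix t :: "real^'d"
    have "f t s = w t * (\<Prod>i\<in>UNIV. indicator {max (t $ i) (l $ i)..u $ i} (s $ i) *\<^sub>R dirichlet R (\<xi> $ i - s $ i))" for s
    proof (cases "\<forall>i. t $ i \<le> s $ i \<and> l $ i \<le> s $ i \<and> s $ i \<le> u $ i")
      case True
      then show ?thesis by (simp add: f_def D_def mem_box_cart)
    next
      case False
      then obtain i where i: "\<not> (t $ i \<le> s $ i \<and> l $ i \<le> s $ i \<and> s $ i \<le> u $ i)" by blast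
      then have "(\<Prod>i\<in>UNIV. indicator {max (t $ i) (l $ i)..u $ i} (s $ i) *\<^sub>R dirichlet R (\<xi> $ i - s $ i)) = 0"
        by (intro prod_zero[OF finite] bexI[of _ i]) auto
      moreover have "f t s = 0"
      proof (cases "t $ i \<le> s $ i")
        case True
        then have "s \<notin> cbox l u" using i by (auto simp: mem_box_cart)
        then show ?thesis by (simp add: f_def)
      next
        case False
        then have "(\<Prod>i\<in>UNIV. indicator {..s $ i} (t $ i)) = (0::complex)"
          by (intro prod_zero[OF finite] bexI[of _ i]) auto
        then show ?thesis by (simp add: f_def)
      qed
      ultimately show ?thesis by simp
    qed
    then have "(\<integral>s. f t s \<partial>lborel) = w t * (\<integral>s. (\<Prod>i\<in>UNIV.
        indicator {max (t $ i) (l $ i)..u $ i} (s $ i) *\<^sub>R dirichlet R (\<xi> $ i - s $ i)) \<partial>lborel)"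
      by simp
    also have "(\<integral>s. (\<Prod>i\<in>UNIV.
        indicator {max (t $ i) (l $ i)..u $ i} (s $ i) *\<^sub>R dirichlet R (\<xi> $ i - s $ i)) \<partial>lborel) = (\<Prod>i\<in>UNIV. E R i (t $ i))"
      unfolding E_def
    proof (rule integral_prod_vec)
      have "set_integrable lborel {max (t $ i) (l $ i)..u $ i} (\<lambda>s. dirichlet R (\<xi> $ i - s))" for i
        by (intro borel_integrable_atLeastAtMost' continuous_intros)
      then show "integrable lborel (\<lambda>s. indicator {max (t $ i) (l $ i)..u $ i} s *\<^sub>R dirichlet R (\<xi> $ i - s))" for i
        by (simp add: set_integrable_def)
    qed
    finally show "(\<integral>s. f t s \<partial>lborel) = w t * (\<Prod>i\<in>UNIV. E R i (t $ i))" .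
  qed
  finally show ?thesis by (simp add: D_def)
qed

text \<open>The length of the interval plus two sawtooth values of modulus at most 1; an empty
  interval gives 0. The bound involves neither \<open>R\<close> nor \<open>x\<close> nor
  \<open>t\<close>.\<close>

lemma dirichlet_integral_bound:
  "norm (\<integral>s. indicator {max t l..u} s *\<^sub>R dirichlet R (x - s) \<partial>lborel) \<le> \<bar>u - l\<bar> + 2"
proof (cases "max t l \<le> u")
  case True
  have "\<bar>(u - max t l) + saw R (x - max t l) - saw R (x - u)\<bar> \<le> \<bar>u - l\<bar> + 2"
    using saw_bound[of R "x - max t l"] saw_bound[of R "x - u"] True by linarith
  then show ?thesis
    unfolding dirichlet_integral[OF True] norm_of_real .
next
  case False
  then show ?thesis by simp
qed

text \<open>The limit is the number of integers \<open>n\<close> with \<open>x - of_int n\<close> in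
  \<open>{max t l..u}\<close>. It is written as a sum of indicators over a range free of
  \<open>t\<close>, so that the product over the coordinates expands into density representations at
  the translates.\<close>

lemma dirichlet_integral_tendsto_count:
  assumes "x - t \<notin> \<int>" "x - l \<notin> \<int>" "x - u \<notin> \<int>" "t \<le> u" "l \<le> u"
  shows "(\<lambda>R. \<integral>s. indicator {max t l..u} s *\<^sub>R dirichlet R (x - s) \<partial>lborel)
    \<longlonglongrightarrow> (\<Sum>n\<in>{\<lceil>x - u\<rceil>..\<lfloor>x - l\<rfloor>}. indicator {..x - of_int n} t)"
proof -
  define m where "m = max t l"
  have m: "x - m \<notin> \<int>" "m \<le> u" using assms by (auto simp: m_def max_def)
  have "(\<lambda>R. complex_of_real ((u - m) + saw R (x - m) - saw R (x - u)))
      \<longlonglongrightarrow> of_real (of_int (\<lfloor>x - m\<rfloor> - \<lfloor>x - u\<rfloor>))"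
    using m assms by (intro tendsto_of_real dirichlet_integral_tendsto)
  moreover have "(\<Sum>n\<in>{\<lceil>x - u\<rceil>..\<lfloor>x - l\<rfloor>}. indicator {..x - of_int n} t)
      = (complex_of_real (of_int (\<lfloor>x - m\<rfloor> - \<lfloor>x - u\<rfloor>)))"
  proof -
    have "(\<Sum>n\<in>{\<lceil>x - u\<rceil>..\<lfloor>x - l\<rfloor>}. indicator {..x - of_int n} t :: complex)
        = (\<Sum>n\<in>{\<lceil>x - u\<rceil>..\<lfloor>x - m\<rfloor>}. 1)"
      by (rule sum.mono_neutral_cong_right)
        (use floor_mono[of "x - m" "x - l"] in \<open>auto simp: m_def le_floor_iff indicator_def algebra_simps\<close>)
    also have "\<dots> = of_nat (nat (\<lfloor>x - m\<rfloor> - \<lceil>x - u\<rceil> + 1))"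
      by simp
    \<comment> \<open>As \<open>x - u\<close> is not an integer, its ceiling exceeds its floor by
      one, which absorbs the \<open>+ 1\<close>.\<close>
    also have "nat (\<lfloor>x - m\<rfloor> - \<lceil>x - u\<rceil> + 1) = nat (\<lfloor>x - m\<rfloor> - \<lfloor>x - u\<rfloor>)"
    proof -
      have "of_int \<lfloor>x - u\<rfloor> \<noteq> x - u"
        using assms(3) by (metis Ints_of_int)
      then show ?thesis by (simp add: ceiling_altdef)
    qed
    also have "of_nat \<dots> = complex_of_real (of_int (\<lfloor>x - m\<rfloor> - \<lfloor>x - u\<rfloor>))"
      using floor_mono[of "x - u" "x - m"] m by (simp add: of_nat_nat)
    finally show ?thesis .
  qed
  ultimately show ?thesis
    unfolding m_def[symmetric] by (simp add: dirichlet_integral[OF m(2)])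
qed

text \<open>The one-variable bounds multiply to a constant \<open>B\<close>, and
  \<open>norm (w t) * B\<close> serves both as the uniform estimate and as the majorant for passing
  to the limit under the integral over \<open>t\<close>. The limit is the sum of
  \<open>\<eta>\<close> over the translates of \<open>\<xi>\<close> lying in the box, of which the
  hypothesis leaves only \<open>\<xi>\<close> itself.\<close>

lemma dirichlet_integral_box_bound:
  fixes \<eta> :: "real^'d \<Rightarrow> complex"
  assumes lu: "\<And>i. l $ i \<le> u $ i" and C: "Ck_on CARD('d) (cbox l u) \<eta>"
    and zero: "\<And>s. s \<notin> cbox l u \<Longrightarrow> \<eta> s = 0"
  shows "\<exists>K. \<forall>R \<xi>. norm (\<integral>s. \<eta> s * (\<Prod>i\<in>UNIV. dirichlet R (\<xi> $ i - s $ i)) \<partial>lborel) \<le> K"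
    and "\<And>\<xi>. (\<forall>i. \<xi> $ i - l $ i \<notin> \<int> \<and> \<xi> $ i - u $ i \<notin> \<int>) \<Longrightarrow>
      (\<And>n. n \<noteq> 0 \<Longrightarrow> \<eta> (\<xi> - int_vec n) = 0) \<Longrightarrow>
      (\<lambda>R. \<integral>s. \<eta> s * (\<Prod>i\<in>UNIV. dirichlet R (\<xi> $ i - s $ i)) \<partial>lborel) \<longlonglongrightarrow> \<eta> \<xi>"
proof -
  obtain w where w: "integrable lborel w"
    and eta: "\<And>s. s \<in> cbox l u \<Longrightarrow> \<eta> s = (\<integral>t. w t * (\<Prod>i\<in>UNIV. indicator {..s $ i} (t $ i)) \<partial>lborel)"
    and supp: "\<And>s i. w s \<noteq> 0 \<Longrightarrow> s $ i \<le> u $ i"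
    by (rule Ck_on_density[OF lu C]) blast
  have [measurable]: "w \<in> borel_measurable borel" using w by auto
  define E where "E = (\<lambda>\<xi>::real^'d. \<lambda>R i t. \<integral>s. indicator {max t (l $ i)..u $ i} s *\<^sub>R dirichlet R (\<xi> $ i - s) \<partial>lborel)"
  have Ed: "E \<xi> R i t = (if max t (l $ i) \<le> u $ i then
      of_real ((u $ i - max t (l $ i)) + saw R (\<xi> $ i - max t (l $ i)) - saw R (\<xi> $ i - u $ i)) else 0)" for \<xi> R i t
    unfolding E_def by (simp add: dirichlet_integral del: of_real_add of_real_diff)
  have [measurable]: "saw R \<in> borel_measurable borel" for R
    unfolding saw_def[abs_def] by measurable
  have [measurable]: "E \<xi> R i \<in> borel_measurable borel" for \<xi> R i
    unfolding Ed[abs_def] by measurable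
  have eq: "(\<integral>s. \<eta> s * (\<Prod>i\<in>UNIV. dirichlet R (\<xi> $ i - s $ i)) \<partial>lborel)
      = (\<integral>t. w t * (\<Prod>i\<in>UNIV. E \<xi> R i (t $ i)) \<partial>lborel)" for R \<xi>
    unfolding E_def by (rule cbox_integral_dirichlet[OF w eta zero])
  define B where "B = (\<Prod>i\<in>(UNIV::'d set). \<bar>u $ i - l $ i\<bar> + 2)"
  have B: "norm (w t * (\<Prod>i\<in>UNIV. E \<xi> R i (t $ i))) \<le> norm (w t) * B" for t \<xi> R
    unfolding norm_mult prod_norm[symmetric] B_def E_def
    by (intro mult_left_mono prod_mono) (auto simp: dirichlet_integral_bound)
  have iB: "integrable lborel (\<lambda>t. norm (w t) * B)" using w by auto
  have "norm (\<integral>t. w t * (\<Prod>i\<in>UNIV. E \<xi> R i (t $ i)) \<partial>lborel) \<le> (\<integral>t. norm (w t) * B \<partial>lborel)" for \<xi> R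
  proof (rule order.trans[OF integral_norm_bound integral_mono[OF _ iB B]])
    have "norm (w t * (\<Prod>i\<in>UNIV. E \<xi> R i (t $ i))) \<le> norm (norm (w t) * B)" for t
      unfolding real_norm_def by (rule order.trans[OF B abs_ge_self])
    then show "integrable lborel (\<lambda>t. norm (w t * (\<Prod>i\<in>UNIV. E \<xi> R i (t $ i))))"
      by (intro Bochner_Integration.integrable_bound[OF iB] AE_I2) auto
  qed
  then show "\<exists>K. \<forall>R \<xi>. norm (\<integral>s. \<eta> s * (\<Prod>i\<in>UNIV. dirichlet R (\<xi> $ i - s $ i)) \<partial>lborel) \<le> K"
    unfolding eq by blast
  fix \<xi> :: "real^'d"
  assume nI: "\<forall>i. \<xi> $ i - l $ i \<notin> \<int> \<and> \<xi> $ i - u $ i \<notin> \<int>"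
    and z: "\<And>n. n \<noteq> 0 \<Longrightarrow> \<eta> (\<xi> - int_vec n) = 0"
  define F where "F = (\<lambda>i. {\<lceil>\<xi> $ i - u $ i\<rceil>..\<lfloor>\<xi> $ i - l $ i\<rfloor>})"
  \<comment> \<open>The lattice vectors \<open>n\<close> for which \<open>\<xi> - int_vec n\<close>
    lies in the box.\<close>
  define G where "G = {n. \<forall>i. n $ i \<in> F i}"
  have G: "finite G" unfolding G_def by (rule finite_vec_set) (simp add: F_def)
  have G_iff: "n \<in> G \<longleftrightarrow> \<xi> - int_vec n \<in> cbox l u" for n
    by (auto simp: G_def F_def mem_box_cart int_vec_def ceiling_le_iff le_floor_iff algebra_simps)
  have "(\<lambda>R. \<integral>t. w t * (\<Prod>i\<in>UNIV. E \<xi> R i (t $ i)) \<partial>lborel) \<longlonglongrightarrow>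
      (\<integral>t. w t * (\<Prod>i\<in>UNIV. \<Sum>n\<in>F i. indicator {..\<xi> $ i - of_int n} (t $ i)) \<partial>lborel)"
  proof (rule integral_dominated_convergence[OF _ _ iB])
    have ind: "(indicator {..s} t :: complex) = (if t \<le> s then 1 else 0)" for s t :: real
      by (simp add: indicator_def)
    show "(\<lambda>t. w t * (\<Prod>i\<in>UNIV. \<Sum>n\<in>F i. indicator {..\<xi> $ i - of_int n} (t $ i))) \<in> borel_measurable lborel"
      unfolding ind by measurable
    show "AE t in lborel. (\<lambda>R. w t * (\<Prod>i\<in>UNIV. E \<xi> R i (t $ i))) \<longlonglongrightarrow>
        w t * (\<Prod>i\<in>UNIV. \<Sum>n\<in>F i. indicator {..\<xi> $ i - of_int n} (t $ i))"
      using AE_component_notin_Ints[of "vec_nth \<xi>"]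
    proof eventually_elim
      case (elim t)
      show ?case
      \<comment> \<open>Where \<open>w\<close> does not vanish, its support yields
        \<open>t $ i \<le> u $ i\<close>, as the counting limit requires.\<close>
      proof (cases "w t = 0")
        case False
        then show ?thesis
          unfolding E_def F_def using elim nI lu supp[OF False]
          by (intro tendsto_intros dirichlet_integral_tendsto_count) auto
      qed simp
    qed
  qed (auto intro: B)
  also have "(\<integral>t. w t * (\<Prod>i\<in>UNIV. \<Sum>n\<in>F i. indicator {..\<xi> $ i - of_int n} (t $ i)) \<partial>lborel)
      = (\<integral>t. (\<Sum>n\<in>G. w t * (\<Prod>i\<in>UNIV. indicator {..(\<xi> - int_vec n) $ i} (t $ i))) \<partial>lborel)"
    by (subst prod_sum_vec) (auto simp: F_def G_def sum_distrib_left int_vec_def)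
  also have "\<dots> = (\<Sum>n\<in>G. \<integral>t. w t * (\<Prod>i\<in>UNIV. indicator {..(\<xi> - int_vec n) $ i} (t $ i)) \<partial>lborel)"
  proof (rule Bochner_Integration.integral_sum)
    fix n
    have ind: "(indicator {..s} t :: complex) = (if t \<le> s then 1 else 0)" for s t :: real
      by (simp add: indicator_def)
    show "integrable lborel (\<lambda>t. w t * (\<Prod>i\<in>UNIV. indicator {..(\<xi> - int_vec n) $ i} (t $ i)))"
    proof (rule Bochner_Integration.integrable_bound[OF w])
      show "(\<lambda>t. w t * (\<Prod>i\<in>UNIV. indicator {..(\<xi> - int_vec n) $ i} (t $ i))) \<in> borel_measurable lborel"
        unfolding ind by measurable
      have "norm (\<Prod>i\<in>UNIV. indicator {..(\<xi> - int_vec n) $ i} (t $ i) :: complex) \<le> 1" for t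
        unfolding prod_norm[symmetric] by (rule prod_le_1) (auto simp: indicator_def)
      then have "norm (w t * (\<Prod>i\<in>UNIV. indicator {..(\<xi> - int_vec n) $ i} (t $ i))) \<le> norm (w t) * 1" for t
        unfolding norm_mult by (intro mult_left_mono) auto
      then show "AE t in lborel. norm (w t * (\<Prod>i\<in>UNIV. indicator {..(\<xi> - int_vec n) $ i} (t $ i))) \<le> norm (w t)"
        by simp
    qed
  qed
  also have "\<dots> = (\<Sum>n\<in>G. \<eta> (\<xi> - int_vec n))"
    by (intro sum.cong refl eta[symmetric]) (simp add: G_iff)
  also have "\<dots> = (\<Sum>n\<in>G. if n = 0 then \<eta> \<xi> else 0)"
    using z by (intro sum.cong refl) (auto simp: int_vec_def vec_eq_iff intro!: arg_cong[where f=\<eta>])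
  also have "\<dots> = \<eta> \<xi>"
  proof (cases "0 \<in> G")
    case True
    then show ?thesis using G by simp
  next
    case False
    moreover have "int_vec 0 = (0::real^'d)" by (simp add: int_vec_def vec_eq_iff)
    ultimately have "\<eta> \<xi> = 0" using G_iff[of 0] zero by simp
    moreover have "(\<Sum>n\<in>G. if n = 0 then \<eta> \<xi> else 0) = 0"
      by (intro sum.neutral) (simp add: \<open>\<eta> \<xi> = 0\<close>)
    ultimately show ?thesis by simp
  qed
  finally show "(\<lambda>R. \<integral>s. \<eta> s * (\<Prod>i\<in>UNIV. dirichlet R (\<xi> $ i - s $ i)) \<partial>lborel) \<longlonglongrightarrow> \<eta> \<xi>"
    unfolding eq .
qed

section \<open>Gaussians\<close>

lemma cis_sum: "finite A \<Longrightarrow> cis (\<Sum>i\<in>A. f i) = (\<Prod>i\<in>A. cis (f i))"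
  by (induction A rule: finite_induct) (auto simp: cis_mult[symmetric])

text \<open>The parameters are inverse width, centre and frequency. The argument is complex so that
  the rules for holomorphic functions apply; real derivatives are obtained by restriction.\<close>

definition gauss1 :: "real \<Rightarrow> real \<Rightarrow> real \<Rightarrow> complex \<Rightarrow> complex" where
  "gauss1 c y b z = exp (- of_real (pi * c\<^sup>2) * (z - of_real y)\<^sup>2 + 2 * of_real pi * \<i> * of_real b * z)"

text \<open>The polynomial factors make the family closed under \<open>partial_deriv\<close>, so
  every \<open>mi_deriv\<close> of a member is again a member whatever order of differentiation is
  chosen.\<close>

definition gauss_poly :: "real \<Rightarrow> real^'d \<Rightarrow> real^'d \<Rightarrow> ('d \<Rightarrow> complex poly) \<Rightarrow> real^'d \<Rightarrow> complex" where
  "gauss_poly c y b p x = (\<Prod>i\<in>UNIV. poly (p i) (of_real (x $ i)) * gauss1 c (y $ i) (b $ i) (of_real (x $ i)))"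

abbreviation gaussian :: "real \<Rightarrow> real^'d \<Rightarrow> real^'d \<Rightarrow> real^'d \<Rightarrow> complex" where
  "gaussian c y b \<equiv> gauss_poly c y b (\<lambda>_. 1)"

lemma gauss1_of_real:
  "gauss1 c y b (of_real t) = of_real (exp (- pi * (c * (t - y))\<^sup>2)) * cis (2 * pi * b * t)"
  unfolding gauss1_def cis_conv_exp exp_of_real[symmetric] exp_add[symmetric]
  by (simp add: power_mult_distrib mult_ac)

lemma norm_gauss1: "norm (gauss1 c y b (of_real t)) = exp (- pi * (c * (t - y))\<^sup>2)"
  by (simp add: gauss1_of_real norm_mult)

lemma gauss1_nonzero [simp]: "gauss1 c y b z \<noteq> 0"
  by (simp add: gauss1_def)

text \<open>The linear polynomial is the logarithmic derivative of
  \<open>gauss1 c y b\<close>.\<close>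

definition gauss_deriv :: "real \<Rightarrow> real \<Rightarrow> real \<Rightarrow> complex poly \<Rightarrow> complex poly" where
  "gauss_deriv c y b p = pderiv p + p * [: 2 * of_real (pi * c\<^sup>2 * y) + 2 * of_real pi * \<i> * of_real b, - (2 * of_real (pi * c\<^sup>2)) :]"

lemma gauss1_has_derivative:
  "((\<lambda>z. poly p z * gauss1 c y b z) has_field_derivative (poly (gauss_deriv c y b p) z * gauss1 c y b z)) (at z)"
  unfolding gauss1_def gauss_deriv_def
  by (auto intro!: derivative_eq_intros poly_DERIV simp: algebra_simps)

lemma gauss_poly_has_derivative:
  "((\<lambda>t. gauss_poly c y b p (x + t *\<^sub>R axis i 1)) has_vector_derivative
    gauss_poly c y b (p(i := gauss_deriv c (y $ i) (b $ i) (p i))) x) (at 0)"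
proof -
  define r where "r = (\<Prod>j\<in>UNIV - {i}. poly (p j) (of_real (x $ j)) * gauss1 c (y $ j) (b $ j) (of_real (x $ j)))"
  have 1: "gauss_poly c y b q (x + t *\<^sub>R axis i 1)
      = (poly (q i) (of_real (x $ i + t)) * gauss1 c (y $ i) (b $ i) (of_real (x $ i + t))) * r"
    if "\<And>j. j \<noteq> i \<Longrightarrow> q j = p j" for t q
    unfolding gauss_poly_def r_def using that
    by (subst prod.remove[of _ i]) (auto simp: axis_def intro!: arg_cong2[where f="(*)"] prod.cong)
  have "((\<lambda>t. poly (p i) (of_real t) * gauss1 c (y $ i) (b $ i) (of_real t)) has_vector_derivative
      (poly (gauss_deriv c (y $ i) (b $ i) (p i)) (of_real (x $ i)) * gauss1 c (y $ i) (b $ i) (of_real (x $ i))))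
      (at (x $ i + 0))"
    using has_vector_derivative_real_field[OF gauss1_has_derivative] by simp
  moreover have "((\<lambda>t. x $ i + t) has_vector_derivative 1) (at 0)"
    by (auto intro!: derivative_eq_intros)
  ultimately have "((\<lambda>t. poly (p i) (of_real t) * gauss1 c (y $ i) (b $ i) (of_real t)) \<circ> (\<lambda>t. x $ i + t)
      has_vector_derivative 1 *\<^sub>R
      (poly (gauss_deriv c (y $ i) (b $ i) (p i)) (of_real (x $ i)) * gauss1 c (y $ i) (b $ i) (of_real (x $ i)))) (at 0)"
    by (intro vector_diff_chain_at) auto
  then have "((\<lambda>t. (poly (p i) (of_real (x $ i + t)) * gauss1 c (y $ i) (b $ i) (of_real (x $ i + t))) * r)
      has_vector_derivative
      (poly (gauss_deriv c (y $ i) (b $ i) (p i)) (of_real (x $ i)) * gauss1 c (y $ i) (b $ i) (of_real (x $ i))) * r) (at 0)"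
    by (intro has_vector_derivative_mult_left) (simp add: comp_def)
  then show ?thesis
    using 1[of "p(i := gauss_deriv c (y $ i) (b $ i) (p i))" 0] by (simp add: 1)
qed

lemma partial_deriv_gauss_poly:
  "partial_deriv i (gauss_poly c y b p) = gauss_poly c y b (p(i := gauss_deriv c (y $ i) (b $ i) (p i)))"
  by (rule ext) (simp add: partial_deriv_def vector_derivative_at[OF gauss_poly_has_derivative])

lemma mi_deriv_gauss_poly: "\<exists>q. mi_deriv \<beta> (gauss_poly c y b p) = gauss_poly c y b q"
proof -
  have "\<exists>q. foldr partial_deriv is (gauss_poly c y b p) = gauss_poly c y b q" for "is"
    by (induction "is") (auto simp: partial_deriv_gauss_poly)
  then show ?thesis by (simp add: mi_deriv_def)
qed

lemma continuous_on_gauss_poly [continuous_intros]: "continuous_on A (gauss_poly c y b p)"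
  unfolding gauss_poly_def gauss1_def by (intro continuous_intros)

lemma borel_measurable_gauss_poly [measurable]: "gauss_poly c y b p \<in> borel_measurable borel"
  by (intro borel_measurable_continuous_onI continuous_intros)

lemma Ck_on_gauss_poly: "Ck_on k UNIV (gauss_poly c y b p)"
proof (induction k arbitrary: p)
  case (Suc k)
  then show ?case
    using gauss_poly_has_derivative by (fastforce intro: continuous_intros)
qed (simp add: continuous_intros)

text \<open>Induction on the polynomial with \<open>\<alpha>\<close> arbitrary: half of the exponent
  absorbs the new factor \<open>t\<close>, the other half is left for the induction
  hypothesis.\<close>

lemma poly_exp_bounded:
  fixes p :: "complex poly"
  assumes "\<alpha> > 0"
  shows "\<exists>K\<ge>0. \<forall>t. norm (poly p (of_real t)) * exp (- \<alpha> * (t - y)\<^sup>2) \<le> K"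
  using assms
proof (induction p arbitrary: \<alpha>)
  case 0
  show ?case by (intro exI[of _ 0]) simp
next
  case (pCons a p)
  define \<beta> where "\<beta> = \<alpha> / 2"
  have \<beta>: "\<beta> > 0" using pCons.prems by (simp add: \<beta>_def)
  from pCons.IH[OF \<beta>] obtain K where K: "K \<ge> 0"
    "\<And>t. norm (poly p (of_real t)) * exp (- \<beta> * (t - y)\<^sup>2) \<le> K" by blast
  \<comment> \<open>With \<open>s = \<bar>t - y\<bar>\<close> one has \<open>s \<le> 1 + s\<^sup>2
    \<le> (1 + 1 / \<beta>) * (1 + \<beta> * s\<^sup>2)\<close>, and the last factor is at most
    \<open>exp (\<beta> * s\<^sup>2)\<close>; the summand \<open>\<bar>y\<bar>\<close> accounts for
    the shift.\<close>
  define L where "L = 1 + 1 / \<beta> + \<bar>y\<bar>"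
  have L: "L \<ge> 0" using \<beta> by (simp add: L_def)
  have tL: "\<bar>t\<bar> * exp (- \<beta> * (t - y)\<^sup>2) \<le> L" for t
  proof -
    define s where "s = \<bar>t - y\<bar>"
    have "s \<le> 1 + s\<^sup>2"
      using zero_le_power2[of "s - 1"] zero_le_power2[of s] unfolding power2_diff one_power2 mult_1_right by linarith
    moreover have "(1 + 1 / \<beta>) * (1 + \<beta> * s\<^sup>2) = 1 + s\<^sup>2 + (1 / \<beta> + \<beta> * s\<^sup>2)"
      using \<beta> by (simp add: field_simps)
    ultimately have "s \<le> (1 + 1 / \<beta>) * (1 + \<beta> * s\<^sup>2)"
      using \<beta> by (simp add: add_increasing2)
    also have "\<dots> \<le> (1 + 1 / \<beta>) * exp (\<beta> * s\<^sup>2)"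
      using \<beta> exp_ge_add_one_self by (intro mult_left_mono) auto
    finally have "s \<le> (1 + 1 / \<beta>) * exp (\<beta> * s\<^sup>2)" .
    moreover have "\<bar>y\<bar> * 1 \<le> \<bar>y\<bar> * exp (\<beta> * s\<^sup>2)"
      using \<beta> by (intro mult_left_mono) auto
    ultimately have "\<bar>t\<bar> \<le> L * exp (\<beta> * s\<^sup>2)"
      unfolding L_def s_def by (simp add: distrib_right)
    then have "\<bar>t\<bar> * exp (- \<beta> * s\<^sup>2) \<le> L * exp (\<beta> * s\<^sup>2) * exp (- \<beta> * s\<^sup>2)"
      by (intro mult_right_mono) auto
    then show ?thesis
      by (simp add: s_def mult.assoc exp_add[symmetric])
  qed
  have "norm (poly (pCons a p) (of_real t)) * exp (- \<alpha> * (t - y)\<^sup>2) \<le> norm a + L * K" for t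
  proof -
    have e: "exp (- \<alpha> * (t - y)\<^sup>2) = exp (- \<beta> * (t - y)\<^sup>2) * exp (- \<beta> * (t - y)\<^sup>2)"
      unfolding \<beta>_def exp_add[symmetric] by (simp add: field_simps)
    have "norm (poly (pCons a p) (of_real t)) \<le> norm a + \<bar>t\<bar> * norm (poly p (of_real t))"
      by (simp add: norm_mult norm_triangle_le)
    then have "norm (poly (pCons a p) (of_real t)) * exp (- \<alpha> * (t - y)\<^sup>2)
        \<le> (norm a + \<bar>t\<bar> * norm (poly p (of_real t))) * exp (- \<alpha> * (t - y)\<^sup>2)"
      by (intro mult_right_mono) auto
    also have "\<dots> = norm a * exp (- \<alpha> * (t - y)\<^sup>2)
        + (\<bar>t\<bar> * exp (- \<beta> * (t - y)\<^sup>2)) * (norm (poly p (of_real t)) * exp (- \<beta> * (t - y)\<^sup>2))"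
      unfolding e by (simp add: algebra_simps)
    also have "\<dots> \<le> norm a * 1 + L * K"
      using pCons.prems K(1) L tL[of t] K(2)[of t] by (intro add_mono mult_mono) auto
    finally show ?thesis by simp
  qed
  then show ?case
    using K(1) L by (intro exI[of _ "norm a + L * K"]) auto
qed

lemma gauss_poly_bounded:
  assumes "c > 0"
  shows "\<exists>K. \<forall>x. norm (gauss_poly c y b p x) \<le> K"
proof -
  have "\<exists>K\<ge>0. \<forall>t. norm (poly (p i) (of_real t)) * exp (- (pi * c\<^sup>2) * (t - y $ i)\<^sup>2) \<le> K" for i
    using assms by (intro poly_exp_bounded) auto
  then obtain K where K: "\<And>i t. norm (poly (p i) (of_real t)) * exp (- (pi * c\<^sup>2) * (t - y $ i)\<^sup>2) \<le> K i"
    by metis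
  have "norm (gauss_poly c y b p x) \<le> (\<Prod>i\<in>UNIV. K i)" for x
    unfolding gauss_poly_def prod_norm[symmetric] norm_mult
    using K by (intro prod_mono) (auto simp: norm_gauss1 power_mult_distrib mult_ac)
  then show ?thesis by blast
qed

lemma gauss_poly_schwartz:
  assumes c: "c > 0"
  shows "gauss_poly c y b p \<in> schwartz"
proof -
  have "bounded (range (\<lambda>x. mi_power x \<alpha> *\<^sub>R mi_deriv \<beta> (gauss_poly c y b p) x))" for \<alpha> \<beta>
  proof -
    obtain q where q: "mi_deriv \<beta> (gauss_poly c y b p) = gauss_poly c y b q"
      using mi_deriv_gauss_poly by blast
    have "mi_power x \<alpha> *\<^sub>R gauss_poly c y b q x = gauss_poly c y b (\<lambda>i. monom 1 (\<alpha> $ i) * q i) x" for x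
      by (simp add: mi_power_def gauss_poly_def scaleR_conv_of_real prod.distrib[symmetric] poly_monom mult_ac)
    then show ?thesis
      unfolding q bounded_iff using gauss_poly_bounded[OF c] by auto
  qed
  then show ?thesis by (simp add: schwartz_def Ck_on_gauss_poly)
qed

section \<open>Integrals and Fourier transforms of Gaussians\<close>

lemma integrable_exp_square:
  fixes \<alpha> y :: real
  assumes "\<alpha> > 0"
  shows "integrable lborel (\<lambda>t. exp (- \<alpha> * (t - y)\<^sup>2))"
proof -
  define \<sigma> where "\<sigma> = 1 / sqrt (2 * \<alpha>)"
  have s2: "2 * \<sigma>\<^sup>2 = 1 / \<alpha>"
    using assms by (simp add: \<sigma>_def power_divide)
  have "exp (- \<alpha> * (t - y)\<^sup>2) = sqrt (2 * pi * \<sigma>\<^sup>2) * normal_density y \<sigma> t" for t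
    using s2 assms unfolding normal_density_def by (simp add: \<sigma>_def)
  moreover have "\<sigma> > 0" using assms by (simp add: \<sigma>_def)
  ultimately show ?thesis by simp
qed

lemma integrable_poly_gauss1:
  assumes c: "c > 0"
  shows "integrable lborel (\<lambda>t. poly p (of_real t) * gauss1 c y b (of_real t))"
proof -
  define \<beta> where "\<beta> = pi * c\<^sup>2 / 2"
  have \<beta>: "\<beta> > 0" using c by (simp add: \<beta>_def)
  from poly_exp_bounded[OF \<beta>] obtain K where K:
    "\<And>t. norm (poly p (of_real t)) * exp (- \<beta> * (t - y)\<^sup>2) \<le> K" by blast
  have bd: "norm (poly p (of_real t) * gauss1 c y b (of_real t)) \<le> K * exp (- \<beta> * (t - y)\<^sup>2)" for t
  proof -
    have "exp (- pi * (c * (t - y))\<^sup>2) = exp (- \<beta> * (t - y)\<^sup>2) * exp (- \<beta> * (t - y)\<^sup>2)"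
      unfolding \<beta>_def exp_add[symmetric] power_mult_distrib by (simp add: field_simps)
    then have "norm (poly p (of_real t) * gauss1 c y b (of_real t))
        = norm (poly p (of_real t)) * exp (- \<beta> * (t - y)\<^sup>2) * exp (- \<beta> * (t - y)\<^sup>2)"
      by (simp add: norm_mult norm_gauss1)
    also have "\<dots> \<le> K * exp (- \<beta> * (t - y)\<^sup>2)"
      by (intro mult_right_mono K) auto
    finally show ?thesis .
  qed
  show ?thesis
  proof (rule Bochner_Integration.integrable_bound)
    show "integrable lborel (\<lambda>t. K * exp (- \<beta> * (t - y)\<^sup>2))"
      by (intro integrable_mult_right integrable_exp_square \<beta>)
    show "(\<lambda>t. poly p (of_real t) * gauss1 c y b (of_real t)) \<in> borel_measurable lborel"
      unfolding gauss1_def by (simp, intro borel_measurable_continuous_onI continuous_intros)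
    have "norm (poly p (of_real t) * gauss1 c y b (of_real t)) \<le> norm (K * exp (- \<beta> * (t - y)\<^sup>2))" for t
      unfolding real_norm_def by (rule order.trans[OF bd abs_ge_self])
    then show "AE t in lborel. norm (poly p (of_real t) * gauss1 c y b (of_real t)) \<le> norm (K * exp (- \<beta> * (t - y)\<^sup>2))"
      by simp
  qed
qed

lemma integrable_gauss_poly: "c > 0 \<Longrightarrow> integrable lborel (gauss_poly c y b p)"
  unfolding gauss_poly_def[abs_def] by (intro integrable_prod_vec integrable_poly_gauss1)

text \<open>An affine substitution turns the integral into the characteristic function of the
  standard normal distribution.\<close>

lemma integral_gauss1:
  assumes c: "c > 0"
  shows "(\<integral>t. gauss1 c y b (of_real t) \<partial>lborel) = of_real (exp (- pi * (b / c)\<^sup>2) / c) * cis (2 * pi * b * y)"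
proof -
  \<comment> \<open>Chosen so that \<open>pi * (c * (a * x))\<^sup>2 = x\<^sup>2 / 2\<close>; the
    frequency \<open>2 * pi * b\<close> then becomes \<open>s\<close>.\<close>
  define a where "a = 1 / (c * sqrt (2 * pi))"
  have a: "a > 0" using c by (simp add: a_def)
  define s where "s = 2 * pi * b * a"
  have "char std_normal_distribution s = of_real (exp (- (s\<^sup>2) / 2))"
    by (simp add: char_std_normal_distribution)
  then have ch: "(\<integral>x. std_normal_density x *\<^sub>R iexp (s * x) \<partial>lborel) = of_real (exp (- (s\<^sup>2) / 2))"
    unfolding char_def by (subst (asm) integral_density) auto
  have "(\<integral>t. gauss1 c y b (of_real t) \<partial>lborel) = \<bar>a\<bar> *\<^sub>R (\<integral>x. gauss1 c y b (of_real (y + a * x)) \<partial>lborel)"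
    using a by (intro lborel_integral_real_affine[where f="\<lambda>t. gauss1 c y b (of_real t)"]) auto
  also have "(\<lambda>x. gauss1 c y b (of_real (y + a * x)))
      = (\<lambda>x. (of_real (sqrt (2 * pi)) * cis (2 * pi * b * y)) * (std_normal_density x *\<^sub>R iexp (s * x)))"
  proof
    fix x
    have "pi * (c * (y + a * x - y))\<^sup>2 = x\<^sup>2 / 2"
      using c by (simp add: a_def power_mult_distrib power_divide)
    then have "gauss1 c y b (of_real (y + a * x)) = of_real (exp (- (x\<^sup>2) / 2)) * cis (2 * pi * b * y + s * x)"
      unfolding gauss1_of_real by (simp add: s_def algebra_simps)
    also have "\<dots> = (of_real (sqrt (2 * pi)) * cis (2 * pi * b * y)) * (std_normal_density x *\<^sub>R iexp (s * x))"
      unfolding std_normal_density_def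
      by (simp add: cis_mult[symmetric] scaleR_conv_of_real cis_conv_exp[of "s * x"] mult_ac)
    finally show "gauss1 c y b (of_real (y + a * x))
        = (of_real (sqrt (2 * pi)) * cis (2 * pi * b * y)) * (std_normal_density x *\<^sub>R iexp (s * x))" .
  qed
  also have "\<bar>a\<bar> *\<^sub>R (\<integral>x. (of_real (sqrt (2 * pi)) * cis (2 * pi * b * y)) * (std_normal_density x *\<^sub>R iexp (s * x)) \<partial>lborel)
      = of_real (a * sqrt (2 * pi) * exp (- (s\<^sup>2) / 2)) * cis (2 * pi * b * y)"
    using a ch by (simp add: scaleR_conv_of_real)
  also have "a * sqrt (2 * pi) = 1 / c"
    using c by (simp add: a_def)
  also have "s\<^sup>2 / 2 = pi * (b / c)\<^sup>2"
    using c by (simp add: s_def a_def power_mult_distrib power_divide power2_eq_square)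
  then have "- (s\<^sup>2) / 2 = - pi * (b / c)\<^sup>2" by simp
  finally show ?thesis by simp
qed

lemma integral_gaussian:
  assumes c: "c > 0"
  shows "(\<integral>x. gaussian c y b x \<partial>lborel)
    = (\<Prod>i\<in>UNIV. of_real (exp (- pi * (b $ i / c)\<^sup>2) / c) * cis (2 * pi * b $ i * y $ i))"
proof -
  have "integrable lborel (\<lambda>t. gauss1 c y b (of_real t))" for y b
    using integrable_poly_gauss1[OF c, of 1] by simp
  then show ?thesis
    using integral_prod_vec[of "\<lambda>i t. gauss1 c (y $ i) (b $ i) (of_real t)"]
    by (simp add: gauss_poly_def integral_gauss1[OF c])
qed

text \<open>Modulation only shifts the frequency, so a Fourier integral of a Gaussian is the plain
  integral of another one.\<close>

lemma gauss_poly_mult_cis: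
  "gauss_poly c y b p x * cis (2 * pi * (x \<bullet> \<xi>)) = gauss_poly c y (b + \<xi>) p x"
proof -
  have "cis (2 * pi * (x \<bullet> \<xi>)) = (\<Prod>i\<in>UNIV. cis (2 * pi * (x $ i * \<xi> $ i)))"
    by (simp add: inner_vec_def sum_distrib_left cis_sum)
  then show ?thesis
    unfolding gauss_poly_def gauss1_of_real
    by (simp add: prod.distrib[symmetric] mult.assoc cis_mult distrib_left distrib_right) (simp add: mult_ac)
qed

text \<open>The scalar produced by the Fourier transform, which otherwise sends the parameters
  \<open>c\<close>, \<open>y\<close>, \<open>b\<close> to \<open>1 / c\<close>, \<open>b\<close>,
  \<open>- y\<close>.\<close>

definition gauss_const :: "real \<Rightarrow> real^'d \<Rightarrow> real^'d \<Rightarrow> complex" where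
  "gauss_const c y b = (\<Prod>i\<in>UNIV. of_real (1 / c) * cis (2 * pi * b $ i * y $ i))"

lemma fourier_gaussian:
  assumes c: "c > 0"
  shows "fourier (gaussian c y b) = (\<lambda>\<xi>. gauss_const c y b * gaussian (1 / c) b (- y) \<xi>)"
proof
  fix \<xi>
  have "fourier (gaussian c y b) \<xi> = (\<integral>x. gaussian c y (b - \<xi>) x \<partial>lborel)"
    using gauss_poly_mult_cis[of c y b "\<lambda>_. 1" _ "- \<xi>"] by (simp add: fourier_def)
  also have "\<dots> = gauss_const c y b * gaussian (1 / c) b (- y) \<xi>"
    unfolding integral_gaussian[OF c]
    unfolding gauss_const_def gauss_poly_def gauss1_of_real prod.distrib[symmetric]
  proof (intro prod.cong refl)
    fix i
    have "(b $ i - \<xi> $ i)\<^sup>2 = (\<xi> $ i - b $ i)\<^sup>2" by (simp add: power2_commute)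
    moreover have "cis (2 * pi * (b $ i - \<xi> $ i) * y $ i) = cis (2 * pi * b $ i * y $ i) * cis (2 * pi * (- y $ i) * \<xi> $ i)"
      by (simp add: cis_mult algebra_simps)
    ultimately show "of_real (exp (- pi * ((b - \<xi>) $ i / c)\<^sup>2) / c) * cis (2 * pi * (b - \<xi>) $ i * y $ i)
        = of_real (1 / c) * cis (2 * pi * b $ i * y $ i) * (poly 1 (of_real (\<xi> $ i)) *
          (of_real (exp (- pi * (1 / c * (\<xi> $ i - b $ i))\<^sup>2)) * cis (2 * pi * (- y) $ i * \<xi> $ i)))"
      by (simp add: power_divide)
  qed
  finally show "fourier (gaussian c y b) \<xi> = gauss_const c y b * gaussian (1 / c) b (- y) \<xi>" .
qed

lemma inverse_fourier_gaussian:
  assumes c: "c > 0"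
  shows "(\<integral>x. fourier (gaussian c y b) x * cis (2 * pi * (x \<bullet> \<xi>)) \<partial>lborel) = gaussian c y b \<xi>"
proof -
  have c': "1 / c > 0" using c by simp
  have "(\<integral>x. fourier (gaussian c y b) x * cis (2 * pi * (x \<bullet> \<xi>)) \<partial>lborel)
      = gauss_const c y b * (\<integral>x. gaussian (1 / c) b (- y + \<xi>) x \<partial>lborel)"
    unfolding fourier_gaussian[OF c] mult.assoc gauss_poly_mult_cis[unfolded mult.assoc] by simp
  also have "\<dots> = gaussian c y b \<xi>"
    unfolding integral_gaussian[OF c']
    unfolding gauss_const_def gauss_poly_def gauss1_of_real prod.distrib[symmetric]
  proof (intro prod.cong refl)
    fix i
    have "cis (2 * pi * b $ i * y $ i) * cis (2 * pi * (\<xi> $ i - y $ i) * b $ i) = cis (2 * pi * b $ i * \<xi> $ i)"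
      by (simp add: cis_mult algebra_simps)
    then show "of_real (1 / c) * cis (2 * pi * b $ i * y $ i) *
        (of_real (exp (- pi * ((- y + \<xi>) $ i / (1 / c))\<^sup>2) / (1 / c)) * cis (2 * pi * (- y + \<xi>) $ i * b $ i))
        = poly 1 (of_real (\<xi> $ i)) * (of_real (exp (- pi * (c * (\<xi> $ i - y $ i))\<^sup>2)) * cis (2 * pi * b $ i * \<xi> $ i))"
      using c by (simp add: mult_ac)
  qed
  finally show ?thesis .
qed

section \<open>Gaussians are total\<close>

lemma integral_lborel_affine:
  fixes h :: "'a::euclidean_space \<Rightarrow> 'b::{banach, second_countable_topology}"
  assumes [measurable]: "h \<in> borel_measurable borel" and c: "c \<noteq> 0"
  shows "(\<integral>x. h x \<partial>lborel) = \<bar>c\<bar> ^ DIM('a) *\<^sub>R (\<integral>z. h (t + c *\<^sub>R z) \<partial>lborel)"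
  by (subst lborel_affine[OF c, of t])
    (simp add: integral_density integral_distr)

text \<open>Boxes are stable under intersection and generate the Borel sets. The complement step
  needs the integral over the whole space, which is the limit over growing cubes.\<close>

lemma integral_box_eq_0_imp_AE_eq_0:
  fixes w :: "'a::euclidean_space \<Rightarrow> complex"
  assumes w: "integrable lborel w"
    and box: "\<And>a b. (\<integral>x. indicator (box a b) x *\<^sub>R w x \<partial>lborel) = 0"
  shows "AE x in lborel. w x = 0"
proof (rule sigma_finite_measure.density_zero[OF sigma_finite_lborel w])
  have [measurable]: "w \<in> borel_measurable borel" using w by auto
  have iw: "integrable lborel (\<lambda>x. indicator A x *\<^sub>R w x)" if "A \<in> sets borel" for A
    using integrable_mult_indicator[of A lborel w] that w by simp
  have total: "(\<integral>x. w x \<partial>lborel) = 0"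
  proof -
    have "(\<lambda>n. \<integral>x. indicator (box (- (real n *\<^sub>R One)) (real n *\<^sub>R One)) x *\<^sub>R w x \<partial>lborel) \<longlonglongrightarrow> (\<integral>x. w x \<partial>lborel)"
    proof (rule integral_dominated_convergence[where w="\<lambda>x. norm (w x)"])
      show "AE x in lborel. (\<lambda>n. indicator (box (- (real n *\<^sub>R One)) (real n *\<^sub>R One)) x *\<^sub>R w x) \<longlonglongrightarrow> w x"
      proof (rule AE_I2)
        fix x :: 'a
        obtain N where N: "x \<in> box (- (real N *\<^sub>R One)) (real N *\<^sub>R One)"
          using UN_box_eq_UNIV by blast
        have "x \<in> box (- (real n *\<^sub>R One)) (real n *\<^sub>R One)" if "n \<ge> N" for n
        proof -
          have "real N \<le> real n" using that by simp
          then show ?thesis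
            using N by (fastforce simp: mem_box inner_simps)
        qed
        then have "eventually (\<lambda>n. indicator (box (- (real n *\<^sub>R One)) (real n *\<^sub>R One)) x *\<^sub>R w x = w x) sequentially"
          by (intro eventually_sequentiallyI[of N]) simp
        then show "(\<lambda>n. indicator (box (- (real n *\<^sub>R One)) (real n *\<^sub>R One)) x *\<^sub>R w x) \<longlonglongrightarrow> w x"
          by (rule tendsto_eventually)
      qed
    qed (use w in \<open>auto simp: indicator_def\<close>)
    then show ?thesis
      by (simp add: box LIMSEQ_const_iff)
  qed
  fix A :: "'a set"
  assume "A \<in> sets lborel"
  then have A: "A \<in> sigma_sets UNIV (range (\<lambda>(a, b). box a b))"
    by (simp add: borel_eq_box)
  have "Int_stable (range (\<lambda>(a, b). box a b :: 'a set))"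
    by (auto simp: Int_stable_def box_Int_box)
  moreover have "range (\<lambda>(a, b). box a b :: 'a set) \<subseteq> Pow UNIV"
    by auto
  ultimately show "set_lebesgue_integral lborel A w = 0"
    using A
  proof (induction rule: sigma_sets_induct_disjoint)
    case (basic A)
    then show ?case using box by (auto simp: set_lebesgue_integral_def)
  next
    case empty
    then show ?case by (simp add: set_lebesgue_integral_def)
  next
    case (compl A)
    then have [measurable]: "A \<in> sets borel" by (simp add: borel_eq_box)
    have "set_lebesgue_integral lborel (UNIV - A) w = (\<integral>x. w x - indicator A x *\<^sub>R w x \<partial>lborel)"
      unfolding set_lebesgue_integral_def
      by (intro Bochner_Integration.integral_cong) (auto simp: indicator_def)
    also have "\<dots> = 0"
      using compl.IH total w iw by (subst Bochner_Integration.integral_diff) (auto simp: set_lebesgue_integral_def)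
    finally show ?case .
  next
    case (union A)
    then have [measurable]: "A i \<in> sets borel" for i by (auto simp: borel_eq_box)
    have "set_lebesgue_integral lborel (\<Union>i. A i) w = (\<Sum>i. set_lebesgue_integral lborel (A i) w)"
      using union(1) iw
      by (intro lebesgue_integral_countable_add) (auto simp: disjoint_family_on_def set_integrable_def)
    with union show ?case by simp
  qed
qed

lemma gauss_poly_pair_measurable [measurable]:
  fixes b :: "real^'d"
  shows "(\<lambda>(x, y). gaussian c y b x) \<in> borel_measurable (borel \<Otimes>\<^sub>M borel)"
proof -
  have "continuous_on UNIV (\<lambda>p::(real^'d) \<times> (real^'d). gaussian c (snd p) b (fst p))"
    unfolding gauss_poly_def gauss1_def by (intro continuous_intros)
  then show ?thesis
    unfolding borel_prod split_beta' by (rule borel_measurable_continuous_onI)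
qed

lemma norm_gaussian_le_1: "norm (gaussian c y b x) \<le> 1"
  unfolding gauss_poly_def prod_norm[symmetric]
  by (rule prod_le_1) (auto simp: norm_mult norm_gauss1)

lemma gaussian_nonzero [simp]: "gaussian c y b x \<noteq> 0"
  by (simp add: gauss_poly_def)

text \<open>Completing the square. Consequently a function orthogonal to all these Gaussians stays
  so after multiplication by the standard one.\<close>

lemma gaussian_times_gaussian:
  "\<exists>K. \<forall>x. gaussian 1 0 0 x * gaussian c y 0 x = K * gaussian (sqrt (1 + c\<^sup>2)) ((c\<^sup>2 / (1 + c\<^sup>2)) *\<^sub>R y) 0 x"
proof -
  have c: "1 + c\<^sup>2 > 0" by (simp add: add_pos_nonneg)
  have sq: "(1 * (t - 0))\<^sup>2 + (c * (t - s))\<^sup>2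
      = (c * s)\<^sup>2 / (1 + c\<^sup>2) + (sqrt (1 + c\<^sup>2) * (t - c\<^sup>2 / (1 + c\<^sup>2) * s))\<^sup>2" for t s
  proof -
    have complete: "D * (t - r / D * s)\<^sup>2 = D * t\<^sup>2 - 2 * r * s * t + r * s\<^sup>2 - r * s\<^sup>2 / D"
      if "D = 1 + r" "D > 0" for r D :: real
    proof -
      have "D * (t - r / D * s)\<^sup>2 = D * t\<^sup>2 - 2 * r * s * t + (r * s\<^sup>2) * (r / D)"
        using that(2) by (simp add: power2_eq_square algebra_simps)
      also have "(r * s\<^sup>2) * (r / D) = r * s\<^sup>2 - r * s\<^sup>2 / D"
        using that by (simp add: field_simps)
      finally show ?thesis by simp
    qed
    have "(sqrt (1 + c\<^sup>2) * (t - c\<^sup>2 / (1 + c\<^sup>2) * s))\<^sup>2 = (1 + c\<^sup>2) * (t - c\<^sup>2 / (1 + c\<^sup>2) * s)\<^sup>2"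
      using c by (simp add: power_mult_distrib)
    also have "\<dots> = (1 + c\<^sup>2) * t\<^sup>2 - 2 * c\<^sup>2 * s * t + c\<^sup>2 * s\<^sup>2 - c\<^sup>2 * s\<^sup>2 / (1 + c\<^sup>2)"
      by (rule complete[OF refl c])
    finally have X: "(sqrt (1 + c\<^sup>2) * (t - c\<^sup>2 / (1 + c\<^sup>2) * s))\<^sup>2
        = (1 + c\<^sup>2) * t\<^sup>2 - 2 * c\<^sup>2 * s * t + c\<^sup>2 * s\<^sup>2 - c\<^sup>2 * s\<^sup>2 / (1 + c\<^sup>2)" .
    show ?thesis
      unfolding X by (simp add: power2_diff power_mult_distrib algebra_simps) (simp add: power2_eq_square)
  qed
  define k where "k = (\<lambda>s. complex_of_real (exp (- pi * ((c * s)\<^sup>2 / (1 + c\<^sup>2)))))"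
  have "gauss1 1 0 0 (of_real t) * gauss1 c s 0 (of_real t)
      = k s * gauss1 (sqrt (1 + c\<^sup>2)) (c\<^sup>2 / (1 + c\<^sup>2) * s) 0 (of_real t)" for t s
  proof -
    have "exp (- pi * (1 * (t - 0))\<^sup>2) * exp (- pi * (c * (t - s))\<^sup>2)
        = exp (- pi * ((c * s)\<^sup>2 / (1 + c\<^sup>2))) * exp (- pi * (sqrt (1 + c\<^sup>2) * (t - c\<^sup>2 / (1 + c\<^sup>2) * s))\<^sup>2)"
      unfolding exp_add[symmetric] distrib_left[symmetric] sq ..
    then show ?thesis
      unfolding gauss1_of_real k_def by (simp only: mult_zero_right mult_zero_left cis_zero mult_1_right of_real_mult[symmetric])
  qed
  then have "gaussian 1 0 0 x * gaussian c y 0 x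
      = (\<Prod>i\<in>UNIV. k (y $ i)) * gaussian (sqrt (1 + c\<^sup>2)) ((c\<^sup>2 / (1 + c\<^sup>2)) *\<^sub>R y) 0 x" for x
    by (simp add: gauss_poly_def prod.distrib[symmetric])
  then show ?thesis by blast
qed

text \<open>The function \<open>u\<close> need not be integrable, hence the weighted
  \<open>w\<close>. The averages \<open>J n\<close> of the indicator of a box over Gaussians of
  width \<open>1 / real (Suc n)\<close> are superpositions of Gaussians, so \<open>w\<close>
  integrates to zero against them, and they converge boundedly to the indicator off the boundary of
  the box.\<close>

lemma gaussian_total:
  fixes u :: "real^'d \<Rightarrow> complex"
  assumes int: "\<And>c y. c > 0 \<Longrightarrow> integrable lborel (\<lambda>x. u x * gaussian c y 0 x)"
    and zero: "\<And>c y. c > 0 \<Longrightarrow> (\<integral>x. u x * gaussian c y 0 x \<partial>lborel) = 0"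
  shows "AE x in lborel. u x = 0"
proof -
  define w where "w = (\<lambda>x. u x * gaussian 1 0 0 x)"
  have w: "integrable lborel w" unfolding w_def by (rule int) simp
  then have [measurable]: "w \<in> borel_measurable borel" by auto
  have w0: "(\<integral>x. w x * gaussian c y 0 x \<partial>lborel) = 0" if c: "c > 0" for c y
  proof -
    obtain K where K: "\<And>x. gaussian 1 0 0 x * gaussian c y 0 x = K * gaussian (sqrt (1 + c\<^sup>2)) ((c\<^sup>2 / (1 + c\<^sup>2)) *\<^sub>R y) 0 x"
      using gaussian_times_gaussian by blast
    have "w x * gaussian c y 0 x = K * (u x * gaussian (sqrt (1 + c\<^sup>2)) ((c\<^sup>2 / (1 + c\<^sup>2)) *\<^sub>R y) 0 x)" for x
      unfolding w_def mult.assoc K by (rule mult.left_commute)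
    moreover have "sqrt (1 + c\<^sup>2) > 0" by (simp add: add_pos_nonneg)
    ultimately show ?thesis by (simp add: zero)
  qed
  let ?G = "gaussian 1 0 0 :: real^'d \<Rightarrow> complex"
  have G: "integrable lborel ?G" by (rule integrable_gauss_poly) simp
  have G1: "(\<integral>z. ?G z \<partial>lborel) = 1"
    by (subst integral_gaussian) simp_all
  have "(\<integral>x. indicator (box a b) x *\<^sub>R w x \<partial>lborel) = 0" for a b
  proof -
    define J where "J = (\<lambda>n x. \<integral>z. indicator (box a b) (x + (1 / real (Suc n)) *\<^sub>R z) *\<^sub>R ?G z \<partial>lborel)"
    have J_meas [measurable]: "J n \<in> borel_measurable borel" for n
      unfolding J_def by (rule lborel.borel_measurable_lebesgue_integral) measurable
    have J_bound: "norm (J n x) \<le> (\<integral>z. norm (?G z) \<partial>lborel)" for n x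
      unfolding J_def
      by (rule order.trans[OF integral_norm_bound integral_mono])
        (use G in \<open>auto simp: indicator_def intro!: Bochner_Integration.integrable_bound[OF G]\<close>)
    have wJ: "(\<integral>x. w x * J n x \<partial>lborel) = 0" for n
    proof -
      let ?c = "1 / real (Suc n)"
      \<comment> \<open>The rescaled shift cancels the width up to sign, and the standard Gaussian
        is even.\<close>
      have g: "gaussian (real (Suc n)) (x + ?c *\<^sub>R z) 0 x = ?G z" for x z :: "real^'d"
        by (simp add: gauss_poly_def gauss1_of_real)
      have "(\<integral>y. indicator (box a b) y *\<^sub>R gaussian (real (Suc n)) y 0 x \<partial>lborel)
          = \<bar>?c\<bar> ^ DIM(real^'d) *\<^sub>R J n x" for x
        unfolding J_def by (subst integral_lborel_affine[of _ ?c x]) (simp_all add: g del: of_nat_Suc)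
      then have "\<bar>?c\<bar> ^ DIM(real^'d) *\<^sub>R (\<integral>x. w x * J n x \<partial>lborel)
          = (\<integral>x. w x * (\<integral>y. indicator (box a b) y *\<^sub>R gaussian (real (Suc n)) y 0 x \<partial>lborel) \<partial>lborel)"
        by simp
      also have "\<dots> = (\<integral>x. (\<integral>y. w x * (indicator (box a b) y *\<^sub>R gaussian (real (Suc n)) y 0 x) \<partial>lborel) \<partial>lborel)"
        by (simp only: integral_mult_right_zero)
      also have "\<dots> = (\<integral>y. (\<integral>x. w x * (indicator (box a b) y *\<^sub>R gaussian (real (Suc n)) y 0 x) \<partial>lborel) \<partial>lborel)"
      proof (rule Fubini_bounded[symmetric, where p="\<lambda>x. norm (w x)" and q="indicator (box a b)"])
        show "norm (w x * (indicator (box a b) y *\<^sub>R gaussian (real (Suc n)) y 0 x)) \<le> norm (w x) * indicator (box a b) y" for x y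
          unfolding norm_mult by (intro mult_left_mono) (auto simp: indicator_def norm_gaussian_le_1)
        show "integrable lborel (indicator (box a b) :: real^'d \<Rightarrow> real)"
          by (intro integrable_real_indicator) (auto simp: emeasure_lborel_box_finite[unfolded infinity_ennreal_def])
      qed (use w in auto)
      also have "\<dots> = (\<integral>y. indicator (box a b) y *\<^sub>R (\<integral>x. w x * gaussian (real (Suc n)) y 0 x \<partial>lborel) \<partial>lborel)"
        by simp
      also have "\<dots> = 0" by (simp add: w0)
      finally show ?thesis by simp
    qed
    have "(\<lambda>n. \<integral>x. w x * J n x \<partial>lborel) \<longlonglongrightarrow> (\<integral>x. w x * of_real (indicator (box a b) x) \<partial>lborel)"
    proof (rule integral_dominated_convergence[where w="\<lambda>x. norm (w x) * (\<integral>z. norm (?G z) \<partial>lborel)"])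
      \<comment> \<open>On the boundary of the box the limit of \<open>J n\<close> may differ from
        the indicator.\<close>
      have "cbox a b - box a b \<in> null_sets lborel"
        using negligible_frontier_interval[of a b]
        by (subst (asm) negligible_iff_null_sets, subst (asm) null_sets_completion_iff) measurable
      from AE_not_in[OF this]
      show "AE x in lborel. (\<lambda>n. w x * J n x) \<longlonglongrightarrow> w x * of_real (indicator (box a b) x)"
      proof eventually_elim
        case (elim x)
        have "(\<lambda>n. J n x) \<longlonglongrightarrow> (\<integral>z. indicator (box a b) x *\<^sub>R ?G z \<partial>lborel)"
          unfolding J_def
        proof (rule integral_dominated_convergence[where w="\<lambda>z. norm (?G z)"])
          show "AE z in lborel. (\<lambda>n. indicator (box a b) (x + (1 / real (Suc n)) *\<^sub>R z) *\<^sub>R ?G z)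
              \<longlonglongrightarrow> indicator (box a b) x *\<^sub>R ?G z"
          proof (rule AE_I2)
            fix z :: "real^'d"
            have "(\<lambda>n. 1 / real (Suc n)) \<longlonglongrightarrow> 0"
              using LIMSEQ_inverse_real_of_nat by (simp add: divide_inverse)
            then have "(\<lambda>n. x + (1 / real (Suc n)) *\<^sub>R z) \<longlonglongrightarrow> x + 0 *\<^sub>R z"
              by (intro tendsto_intros)
            then have lim: "(\<lambda>n. x + (1 / real (Suc n)) *\<^sub>R z) \<longlonglongrightarrow> x" by simp
            have "eventually (\<lambda>n. indicator (box a b) (x + (1 / real (Suc n)) *\<^sub>R z)
                = (indicator (box a b) x :: real)) sequentially"
            proof (cases "x \<in> box a b")
              case True
              from topological_tendstoD[OF lim open_box True] show ?thesis
                by eventually_elim (use True in simp)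
            next
              case False
              with elim have "x \<in> - cbox a b" by auto
              from topological_tendstoD[OF lim open_Compl[OF closed_cbox] this] show ?thesis
                by eventually_elim (use False box_subset_cbox in \<open>auto simp: indicator_def\<close>)
            qed
            then show "(\<lambda>n. indicator (box a b) (x + (1 / real (Suc n)) *\<^sub>R z) *\<^sub>R ?G z)
                \<longlonglongrightarrow> indicator (box a b) x *\<^sub>R ?G z"
              by (intro tendsto_eventually) (auto elim: eventually_mono)
          qed
        qed (use G in \<open>auto simp: indicator_def\<close>)
        then show ?case
          by (intro tendsto_intros) (simp add: G1 scaleR_conv_of_real)
      qed
      show "AE x in lborel. norm (w x * J n x) \<le> norm (w x) * (\<integral>z. norm (?G z) \<partial>lborel)" for n
        by (rule AE_I2) (simp add: norm_mult J_bound mult_left_mono)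
    qed (use w in auto)
    then show ?thesis
      by (simp add: wJ LIMSEQ_const_iff scaleR_conv_of_real mult.commute)
  qed
  then have "AE x in lborel. w x = 0"
    by (rule integral_box_eq_0_imp_AE_eq_0[OF w])
  then show ?thesis
    by eventually_elim (simp add: w_def)
qed

section \<open>Fourier transforms of distributions\<close>

lemma borel_measurable_cis [measurable]: "cis \<in> borel_measurable borel"
  by (intro borel_measurable_continuous_onI continuous_intros)

definition inverse_fourier :: "(real^'d \<Rightarrow> complex) \<Rightarrow> real^'d \<Rightarrow> complex" where
  "inverse_fourier g x = (\<integral>\<xi>. g \<xi> * cis (2 * pi * (x \<bullet> \<xi>)) \<partial>lborel)"

lemma continuous_inverse_fourier:
  assumes g: "integrable lborel g"
  shows "continuous_on UNIV (inverse_fourier g)"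
proof -
  have [measurable]: "g \<in> borel_measurable borel" using g by auto
  have "(\<lambda>n. inverse_fourier g (X n)) \<longlonglongrightarrow> inverse_fourier g x" if X: "X \<longlonglongrightarrow> x" for X x
    unfolding inverse_fourier_def
  proof (rule integral_dominated_convergence[where w="\<lambda>\<xi>. norm (g \<xi>)"])
    show "AE \<xi> in lborel. (\<lambda>n. g \<xi> * cis (2 * pi * (X n \<bullet> \<xi>))) \<longlonglongrightarrow> g \<xi> * cis (2 * pi * (x \<bullet> \<xi>))"
    proof (rule AE_I2)
      fix \<xi>
      have "continuous_on UNIV (\<lambda>z. g \<xi> * cis (2 * pi * (z \<bullet> \<xi>)))"
        by (intro continuous_intros)
      from continuous_on_tendsto_compose[OF this X]
      show "(\<lambda>n. g \<xi> * cis (2 * pi * (X n \<bullet> \<xi>))) \<longlonglongrightarrow> g \<xi> * cis (2 * pi * (x \<bullet> \<xi>))"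
        by simp
    qed
  qed (use g in \<open>auto simp: norm_mult\<close>)
  then show ?thesis
    by (simp add: continuous_on_sequentially comp_def)
qed

lemma integrable_fourier_gaussian: "c > 0 \<Longrightarrow> integrable lborel (fourier (gaussian c y b))"
  by (simp add: fourier_gaussian integrable_gauss_poly)

text \<open>Interchanging the integrals moves the inverse transform from \<open>g\<close> to the
  Gaussian, where it is explicit.\<close>

lemma integral_inverse_fourier_times_fourier_gaussian:
  assumes g: "integrable lborel g" and c: "c > 0"
  shows "(\<integral>x. inverse_fourier g x * fourier (gaussian c y b) x \<partial>lborel) = (\<integral>\<xi>. g \<xi> * gaussian c y b \<xi> \<partial>lborel)"
proof -
  have [measurable]: "g \<in> borel_measurable borel" using g by auto
  let ?F = "fourier (gaussian c y b)"
  have F: "integrable lborel ?F" by (rule integrable_fourier_gaussian[OF c])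
  then have [measurable]: "?F \<in> borel_measurable borel" by auto
  have "(\<integral>x. inverse_fourier g x * ?F x \<partial>lborel)
      = (\<integral>x. (\<integral>\<xi>. (g \<xi> * cis (2 * pi * (x \<bullet> \<xi>))) * ?F x \<partial>lborel) \<partial>lborel)"
    by (simp only: inverse_fourier_def integral_mult_left_zero)
  also have "\<dots> = (\<integral>\<xi>. (\<integral>x. (g \<xi> * cis (2 * pi * (x \<bullet> \<xi>))) * ?F x \<partial>lborel) \<partial>lborel)"
    by (rule Fubini_bounded[symmetric, where p="\<lambda>x. norm (?F x)" and q="\<lambda>\<xi>. norm (g \<xi>)"])
      (use g F in \<open>auto simp: norm_mult\<close>)
  also have "\<dots> = (\<integral>\<xi>. g \<xi> * (\<integral>x. ?F x * cis (2 * pi * (x \<bullet> \<xi>)) \<partial>lborel) \<partial>lborel)"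
    by (simp only: integral_mult_right_zero mult.assoc mult.commute[of "cis _"])
  also have "\<dots> = (\<integral>\<xi>. g \<xi> * gaussian c y b \<xi> \<partial>lborel)"
    by (simp add: inverse_fourier_gaussian[OF c])
  finally show ?thesis .
qed

lemma tempered_function_integrable_gaussian:
  "tempered_function f \<Longrightarrow> c > 0 \<Longrightarrow> integrable lborel (\<lambda>x. f x * gauss_poly c y b p x)"
  by (simp add: tempered_function_def gauss_poly_schwartz)

lemma has_fourier_function_gaussian:
  "has_fourier_function u g \<Longrightarrow> c > 0 \<Longrightarrow> u (fourier (gaussian c y b)) = (\<integral>\<xi>. g \<xi> * gaussian c y b \<xi> \<partial>lborel)"
  by (simp add: has_fourier_function_def fourier_distr_def regular_distr_def gauss_poly_schwartz)

lemma AE_eq_if_gaussian_integrals_eq: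
  assumes "\<And>c y. c > 0 \<Longrightarrow> integrable lborel (\<lambda>x. f x * gaussian c y 0 x)"
    and "\<And>c y. c > 0 \<Longrightarrow> integrable lborel (\<lambda>x. g x * gaussian c y 0 x)"
    and "\<And>c y. c > 0 \<Longrightarrow> (\<integral>x. f x * gaussian c y 0 x \<partial>lborel) = (\<integral>x. g x * gaussian c y 0 x \<partial>lborel)"
  shows "AE x in lborel. f x = g x"
proof -
  have "AE x in lborel. f x - g x = 0"
    by (rule gaussian_total) (use assms in \<open>auto simp: left_diff_distrib\<close>)
  then show ?thesis by simp
qed

lemma integrable_times_gaussian:
  assumes g: "integrable lborel g"
  shows "integrable lborel (\<lambda>x. g x * gaussian c y b x)"
proof (rule Bochner_Integration.integrable_bound[OF g])
  have [measurable]: "g \<in> borel_measurable borel" using g by auto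
  show "(\<lambda>x. g x * gaussian c y b x) \<in> borel_measurable lborel" by measurable
  have "norm (g x * gaussian c y b x) \<le> norm (g x)" for x
    unfolding norm_mult using mult_left_mono[OF norm_gaussian_le_1[of c y b x] norm_ge_zero[of "g x"]] by simp
  then show "AE x in lborel. norm (g x * gaussian c y b x) \<le> norm (g x)" by simp
qed

text \<open>Allows \<open>\<theta>\<close> to replace whichever representative of the transform of
  \<open>\<phi>\<close> the compatibility conditions provide.\<close>

lemma fun_has_fourier_inverse_fourier_AE:
  assumes f: "fun_has_fourier (inverse_fourier \<theta>) g" and \<theta>: "integrable lborel \<theta>"
  shows "AE \<xi> in lborel. g \<xi> = \<theta> \<xi>"
proof (rule AE_eq_if_gaussian_integrals_eq)
  fix c :: real and y assume c: "c > 0"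
  show "integrable lborel (\<lambda>x. g x * gaussian c y 0 x)"
    using f c by (intro tempered_function_integrable_gaussian) (auto simp: fun_has_fourier_def has_fourier_function_def)
  show "integrable lborel (\<lambda>x. \<theta> x * gaussian c y 0 x)"
    by (rule integrable_times_gaussian[OF \<theta>])
  have "(\<integral>x. g x * gaussian c y 0 x \<partial>lborel) = regular_distr (inverse_fourier \<theta>) (fourier (gaussian c y 0))"
    using f unfolding fun_has_fourier_def by (intro has_fourier_function_gaussian[OF _ c, symmetric]) simp
  also have "\<dots> = (\<integral>x. \<theta> x * gaussian c y 0 x \<partial>lborel)"
    unfolding regular_distr_def by (rule integral_inverse_fourier_times_fourier_gaussian[OF \<theta> c])
  finally show "(\<integral>x. g x * gaussian c y 0 x \<partial>lborel) = (\<integral>x. \<theta> x * gaussian c y 0 x \<partial>lborel)" .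
qed

lemma gauss_const_nonzero: "c > 0 \<Longrightarrow> gauss_const c y b \<noteq> 0"
  by (simp add: gauss_const_def)

lemma norm_inverse_fourier_le: "norm (inverse_fourier g x) \<le> (\<integral>\<xi>. norm (g \<xi>) \<partial>lborel)"
  unfolding inverse_fourier_def by (rule order.trans[OF integral_norm_bound]) (simp add: norm_mult)

lemma continuous_AE_eq_imp_eq:
  fixes f g :: "'a::euclidean_space \<Rightarrow> complex"
  assumes f: "continuous_on UNIV f" and g: "continuous_on UNIV g" and ae: "AE x in lborel. f x = g x"
  shows "f = g"
proof -
  have "open {x. f x \<noteq> g x}"
    using open_Collect_neq[OF f g] .
  moreover have "negligible {x. f x \<noteq> g x}"
    using ae calculation
    by (simp add: AE_iff_null negligible_iff_null_sets null_sets_completionI)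
  ultimately have "{x. f x \<noteq> g x} = {}"
    using open_not_negligible by blast
  then show ?thesis by auto
qed

text \<open>A Gaussian centred at \<open>y\<close> without modulation is a nonzero multiple of the
  transform of a Gaussian centred at 0 with frequency \<open>y\<close>. The pairing of
  \<open>f\<close> with it is therefore determined by \<open>g\<close>, and agrees with that of
  \<open>inverse_fourier g\<close>. Continuity upgrades equality almost everywhere to
  equality.\<close>

lemma fun_has_fourier_inversion:
  assumes f: "fun_has_fourier f g" and c: "continuous_on UNIV f" and g: "integrable lborel g"
  shows "f = inverse_fourier g"
proof (rule continuous_AE_eq_imp_eq[OF c continuous_inverse_fourier[OF g]])
  show "AE x in lborel. f x = inverse_fourier g x"
  proof (rule AE_eq_if_gaussian_integrals_eq)
    fix c :: real and y :: "real^'a" assume c: "c > 0"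
    show "integrable lborel (\<lambda>x. f x * gaussian c y 0 x)"
      using f c by (intro tempered_function_integrable_gaussian) (auto simp: fun_has_fourier_def)
    have [measurable]: "inverse_fourier g \<in> borel_measurable borel"
      by (intro borel_measurable_continuous_onI continuous_inverse_fourier g)
    have "norm (inverse_fourier g x * gaussian c y 0 x) \<le> norm ((\<integral>\<xi>. norm (g \<xi>) \<partial>lborel) *\<^sub>R gaussian c y 0 x)" for x
      unfolding norm_mult norm_scaleR
      by (intro mult_right_mono order.trans[OF norm_inverse_fourier_le abs_ge_self]) auto
    then show "integrable lborel (\<lambda>x. inverse_fourier g x * gaussian c y 0 x)"
      by (intro Bochner_Integration.integrable_bound[OF integrable_scaleR_right[OF integrable_gauss_poly[OF c],
              where c="\<integral>\<xi>. norm (g \<xi>) \<partial>lborel"]] AE_I2) auto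
    have c': "1 / c > 0" using c by simp
    have F: "fourier (gaussian (1 / c) 0 y) = (\<lambda>x. gauss_const (1 / c) 0 y * gaussian c y 0 x)"
      using fourier_gaussian[OF c', of 0 y] by simp
    have "gauss_const (1 / c) 0 y * (\<integral>x. f x * gaussian c y 0 x \<partial>lborel)
        = regular_distr f (fourier (gaussian (1 / c) 0 y))"
      unfolding F regular_distr_def by (simp only: mult.left_commute[of "f _"] integral_mult_right_zero)
    also have "\<dots> = (\<integral>\<xi>. g \<xi> * gaussian (1 / c) 0 y \<xi> \<partial>lborel)"
      using f unfolding fun_has_fourier_def by (intro has_fourier_function_gaussian[OF _ c']) simp
    also have "\<dots> = (\<integral>x. inverse_fourier g x * fourier (gaussian (1 / c) 0 y) x \<partial>lborel)"
      by (rule integral_inverse_fourier_times_fourier_gaussian[OF g c', symmetric])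
    also have "\<dots> = gauss_const (1 / c) 0 y * (\<integral>x. inverse_fourier g x * gaussian c y 0 x \<partial>lborel)"
      unfolding F by (simp only: mult.left_commute[of "inverse_fourier g _"] integral_mult_right_zero)
    finally show "(\<integral>x. f x * gaussian c y 0 x \<partial>lborel) = (\<integral>x. inverse_fourier g x * gaussian c y 0 x \<partial>lborel)"
      using gauss_const_nonzero[OF c', of 0 y] by simp
  qed
qed

section \<open>Derivatives of oscillatory integrals and the symbol of the operator\<close>

lemma cis_taylor_bound: "norm (cis t - 1 - \<i> * of_real t) \<le> t\<^sup>2 / 2"
  using iexp_approx1[of t 1] by (simp add: cis_conv_exp numeral_2_eq_2[symmetric] diff_diff_eq)

text \<open>The quadratic Taylor remainder of \<open>cis\<close> bounds the increment minus its
  linear part by \<open>t\<^sup>2\<close> times a second moment. The phase \<open>v\<close> is left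
  general to cover both transforms of Gaussians and dilates of \<open>f\<close>.\<close>

lemma partial_deriv_oscillatory:
  fixes q :: "real^'d \<Rightarrow> complex" and v :: "real^'d \<Rightarrow> real^'d"
  assumes [measurable]: "v \<in> borel_measurable borel" and q: "integrable lborel q"
    and q1: "integrable lborel (\<lambda>x. q x * (\<i> * of_real (v x $ i)))"
    and q2: "integrable lborel (\<lambda>x. q x * (\<i> * of_real (v x $ i)) * (\<i> * of_real (v x $ i)))"
  shows "partial_deriv i (\<lambda>y. \<integral>x. q x * cis (y \<bullet> v x) \<partial>lborel)
    = (\<lambda>y. \<integral>x. q x * (\<i> * of_real (v x $ i)) * cis (y \<bullet> v x) \<partial>lborel)"
proof
  fix y
  have [measurable]: "q \<in> borel_measurable borel" using q by auto
  let ?F = "\<lambda>y. \<integral>x. q x * cis (y \<bullet> v x) \<partial>lborel"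
  let ?D = "\<integral>x. q x * (\<i> * of_real (v x $ i)) * cis (y \<bullet> v x) \<partial>lborel"
  let ?K = "\<integral>x. norm (q x * (\<i> * of_real (v x $ i)) * (\<i> * of_real (v x $ i))) \<partial>lborel"
  have intF: "integrable lborel (\<lambda>x. q x * cis (z \<bullet> v x))" for z
    by (rule Bochner_Integration.integrable_bound[OF q]) (auto simp: norm_mult)
  have intD: "integrable lborel (\<lambda>x. q x * (\<i> * of_real (v x $ i)) * cis (z \<bullet> v x))" for z
    by (rule Bochner_Integration.integrable_bound[OF q1]) (auto simp: norm_mult)
  have bound: "norm (?F (y + t *\<^sub>R axis i 1) - ?F y - t *\<^sub>R ?D) \<le> t\<^sup>2 * ?K" for t
  proof -
    have "?F (y + t *\<^sub>R axis i 1) - ?F y - t *\<^sub>R ?D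
        = (\<integral>x. q x * cis ((y + t *\<^sub>R axis i 1) \<bullet> v x) - q x * cis (y \<bullet> v x)
          - t *\<^sub>R (q x * (\<i> * of_real (v x $ i)) * cis (y \<bullet> v x)) \<partial>lborel)"
      using intF intD by simp
    also have "norm \<dots> \<le> (\<integral>x. t\<^sup>2 * norm (q x * (\<i> * of_real (v x $ i)) * (\<i> * of_real (v x $ i))) \<partial>lborel)"
    proof (rule order.trans[OF integral_norm_bound integral_mono])
      fix x
      have "cis ((y + t *\<^sub>R axis i 1) \<bullet> v x) = cis (y \<bullet> v x) * cis (t * v x $ i)"
        by (simp add: cis_mult inner_add_left inner_axis')
      then have "q x * cis ((y + t *\<^sub>R axis i 1) \<bullet> v x) - q x * cis (y \<bullet> v x)
          - t *\<^sub>R (q x * (\<i> * of_real (v x $ i)) * cis (y \<bullet> v x))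
          = q x * cis (y \<bullet> v x) * (cis (t * v x $ i) - 1 - \<i> * of_real (t * v x $ i))"
        by (simp add: algebra_simps scaleR_conv_of_real)
      also have "norm \<dots> \<le> norm (q x) * ((t * v x $ i)\<^sup>2 / 2)"
        unfolding norm_mult norm_cis mult_1_right by (intro mult_left_mono cis_taylor_bound) auto
      also have "\<dots> \<le> norm (q x) * (t * v x $ i)\<^sup>2"
        by (intro mult_left_mono) auto
      also have "\<dots> = t\<^sup>2 * norm (q x * (\<i> * of_real (v x $ i)) * (\<i> * of_real (v x $ i)))"
        by (simp add: norm_mult power2_eq_square mult_ac abs_mult_self_eq[of "v x $ i", symmetric] del: abs_mult_self_eq)
      finally show "norm (q x * cis ((y + t *\<^sub>R axis i 1) \<bullet> v x) - q x * cis (y \<bullet> v x)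
          - t *\<^sub>R (q x * (\<i> * of_real (v x $ i)) * cis (y \<bullet> v x)))
          \<le> t\<^sup>2 * norm (q x * (\<i> * of_real (v x $ i)) * (\<i> * of_real (v x $ i)))" .
    next
      show "integrable lborel (\<lambda>x. t\<^sup>2 * norm (q x * (\<i> * of_real (v x $ i)) * (\<i> * of_real (v x $ i))))"
        using q2 by auto
      show "integrable lborel (\<lambda>x. norm (q x * cis ((y + t *\<^sub>R axis i 1) \<bullet> v x) - q x * cis (y \<bullet> v x)
          - t *\<^sub>R (q x * (\<i> * of_real (v x $ i)) * cis (y \<bullet> v x))))"
        using intF intD by auto
    qed
    finally show ?thesis by simp
  qed
  have "((\<lambda>t. ?F (y + t *\<^sub>R axis i 1)) has_vector_derivative ?D) (at 0)"
    unfolding has_vector_derivative_def has_derivative_at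
  proof
    show "(\<lambda>h. norm (?F (y + (0 + h) *\<^sub>R axis i 1) - ?F (y + 0 *\<^sub>R axis i 1) - h *\<^sub>R ?D) / norm h) \<midarrow>0\<rightarrow> 0"
    proof (rule Lim_null_comparison)
      show "\<forall>\<^sub>F h in at 0. norm (norm (?F (y + (0 + h) *\<^sub>R axis i 1) - ?F (y + 0 *\<^sub>R axis i 1) - h *\<^sub>R ?D) / norm h)
          \<le> \<bar>h\<bar> * ?K"
      proof (intro always_eventually allI)
        fix h :: real
        have "norm (?F (y + h *\<^sub>R axis i 1) - ?F y - h *\<^sub>R ?D) / \<bar>h\<bar> \<le> (h\<^sup>2 * ?K) / \<bar>h\<bar>"
          by (intro divide_right_mono bound) auto
        also have "\<dots> = \<bar>h\<bar> * ?K"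
          by (cases "h = 0") (simp_all add: field_simps power2_eq_square abs_if)
        finally show "norm (norm (?F (y + (0 + h) *\<^sub>R axis i 1) - ?F (y + 0 *\<^sub>R axis i 1) - h *\<^sub>R ?D) / norm h)
          \<le> \<bar>h\<bar> * ?K" by simp
      qed
      show "((\<lambda>h. \<bar>h\<bar> * ?K) \<longlongrightarrow> 0) (at (0::real))"
        by (auto intro!: tendsto_eq_intros)
    qed
  qed (rule bounded_linear_scaleR_left)
  then show "partial_deriv i ?F y = ?D"
    by (simp add: partial_deriv_def vector_derivative_at)
qed

text \<open>Guarantees that the choice in \<open>mi_deriv\<close> yields a list with the prescribed
  counts.\<close>

lemma ex_count_list: "\<exists>is. \<forall>i. count_list is i = (n :: 'a::finite \<Rightarrow> nat) i"
proof -
  obtain "is" where "mset is = (\<Sum>i\<in>UNIV. replicate_mset (n i) i)"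
    using ex_mset by blast
  then have "count_list is i = n i" for i
    by (simp add: count_mset[symmetric] count_sum)
  then show ?thesis by blast
qed

lemma prod_list_count_list:
  fixes f :: "'a::finite \<Rightarrow> 'b::comm_monoid_mult"
  shows "(\<Prod>i\<leftarrow>is. f i) = (\<Prod>i\<in>UNIV. f i ^ count_list is i)"
proof (induction "is")
  case (Cons a "is")
  have "(\<Prod>i\<in>UNIV. f i ^ count_list (a # is) i) = (\<Prod>i\<in>UNIV. (if i = a then f i else 1) * f i ^ count_list is i)"
    by (intro prod.cong) auto
  with Cons show ?case
    by (simp add: prod.distrib)
qed simp

text \<open>Each differentiation multiplies the integrand by a scalar factor; these commute, so the
  order chosen in \<open>mi_deriv\<close> does not affect the result. The hypothesis ranges over all
  lists because each differentiation calls for two further moments.\<close>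

lemma mi_deriv_oscillatory:
  fixes q :: "real^'d \<Rightarrow> complex" and v :: "real^'d \<Rightarrow> real^'d"
  assumes v: "v \<in> borel_measurable borel"
    and q: "\<And>is. integrable lborel (\<lambda>x. q x * (\<Prod>i\<leftarrow>is. \<i> * of_real (v x $ i)))"
  shows "mi_deriv \<beta> (\<lambda>y. \<integral>x. q x * cis (y \<bullet> v x) \<partial>lborel)
    = (\<lambda>y. \<integral>x. q x * (\<Prod>i\<in>UNIV. (\<i> * of_real (v x $ i)) ^ (\<beta> $ i)) * cis (y \<bullet> v x) \<partial>lborel)"
proof -
  have f: "foldr partial_deriv is (\<lambda>y. \<integral>x. q x * cis (y \<bullet> v x) \<partial>lborel)
    = (\<lambda>y. \<integral>x. q x * (\<Prod>i\<leftarrow>is. \<i> * of_real (v x $ i)) * cis (y \<bullet> v x) \<partial>lborel)" for "is"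
  proof (induction "is")
    case (Cons i "is")
    show ?case
      using partial_deriv_oscillatory[OF v, of "\<lambda>x. q x * (\<Prod>i\<leftarrow>is. \<i> * of_real (v x $ i))" i]
        q[of "is"] q[of "i # is"] q[of "i # i # is"]
      by (simp add: Cons mult_ac)
  qed simp
  define js where "js = (SOME is. \<forall>i. count_list is i = \<beta> $ i)"
  have "\<forall>i. count_list js i = \<beta> $ i"
    unfolding js_def by (rule someI_ex[OF ex_count_list])
  then show ?thesis
    by (simp add: mi_deriv_def js_def[symmetric] f prod_list_count_list)
qed

text \<open>The factor by which \<open>diff_op N a\<close> acts on the exponential
  \<open>cis (2 * pi * (y \<bullet> \<xi>))\<close> as a function of \<open>y\<close>.\<close>

definition symbol :: "nat \<Rightarrow> (nat^'d \<Rightarrow> complex) \<Rightarrow> real^'d \<Rightarrow> complex" where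
  "symbol N a \<xi> = (\<Sum>\<beta>\<in>{\<beta>. mi_order \<beta> \<le> N}. a \<beta> * (\<Prod>i\<in>UNIV. (\<i> * of_real (2 * pi * \<xi> $ i)) ^ (\<beta> $ i)))"

lemma gauss_poly_times_monomial:
  "\<exists>p'. \<forall>x. gauss_poly c y b p x * (\<Prod>i\<leftarrow>is. \<i> * of_real (((- 2 * pi) *\<^sub>R x) $ i)) = gauss_poly c y b p' x"
proof (induction "is" arbitrary: p)
  case (Cons i "is")
  let ?p = "p(i := p i * [:0, \<i> * of_real (- 2 * pi):])"
  have "gauss_poly c y b p x * (\<i> * of_real (((- 2 * pi) *\<^sub>R x) $ i)) = gauss_poly c y b ?p x" for x
    unfolding gauss_poly_def by (subst (1 2) prod.remove[of _ i]) (auto intro!: prod.cong)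
  then have "gauss_poly c y b p x * (\<Prod>i\<leftarrow>i # is. \<i> * of_real (((- 2 * pi) *\<^sub>R x) $ i))
      = gauss_poly c y b ?p x * (\<Prod>i\<leftarrow>is. \<i> * of_real (((- 2 * pi) *\<^sub>R x) $ i))" for x
    by (simp only: list.map prod_list.Cons mult.assoc[symmetric])
  then show ?case
    using Cons.IH[of ?p] by (simp only:)
qed auto

text \<open>The sign in \<open>assoc_distr\<close> cancels the one in \<open>distr_deriv\<close>.
  Differentiating the transform at 0 brings down powers of \<open>- 2 * pi * \<i> * x\<close>, and
  these, with the conjugated coefficients, make up the conjugate of the symbol.\<close>

lemma assoc_distr_fourier_gaussian:
  fixes a :: "nat^'d \<Rightarrow> complex"
  assumes c: "c > 0"
  shows "integrable lborel (\<lambda>x. cnj (symbol N a x) * gaussian c y b x)"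
    and "assoc_distr N a (fourier (gaussian c y b)) = (\<integral>x. cnj (symbol N a x) * gaussian c y b x \<partial>lborel)"
proof -
  define v :: "real^'d \<Rightarrow> real^'d" where "v = (\<lambda>x. (- 2 * pi) *\<^sub>R x)"
  have v: "v \<in> borel_measurable borel" unfolding v_def by measurable
  have int: "integrable lborel (\<lambda>x. gaussian c y b x * (\<Prod>i\<leftarrow>is. \<i> * of_real (v x $ i)))" for "is"
  proof -
    obtain p where "\<And>x. gaussian c y b x * (\<Prod>i\<leftarrow>is. \<i> * of_real (v x $ i)) = gauss_poly c y b p x"
      using gauss_poly_times_monomial[of c y b "\<lambda>_. 1" "is"] unfolding v_def by blast
    then show ?thesis
      using integrable_gauss_poly[OF c, of y b p] by (simp only:)
  qed
  have int': "integrable lborel (\<lambda>x. gaussian c y b x * (\<Prod>i\<in>UNIV. (\<i> * of_real (v x $ i)) ^ (\<beta> $ i)))" for \<beta> :: "nat^'d"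
  proof -
    obtain js where "\<forall>i. count_list js i = \<beta> $ i" using ex_count_list[of "vec_nth \<beta>"] by blast
    then show ?thesis using int[of js] by (simp add: prod_list_count_list)
  qed
  have F: "fourier (gaussian c y b) = (\<lambda>\<xi>. \<integral>x. gaussian c y b x * cis (\<xi> \<bullet> v x) \<partial>lborel)"
    by (simp add: fourier_def[abs_def] v_def inner_commute)
  have sym: "cnj (symbol N a x) * gaussian c y b x
      = (\<Sum>\<beta>\<in>{\<beta>. mi_order \<beta> \<le> N}. cnj (a \<beta>) * (gaussian c y b x * (\<Prod>i\<in>UNIV. (\<i> * of_real (v x $ i)) ^ (\<beta> $ i))))" for x
    by (simp add: symbol_def v_def sum_distrib_left mult_ac)
  show "integrable lborel (\<lambda>x. cnj (symbol N a x) * gaussian c y b x)"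
    unfolding sym using int' by (intro Bochner_Integration.integrable_sum integrable_mult_right)
  have sign: "(-1) ^ n * ((-1) ^ n * z) = z" for n and z :: complex
    by (simp add: mult.assoc[symmetric] power_mult_distrib[symmetric])
  have "assoc_distr N a (fourier (gaussian c y b))
      = (\<Sum>\<beta>\<in>{\<beta>. mi_order \<beta> \<le> N}. cnj (a \<beta>) * (\<integral>x. gaussian c y b x * (\<Prod>i\<in>UNIV. (\<i> * of_real (v x $ i)) ^ (\<beta> $ i)) \<partial>lborel))"
    unfolding assoc_distr_def distr_deriv_def dirac_def F mi_deriv_oscillatory[OF v int]
    by (simp add: mult.assoc sign)
  also have "\<dots> = (\<integral>x. cnj (symbol N a x) * gaussian c y b x \<partial>lborel)"
    unfolding sym using int' by (subst Bochner_Integration.integral_sum) (auto intro!: integrable_mult_right)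
  finally show "assoc_distr N a (fourier (gaussian c y b)) = (\<integral>x. cnj (symbol N a x) * gaussian c y b x \<partial>lborel)" .
qed

lemma assoc_distr_fourier_AE:
  assumes "has_fourier_function (assoc_distr N a) g"
  shows "AE \<xi> in lborel. g \<xi> = cnj (symbol N a \<xi>)"
proof (rule AE_eq_if_gaussian_integrals_eq)
  fix c :: real and y :: "real^'a" assume c: "c > 0"
  show "integrable lborel (\<lambda>x. g x * gaussian c y 0 x)"
    using assms c by (intro tempered_function_integrable_gaussian) (auto simp: has_fourier_function_def)
  show "integrable lborel (\<lambda>x. cnj (symbol N a x) * gaussian c y 0 x)"
    by (rule assoc_distr_fourier_gaussian[OF c])
  show "(\<integral>x. g x * gaussian c y 0 x \<partial>lborel) = (\<integral>x. cnj (symbol N a x) * gaussian c y 0 x \<partial>lborel)"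
    unfolding assoc_distr_fourier_gaussian(2)[OF c, symmetric]
    by (rule has_fourier_function_gaussian[OF assms c, symmetric])
qed

section \<open>The sampling expansion\<close>

lemma matrix_inv_mult:
  fixes A :: "real^'n^'n"
  assumes "invertible A"
  shows "A ** matrix_inv A = mat 1" "matrix_inv A ** A = mat 1"
proof -
  have "A ** matrix_inv A = mat 1 \<and> matrix_inv A ** A = mat 1"
    unfolding matrix_inv_def by (rule someI_ex) (use assms in \<open>simp add: invertible_def\<close>)
  then show "A ** matrix_inv A = mat 1" "matrix_inv A ** A = mat 1" by auto
qed

lemma matrix_power_Suc: "matrix_power A (Suc n) = A ** matrix_power A n"
  by (simp add: matrix_power_def)

lemma matrix_power_Suc_right: "matrix_power A (Suc n) = matrix_power A n ** A"
proof (induction n)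
  case (Suc n)
  have "matrix_power A (Suc (Suc n)) = A ** (matrix_power A n ** A)"
    by (simp only: matrix_power_Suc[of A "Suc n"] Suc)
  then show ?case
    by (simp only: matrix_mul_assoc matrix_power_Suc[of A n])
qed (simp add: matrix_power_def)

lemma matrix_power_mult_inverse:
  assumes "A ** B = mat 1"
  shows "matrix_power A n ** matrix_power B n = mat 1"
proof (induction n)
  case (Suc n)
  have "matrix_power A (Suc n) ** matrix_power B (Suc n) = matrix_power A n ** (A ** B) ** matrix_power B n"
    by (simp only: matrix_power_Suc_right[of A] matrix_power_Suc[of B] matrix_mul_assoc)
  with Suc assms show ?case by simp
qed (simp add: matrix_power_def)

lemma matrix_powi_mult_minus:
  assumes "invertible A"
  shows "matrix_powi A j ** matrix_powi A (- j) = mat 1"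
  using matrix_inv_mult[OF assms]
  by (cases "j = 0") (auto simp: matrix_powi_def matrix_power_mult_inverse matrix_power_def[of _ 0])

lemma transpose_matrix_power: "transpose (matrix_power A n) = matrix_power (transpose A) n"
proof (induction n)
  case (Suc n)
  then show ?case
    by (simp only: matrix_power_Suc[of A] matrix_transpose_mul matrix_power_Suc_right[of "transpose A"])
qed (simp add: matrix_power_def transpose_mat)

lemma transpose_matrix_inv:
  fixes A :: "real^'n^'n"
  assumes A: "invertible A"
  shows "transpose (matrix_inv A) = matrix_inv (transpose A)"
proof -
  have "invertible (transpose A)"
    using A by (simp add: invertible_det_nz det_transpose)
  then have 1: "transpose A ** matrix_inv (transpose A) = mat 1"
    by (rule matrix_inv_mult)
  have "transpose (matrix_inv A) ** transpose A = mat 1"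
    unfolding matrix_transpose_mul[symmetric] matrix_inv_mult[OF A] by (rule transpose_mat)
  then have "transpose (matrix_inv A) ** (transpose A ** matrix_inv (transpose A)) = matrix_inv (transpose A)"
    by (simp only: matrix_mul_assoc matrix_mul_lid)
  then show ?thesis
    by (simp only: 1 matrix_mul_rid)
qed

lemma transpose_matrix_powi:
  "invertible A \<Longrightarrow> transpose (matrix_powi A j) = matrix_powi (transpose A) j"
  by (simp add: matrix_powi_def transpose_matrix_power transpose_matrix_inv)

text \<open>A kernel vector, read as a complex vector, would be an eigenvector for the eigenvalue
  0.\<close>

lemma dilation_matrix_invertible:
  fixes M :: "real^'d^'d"
  assumes "dilation_matrix M"
  shows "invertible M"
proof (rule ccontr)
  assume "\<not> invertible M"
  then obtain x where x: "M *v x = 0" "x \<noteq> 0"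
    using invertible_left_inverse matrix_left_invertible_ker by blast
  define v :: "complex^'d" where "v = (\<chi> i. of_real (x $ i))"
  have "(complex_matrix M *v v) $ i = of_real ((M *v x) $ i)" for i
    by (simp add: matrix_vector_mult_def complex_matrix_def v_def)
  then have "complex_matrix M *v v = 0 *s v"
    using x by (simp add: vec_eq_iff)
  moreover have "v \<noteq> 0"
    using x by (auto simp: v_def vec_eq_iff)
  ultimately have "matrix_eigenvalue (complex_matrix M) 0"
    unfolding matrix_eigenvalue_def by blast
  with assms show False
    unfolding dilation_matrix_def by force
qed

section \<open>Null sets under linear maps and translations\<close>

lemma AE_lborel_iff_negligible:
  "(AE x in (lborel :: 'a::euclidean_space measure). P x) \<longleftrightarrow> negligible {x. \<not> P x}"
  using completion.AE_iff_null_sets[of P lborel]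
  by (simp add: AE_completion_iff negligible_iff_null_sets)

text \<open>The exceptional set is contained in the image of a null set under the linear map
  \<open>B\<close>. This transports statements about \<open>\<zeta> = T *v \<xi>\<close> to
  \<open>\<xi>\<close>.\<close>

lemma AE_matrix_preimage:
  fixes A B :: "real^'d^'d"
  assumes "B ** A = mat 1" and "AE x in lborel. P x"
  shows "AE x in lborel. P (A *v x)"
proof -
  have "negligible ((*v) B ` {x. \<not> P x})"
    using assms(2) unfolding AE_lborel_iff_negligible
    by (intro negligible_differentiable_image_negligible linear_imp_differentiable_on) auto
  moreover have "{x. \<not> P (A *v x)} \<subseteq> (*v) B ` {x. \<not> P x}"
  proof
    fix x assume "x \<in> {x. \<not> P (A *v x)}"
    moreover have "x = B *v (A *v x)"
      by (simp add: matrix_vector_mul_assoc assms(1))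
    ultimately show "x \<in> (*v) B ` {x. \<not> P x}" by blast
  qed
  ultimately show ?thesis
    unfolding AE_lborel_iff_negligible by (rule negligible_subset)
qed

lemma AE_translate:
  fixes c :: "'a::euclidean_space"
  assumes "AE x in lborel. P x"
  shows "AE x in lborel. P (x - c)"
proof -
  have "negligible ((+) c ` {x. \<not> P x})"
    using assms unfolding AE_lborel_iff_negligible by (rule negligible_translation)
  moreover have "{x. \<not> P (x - c)} \<subseteq> (+) c ` {x. \<not> P x}"
  proof
    fix x assume "x \<in> {x. \<not> P (x - c)}"
    then show "x \<in> (+) c ` {x. \<not> P x}"
      by (intro image_eqI[of _ _ "x - c"]) auto
  qed
  ultimately show ?thesis
    unfolding AE_lborel_iff_negligible by (rule negligible_subset)
qed

section \<open>Stability of smoothness on a box under modulation\<close>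

lemma Ck_on_add_cmult:
  "Ck_on k S f \<Longrightarrow> Ck_on k S g \<Longrightarrow> Ck_on k S (\<lambda>x. f x + c * g x)"
proof (induction k arbitrary: f g)
  case 0
  then show ?case by (auto intro!: continuous_intros)
next
  case (Suc k)
  have "\<exists>h. (\<forall>x\<in>S. ((\<lambda>t. f (x + t *\<^sub>R axis i 1) + c * g (x + t *\<^sub>R axis i 1)) has_vector_derivative h x)
      (at 0 within {t. x + t *\<^sub>R axis i 1 \<in> S})) \<and> Ck_on k S h" for i
  proof -
    obtain f' g' where
      f: "\<forall>x\<in>S. ((\<lambda>t. f (x + t *\<^sub>R axis i 1)) has_vector_derivative f' x) (at 0 within {t. x + t *\<^sub>R axis i 1 \<in> S})" "Ck_on k S f'"
      and g: "\<forall>x\<in>S. ((\<lambda>t. g (x + t *\<^sub>R axis i 1)) has_vector_derivative g' x) (at 0 within {t. x + t *\<^sub>R axis i 1 \<in> S})" "Ck_on k S g'"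
      using Suc.prems unfolding Ck_on.simps by meson
    show ?thesis
      using f g Suc.IH[OF f(2) g(2)]
      by (intro exI[of _ "\<lambda>x. f' x + c * g' x"])
        (auto intro!: has_vector_derivative_add has_vector_derivative_mult_right)
  qed
  moreover have "continuous_on S (\<lambda>x. f x + c * g x)"
    using Suc.prems by (auto intro!: continuous_intros)
  ultimately show ?case by simp
qed

text \<open>Differentiation keeps the exponential factor and replaces \<open>f\<close> by
  \<open>f' + c * f\<close>, so the induction over all \<open>f\<close> closes.\<close>

lemma Ck_on_mult_cis:
  "Ck_on k S f \<Longrightarrow> Ck_on k S (\<lambda>x. f x * cis (2 * pi * (y \<bullet> x)))"
proof (induction k arbitrary: f)
  case 0
  then show ?case by (auto intro!: continuous_intros)
next
  case (Suc k)
  have "\<exists>h. (\<forall>x\<in>S. ((\<lambda>t. f (x + t *\<^sub>R axis i 1) * cis (2 * pi * (y \<bullet> (x + t *\<^sub>R axis i 1)))) has_vector_derivative h x)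
      (at 0 within {t. x + t *\<^sub>R axis i 1 \<in> S})) \<and> Ck_on k S h" for i
  proof -
    obtain f' where
      f: "\<forall>x\<in>S. ((\<lambda>t. f (x + t *\<^sub>R axis i 1)) has_vector_derivative f' x) (at 0 within {t. x + t *\<^sub>R axis i 1 \<in> S})" "Ck_on k S f'"
      using Suc.prems unfolding Ck_on.simps by meson
    define c where "c = \<i> * of_real (2 * pi * y $ i)"
    define h where "h = (\<lambda>x. (f' x + c * f x) * cis (2 * pi * (y \<bullet> x)))"
    have "((\<lambda>t. f (x + t *\<^sub>R axis i 1) * cis (2 * pi * (y \<bullet> (x + t *\<^sub>R axis i 1)))) has_vector_derivative h x)
      (at 0 within {t. x + t *\<^sub>R axis i 1 \<in> S})" if x: "x \<in> S" for x
    proof -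
      have cis: "cis (2 * pi * (y \<bullet> (x + t *\<^sub>R axis i 1))) = exp (c * of_real t) * cis (2 * pi * (y \<bullet> x))" for t
        by (simp add: c_def cis_conv_exp exp_add[symmetric] inner_add_right inner_axis algebra_simps)
      have "((\<lambda>z. exp (c * z)) has_field_derivative c) (at (of_real 0))"
        by (auto intro!: derivative_eq_intros)
      from has_vector_derivative_real_field[OF this]
      have e: "((\<lambda>t. exp (c * of_real t)) has_vector_derivative c) (at 0 within {t. x + t *\<^sub>R axis i 1 \<in> S})" .
      from has_vector_derivative_mult[OF bspec[OF f(1) x] e]
      have "((\<lambda>t. f (x + t *\<^sub>R axis i 1) * exp (c * of_real t) * cis (2 * pi * (y \<bullet> x))) has_vector_derivative
          (f (x + 0 *\<^sub>R axis i 1) * c + f' x * exp (c * of_real 0)) * cis (2 * pi * (y \<bullet> x)))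
          (at 0 within {t. x + t *\<^sub>R axis i 1 \<in> S})"
        by (rule has_vector_derivative_mult_left)
      then show ?thesis
        unfolding cis h_def by (simp add: algebra_simps)
    qed
    moreover have "Ck_on k S h"
      unfolding h_def by (intro Suc.IH Ck_on_add_cmult f(2) Ck_on_Suc_imp[OF Suc.prems])
    ultimately show ?thesis by blast
  qed
  moreover have "continuous_on S (\<lambda>x. f x * cis (2 * pi * (y \<bullet> x)))"
    using Suc.prems by (auto intro!: continuous_intros)
  ultimately show ?case by simp
qed

lemma Ck_on_cbox_integrable:
  assumes "Ck_on k (cbox l u) \<theta>" and zero: "\<And>s. s \<notin> cbox l u \<Longrightarrow> \<theta> s = 0"
  shows "integrable lborel \<theta>"
proof -
  have "\<theta> = (\<lambda>s. indicator (cbox l u) s *\<^sub>R \<theta> s)"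
    using zero by (auto simp: indicator_def fun_eq_iff)
  moreover have "integrable lborel (\<lambda>s. indicator (cbox l u) s *\<^sub>R \<theta> s)"
    by (intro borel_integrable_compact compact_cbox Ck_on_imp_continuous_on[OF assms(1)])
  ultimately show ?thesis by simp
qed

section \<open>Sampling sums as integrals against Dirichlet kernels, and their limit\<close>

lemma dirichlet_minus: "dirichlet R (- z) = dirichlet R z"
  by (simp add: dirichlet_eq)

text \<open>A truncated Poisson summation: the product of kernels expands into exponentials indexed
  by a cube of lattice points \<open>k\<close>, and each of them contributes the inverse transform
  at \<open>y + int_vec k\<close>.\<close>

lemma inverse_fourier_partial_sum:
  fixes \<theta> :: "real^'d \<Rightarrow> complex"
  assumes \<theta>: "integrable lborel \<theta>"
  shows "(\<Sum>k\<in>{k. \<forall>i. \<bar>k $ i\<bar> \<le> int R}. cis (- (2 * pi * (int_vec k \<bullet> \<zeta>))) * inverse_fourier \<theta> (y + int_vec k))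
    = (\<integral>s. (\<theta> s * cis (2 * pi * (y \<bullet> s))) * (\<Prod>i\<in>UNIV. dirichlet R (\<zeta> $ i - s $ i)) \<partial>lborel)"
proof -
  have [measurable]: "\<theta> \<in> borel_measurable borel" using \<theta> by auto
  have D: "(\<Prod>i\<in>UNIV. dirichlet R (\<zeta> $ i - s $ i))
      = (\<Sum>k\<in>{k. \<forall>i. \<bar>k $ i\<bar> \<le> int R}. cis (2 * pi * (int_vec k \<bullet> (s - \<zeta>))))" for s
  proof -
    have "(\<Prod>i\<in>UNIV. dirichlet R (\<zeta> $ i - s $ i)) = (\<Prod>i\<in>UNIV. dirichlet R (s $ i - \<zeta> $ i))"
      using dirichlet_minus[of R "s $ _ - \<zeta> $ _"] by simp
    also have "\<dots> = (\<Sum>k\<in>{k. \<forall>i. k $ i \<in> {- int R..int R}}. \<Prod>i\<in>UNIV. cis (2 * pi * of_int (k $ i) * (s $ i - \<zeta> $ i)))"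
      unfolding dirichlet_def by (rule prod_sum_vec) simp
    also have "\<dots> = (\<Sum>k\<in>{k. \<forall>i. \<bar>k $ i\<bar> \<le> int R}. cis (2 * pi * (int_vec k \<bullet> (s - \<zeta>))))"
    proof (rule sum.cong)
      have "m \<in> {- int R..int R} \<longleftrightarrow> \<bar>m\<bar> \<le> int R" for m by auto
      then show "{k::int^'d. \<forall>i. k $ i \<in> {- int R..int R}} = {k. \<forall>i. \<bar>k $ i\<bar> \<le> int R}" by (simp only:)
    qed (simp add: cis_sum[symmetric] inner_vec_def int_vec_def sum_distrib_left mult.assoc)
    finally show ?thesis .
  qed
  have e: "\<theta> s * cis (2 * pi * (y \<bullet> s)) * cis (2 * pi * (k \<bullet> (s - \<zeta>)))
      = cis (- (2 * pi * (k \<bullet> \<zeta>))) * (\<theta> s * cis (2 * pi * ((y + k) \<bullet> s)))" for k s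
  proof -
    have "cis (2 * pi * (y \<bullet> s)) * cis (2 * pi * (k \<bullet> (s - \<zeta>)))
        = cis (- (2 * pi * (k \<bullet> \<zeta>))) * cis (2 * pi * ((y + k) \<bullet> s))"
      by (simp add: cis_mult inner_diff_right inner_add_left algebra_simps)
    then show ?thesis
      by (simp only: mult.assoc mult.left_commute[of "cis _" "\<theta> s"])
  qed
  have "(\<integral>s. (\<theta> s * cis (2 * pi * (y \<bullet> s))) * (\<Prod>i\<in>UNIV. dirichlet R (\<zeta> $ i - s $ i)) \<partial>lborel)
      = (\<integral>s. (\<Sum>k\<in>{k. \<forall>i. \<bar>k $ i\<bar> \<le> int R}. cis (- (2 * pi * (int_vec k \<bullet> \<zeta>))) * (\<theta> s * cis (2 * pi * ((y + int_vec k) \<bullet> s)))) \<partial>lborel)"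
    unfolding D sum_distrib_left e ..
  also have "\<dots> = (\<Sum>k\<in>{k. \<forall>i. \<bar>k $ i\<bar> \<le> int R}. cis (- (2 * pi * (int_vec k \<bullet> \<zeta>))) * inverse_fourier \<theta> (y + int_vec k))"
    unfolding inverse_fourier_def
    by (subst Bochner_Integration.integral_sum)
      (auto intro!: integrable_mult_right Bochner_Integration.integrable_bound[OF \<theta>] simp: norm_mult)
  finally show ?thesis ..
qed

text \<open>On the support of \<open>g\<close> the point \<open>T *v \<xi>\<close> stays in the
  bounded set \<open>E\<close>. The polynomial factors are bounded there, so all moments exist
  although \<open>g\<close> is only integrable, and differentiation under the integral is justified
  to every order.\<close>

lemma diff_op_inverse_fourier:
  fixes g :: "real^'d \<Rightarrow> complex" and B T :: "real^'d^'d"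
  assumes g: "integrable lborel g" and E: "bounded E"
    and supp: "AE \<xi> in lborel. T *v \<xi> \<notin> E \<longrightarrow> g \<xi> = 0"
    and T: "\<And>y \<xi>. (B *v y) \<bullet> \<xi> = y \<bullet> (T *v \<xi>)"
  shows "integrable lborel (\<lambda>\<xi>. g \<xi> * symbol N a (T *v \<xi>))"
    and "diff_op N a (\<lambda>y. inverse_fourier g (B *v y)) y
      = (\<integral>\<xi>. g \<xi> * symbol N a (T *v \<xi>) * cis (2 * pi * (y \<bullet> (T *v \<xi>))) \<partial>lborel)"
proof -
  have [measurable]: "g \<in> borel_measurable borel" using g by auto
  have T_meas [measurable]: "(*v) T \<in> borel_measurable borel"
    by (intro borel_measurable_continuous_onI linear_continuous_on) (simp add: linear_linear)
  define v where "v = (\<lambda>\<xi>. (2 * pi) *\<^sub>R (T *v \<xi>))"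
  have v [measurable]: "v \<in> borel_measurable borel" unfolding v_def by measurable
  from E obtain K where K: "K > 0" "\<And>x. x \<in> E \<Longrightarrow> norm x \<le> K"
    by (auto simp: bounded_pos)
  have int: "integrable lborel (\<lambda>\<xi>. g \<xi> * (\<Prod>i\<leftarrow>is. \<i> * of_real (v \<xi> $ i)))" for "is"
  proof (rule Bochner_Integration.integrable_bound)
    show "integrable lborel (\<lambda>\<xi>. (2 * pi * K) ^ length is *\<^sub>R g \<xi>)" using g by simp
    have m: "(\<lambda>\<xi>. \<Prod>i\<leftarrow>is. \<i> * complex_of_real (v \<xi> $ i)) \<in> borel_measurable borel"
      by (induction "is") auto
    then show "(\<lambda>\<xi>. g \<xi> * (\<Prod>i\<leftarrow>is. \<i> * of_real (v \<xi> $ i))) \<in> borel_measurable lborel"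
      by simp
    show "AE \<xi> in lborel. norm (g \<xi> * (\<Prod>i\<leftarrow>is. \<i> * of_real (v \<xi> $ i))) \<le> norm ((2 * pi * K) ^ length is *\<^sub>R g \<xi>)"
      using supp
    proof eventually_elim
      case (elim \<xi>)
      show ?case
      proof (cases "T *v \<xi> \<in> E")
        case True
        have "\<bar>v \<xi> $ i\<bar> \<le> 2 * pi * K" for i
          using component_le_norm_cart[of "T *v \<xi>" i] K(2)[OF True]
          by (simp add: v_def abs_mult del: component_le_norm_cart)
        then have "norm (\<Prod>i\<leftarrow>is. \<i> * complex_of_real (v \<xi> $ i)) \<le> (2 * pi * K) ^ length is"
          using K(1) by (induction "is") (auto simp: norm_mult intro!: mult_mono)
        then have "norm (g \<xi> * (\<Prod>i\<leftarrow>is. \<i> * of_real (v \<xi> $ i))) \<le> norm (g \<xi>) * (2 * pi * K) ^ length is"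
          unfolding norm_mult by (intro mult_left_mono) auto
        then show ?thesis using K(1) by (simp add: mult.commute)
      qed (use elim in simp)
    qed
  qed
  have int': "integrable lborel (\<lambda>\<xi>. g \<xi> * (\<Prod>i\<in>UNIV. (\<i> * of_real (v \<xi> $ i)) ^ (\<beta> $ i)))" for \<beta> :: "nat^'d"
  proof -
    obtain js where "\<forall>i. count_list js i = \<beta> $ i" using ex_count_list[of "vec_nth \<beta>"] by blast
    then show ?thesis using int[of js] by (simp add: prod_list_count_list)
  qed
  have sym: "g \<xi> * symbol N a (T *v \<xi>)
      = (\<Sum>\<beta>\<in>{\<beta>. mi_order \<beta> \<le> N}. a \<beta> * (g \<xi> * (\<Prod>i\<in>UNIV. (\<i> * of_real (v \<xi> $ i)) ^ (\<beta> $ i))))" for \<xi>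
    by (simp add: symbol_def v_def sum_distrib_left mult_ac)
  show "integrable lborel (\<lambda>\<xi>. g \<xi> * symbol N a (T *v \<xi>))"
    unfolding sym using int' by (intro Bochner_Integration.integrable_sum integrable_mult_right)
  have F: "(\<lambda>y. inverse_fourier g (B *v y)) = (\<lambda>y. \<integral>\<xi>. g \<xi> * cis (y \<bullet> v \<xi>) \<partial>lborel)"
    by (simp add: inverse_fourier_def T v_def)
  have "diff_op N a (\<lambda>y. inverse_fourier g (B *v y)) y
      = (\<Sum>\<beta>\<in>{\<beta>. mi_order \<beta> \<le> N}. a \<beta> * (\<integral>\<xi>. g \<xi> * (\<Prod>i\<in>UNIV. (\<i> * of_real (v \<xi> $ i)) ^ (\<beta> $ i)) * cis (y \<bullet> v \<xi>) \<partial>lborel))"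
    unfolding diff_op_def F mi_deriv_oscillatory[OF v int] ..
  also have "\<dots> = (\<integral>\<xi>. (\<Sum>\<beta>\<in>{\<beta>. mi_order \<beta> \<le> N}. a \<beta> * (g \<xi> * (\<Prod>i\<in>UNIV. (\<i> * of_real (v \<xi> $ i)) ^ (\<beta> $ i)) * cis (y \<bullet> v \<xi>))) \<partial>lborel)"
    by (subst Bochner_Integration.integral_sum)
      (auto intro!: integrable_mult_right Bochner_Integration.integrable_bound[OF int'] simp: norm_mult)
  also have "\<dots> = (\<integral>\<xi>. g \<xi> * symbol N a (T *v \<xi>) * cis (2 * pi * (y \<bullet> (T *v \<xi>))) \<partial>lborel)"
    unfolding sym sum_distrib_right by (simp add: v_def mult.assoc)
  finally show "diff_op N a (\<lambda>y. inverse_fourier g (B *v y)) y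
      = (\<integral>\<xi>. g \<xi> * symbol N a (T *v \<xi>) * cis (2 * pi * (y \<bullet> (T *v \<xi>))) \<partial>lborel)" .
qed

text \<open>The set \<open>E\<close> is a region for the dilated frequency
  \<open>\<zeta> = T *v \<xi>\<close>; the hypotheses \<open>one\<close> and \<open>vanish\<close>
  are required only almost everywhere in it, which lets both parts of the theorem be
  instances.\<close>

lemma sampling_partial_sum_tendsto:
  fixes M :: "real^'d^'d" and \<theta> g :: "real^'d \<Rightarrow> complex"
  assumes M: "invertible M"
    and lu: "\<And>i. l $ i < u $ i" and zero: "\<And>\<xi>. \<xi> \<notin> cbox l u \<Longrightarrow> \<theta> \<xi> = 0"
    and Ck: "Ck_on CARD('d) (cbox l u) \<theta>"
    and g: "integrable lborel g" and E: "bounded E"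
    and supp: "AE \<xi> in lborel. matrix_powi (transpose M) (- j) *v \<xi> \<notin> E \<longrightarrow> g \<xi> = 0"
    and one: "AE \<zeta> in lborel. \<zeta> \<in> E \<longrightarrow> \<theta> \<zeta> * symbol N a \<zeta> = 1"
    and vanish: "\<And>n. n \<noteq> 0 \<Longrightarrow> AE \<zeta> in lborel. \<zeta> \<in> E \<longrightarrow> \<theta> (\<zeta> - int_vec n) = 0"
  shows "(\<lambda>R. sampling_partial_sum M j N a (inverse_fourier \<theta>) (inverse_fourier g) R x) \<longlonglongrightarrow> inverse_fourier g x"
proof -
  define B where "B = matrix_powi M (- j)"
  define T where "T = matrix_powi (transpose M) (- j)"
  define y where "y = matrix_powi M j *v x"
  have detM: "det M \<noteq> 0" using M by (simp add: invertible_det_nz)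
  have T_eq: "T = transpose B"
    unfolding B_def T_def by (rule transpose_matrix_powi[OF M, symmetric])
  have BT: "(B *v y) \<bullet> \<xi> = y \<bullet> (T *v \<xi>)" for y \<xi>
    unfolding T_eq transpose_matrix_vector using dot_lmul_matrix[of \<xi> B y] by (simp only: inner_commute)
  have By: "B *v y = x"
    using matrix_powi_mult_minus[OF M, of "- j"] by (simp add: B_def y_def matrix_vector_mul_assoc)
  have "invertible (transpose M)" using M by (simp add: invertible_det_nz det_transpose)
  then have T: "matrix_powi (transpose M) j ** T = mat 1"
    unfolding T_def by (rule matrix_powi_mult_minus)
  have [measurable]: "(*v) T \<in> borel_measurable borel"
    by (intro borel_measurable_continuous_onI linear_continuous_on) (simp add: linear_linear)
  have \<theta>: "integrable lborel \<theta>" by (rule Ck_on_cbox_integrable[OF Ck zero])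
  define F where "F = (\<lambda>\<xi>. g \<xi> * symbol N a (T *v \<xi>))"
  have F: "integrable lborel F"
    unfolding F_def by (rule diff_op_inverse_fourier[OF g E supp[folded T_def] BT])
  then have [measurable]: "F \<in> borel_measurable borel" by auto
  define \<eta> where "\<eta> = (\<lambda>s. \<theta> s * cis (2 * pi * (y \<bullet> s)))"
  have [measurable]: "\<theta> \<in> borel_measurable borel" using \<theta> by auto
  have [measurable]: "\<eta> \<in> borel_measurable borel" unfolding \<eta>_def by measurable
  define S where "S = (\<lambda>R \<zeta>. \<Sum>k\<in>{k. \<forall>i. \<bar>k $ i\<bar> \<le> int R}. cis (- (2 * pi * (int_vec k \<bullet> \<zeta>))) * inverse_fourier \<theta> (y + int_vec k))"
  have S_eq: "S R \<zeta> = (\<integral>s. \<eta> s * (\<Prod>i\<in>UNIV. dirichlet R (\<zeta> $ i - s $ i)) \<partial>lborel)" for R \<zeta>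
    unfolding S_def \<eta>_def by (rule inverse_fourier_partial_sum[OF \<theta>])
  have [measurable]: "S R \<in> borel_measurable borel" for R
    unfolding S_def by measurable
  have Ck\<eta>: "Ck_on CARD('d) (cbox l u) \<eta>" unfolding \<eta>_def by (rule Ck_on_mult_cis[OF Ck])
  have zero\<eta>: "\<eta> s = 0" if "s \<notin> cbox l u" for s using zero[OF that] by (simp add: \<eta>_def)
  note box = dirichlet_integral_box_bound[OF less_imp_le[OF lu] Ck\<eta> zero\<eta>, folded S_eq]
  obtain K where K: "\<And>R \<zeta>. norm (S R \<zeta>) \<le> K" using box(1) by blast
  have partial: "sampling_partial_sum M j N a (inverse_fourier \<theta>) (inverse_fourier g) R x = (\<integral>\<xi>. F \<xi> * S R (T *v \<xi>) \<partial>lborel)" for R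
  proof -
    have m: "of_real (\<bar>det M\<bar> powr (- of_int j / 2)) * of_real (\<bar>det M\<bar> powr (of_int j / 2)) = (1::complex)"
      using detM by (simp add: of_real_mult[symmetric] powr_add[symmetric] del: of_real_mult)
    have "sampling_partial_sum M j N a (inverse_fourier \<theta>) (inverse_fourier g) R x
        = (of_real (\<bar>det M\<bar> powr (- of_int j / 2)) * of_real (\<bar>det M\<bar> powr (of_int j / 2))) *
          (\<Sum>k\<in>{k. \<forall>i. \<bar>k $ i\<bar> \<le> int R}.
            diff_op N a (\<lambda>y. inverse_fourier g (B *v y)) (- int_vec k) * inverse_fourier \<theta> (y + int_vec k))"
      unfolding sampling_partial_sum_def dilate_shift_def B_def y_def sum_distrib_left by (simp add: mult_ac)
    also have "\<dots> = (\<Sum>k\<in>{k. \<forall>i. \<bar>k $ i\<bar> \<le> int R}.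
        (\<integral>\<xi>. F \<xi> * cis (- (2 * pi * (int_vec k \<bullet> (T *v \<xi>)))) \<partial>lborel) * inverse_fourier \<theta> (y + int_vec k))"
      unfolding m diff_op_inverse_fourier(2)[OF g E supp[folded T_def] BT] F_def by simp
    also have "\<dots> = (\<integral>\<xi>. (\<Sum>k\<in>{k. \<forall>i. \<bar>k $ i\<bar> \<le> int R}.
        F \<xi> * cis (- (2 * pi * (int_vec k \<bullet> (T *v \<xi>)))) * inverse_fourier \<theta> (y + int_vec k)) \<partial>lborel)"
      by (subst Bochner_Integration.integral_sum)
        (auto intro!: integrable_mult_left Bochner_Integration.integrable_bound[OF F] simp: norm_mult)
    also have "\<dots> = (\<integral>\<xi>. F \<xi> * S R (T *v \<xi>) \<partial>lborel)"
      unfolding S_def sum_distrib_left by (simp add: mult.assoc)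
    finally show ?thesis .
  qed
  have good: "AE \<zeta> in lborel. \<zeta> \<in> E \<longrightarrow> (\<lambda>R. S R \<zeta>) \<longlonglongrightarrow> \<eta> \<zeta> \<and> \<theta> \<zeta> * symbol N a \<zeta> = 1"
  proof -
    have "AE \<zeta> in lborel. \<forall>n. n \<noteq> 0 \<longrightarrow> \<zeta> \<in> E \<longrightarrow> \<theta> (\<zeta> - int_vec n) = 0"
      unfolding AE_all_countable using vanish by simp
    with one AE_component_notin_Ints[of "vec_nth l"] AE_component_notin_Ints[of "vec_nth u"]
    show ?thesis
    proof eventually_elim
      case (elim \<zeta>)
      have "\<zeta> $ i - l $ i \<notin> \<int> \<and> \<zeta> $ i - u $ i \<notin> \<int>" for i
        using elim(2,3) minus_in_Ints_iff[of "l $ i - \<zeta> $ i"] minus_in_Ints_iff[of "u $ i - \<zeta> $ i"] by simp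
      moreover have "\<eta> (\<zeta> - int_vec n) = 0" if "\<zeta> \<in> E" "n \<noteq> 0" for n
        using elim(4) that by (simp add: \<eta>_def)
      ultimately show ?case
        using box(2)[of \<zeta>] elim(1) by blast
    qed
  qed
  have "(\<lambda>R. \<integral>\<xi>. F \<xi> * S R (T *v \<xi>) \<partial>lborel) \<longlonglongrightarrow> (\<integral>\<xi>. F \<xi> * \<eta> (T *v \<xi>) \<partial>lborel)"
  proof (rule integral_dominated_convergence[where w="\<lambda>\<xi>. norm (F \<xi>) * K"])
    show "AE \<xi> in lborel. (\<lambda>R. F \<xi> * S R (T *v \<xi>)) \<longlonglongrightarrow> F \<xi> * \<eta> (T *v \<xi>)"
      using AE_matrix_preimage[OF T good] supp[folded T_def]
    proof eventually_elim
      case (elim \<xi>)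
      show ?case
      proof (cases "T *v \<xi> \<in> E")
        case True
        then show ?thesis using elim by (auto intro!: tendsto_intros)
      next
        case False
        then show ?thesis using elim by (simp add: F_def)
      qed
    qed
    show "AE \<xi> in lborel. norm (F \<xi> * S R (T *v \<xi>)) \<le> norm (F \<xi>) * K" for R
      by (rule AE_I2) (simp add: norm_mult K mult_left_mono)
  qed (use F in auto)
  also have "(\<integral>\<xi>. F \<xi> * \<eta> (T *v \<xi>) \<partial>lborel) = (\<integral>\<xi>. g \<xi> * cis (2 * pi * (y \<bullet> (T *v \<xi>))) \<partial>lborel)"
  proof (rule integral_cong_AE)
    show "AE \<xi> in lborel. F \<xi> * \<eta> (T *v \<xi>) = g \<xi> * cis (2 * pi * (y \<bullet> (T *v \<xi>)))"
      using AE_matrix_preimage[OF T good] supp[folded T_def]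
    proof eventually_elim
      case (elim \<xi>)
      have "F \<xi> * \<eta> (T *v \<xi>) = g \<xi> * (\<theta> (T *v \<xi>) * symbol N a (T *v \<xi>)) * cis (2 * pi * (y \<bullet> (T *v \<xi>)))"
        by (simp add: F_def \<eta>_def mult_ac)
      with elim show ?case by (cases "T *v \<xi> \<in> E") auto
    qed
  qed (use g in auto)
  also have "\<dots> = inverse_fourier g x"
    by (simp add: inverse_fourier_def BT[symmetric] By)
  finally show ?thesis unfolding partial .
qed

theorem corollary17:
  fixes M :: "real^'d^'d" and j :: int and N :: nat and a :: "nat^'d \<Rightarrow> complex"
    and \<phi> :: "real^'d \<Rightarrow> complex" and \<delta> :: real
  assumes "dilation_matrix M"
    and "a 0 \<noteq> 0"
    and "\<phi> \<in> class_B"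
    and "strictly_compatible (assoc_distr N a) \<phi> \<delta>"
  shows "(\<forall>f. continuous_on UNIV f \<and>
            fourier_L1_supported_in f {\<xi>. norm (matrix_powi (transpose M) (- j) *v \<xi>) < \<delta>} \<longrightarrow>
            (\<forall>x. (\<lambda>R. sampling_partial_sum M j N a \<phi> f R x) \<longlonglongrightarrow> f x)) \<and>
         (cube_dual (assoc_distr N a) \<phi> \<longrightarrow>
          (\<forall>f. continuous_on UNIV f \<and>
            fourier_L1_supported_in f ((*v) (matrix_powi (transpose M) j) ` unit_cube) \<longrightarrow>
            (\<forall>x. (\<lambda>R. sampling_partial_sum M j N a \<phi> f R x) \<longlonglongrightarrow> f x)))"
proof -
  have M: "invertible M" by (rule dilation_matrix_invertible[OF assms(1)])
  then have MT: "invertible (transpose M)" by (simp add: invertible_det_nz det_transpose)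
  obtain \<theta> l u where lu: "\<forall>i. l $ i < u $ i" and zero: "\<forall>\<xi>. \<xi> \<notin> cbox l u \<longrightarrow> \<theta> \<xi> = 0"
    and Ck: "Ck_on CARD('d) (cbox l u) \<theta>"
    and "\<forall>x. \<phi> x = (\<integral>\<xi>. \<theta> \<xi> * cis (2 * pi * (x \<bullet> \<xi>)) \<partial>lborel)"
    using assms(3) unfolding class_B_def mem_Collect_eq by (elim exE conjE)
  then have \<phi>: "\<phi> = inverse_fourier \<theta>"
    by (simp add: fun_eq_iff inverse_fourier_def)
  have \<theta>: "integrable lborel \<theta>" by (rule Ck_on_cbox_integrable[OF Ck zero[rule_format]])
  \<comment> \<open>Used with the ball of radius \<open>\<delta>\<close> and with the unit cube as
    \<open>E\<close>.\<close>
  have sampling: "(\<lambda>R. sampling_partial_sum M j N a \<phi> f R x) \<longlonglongrightarrow> f x"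
    if f: "continuous_on UNIV f" "fourier_L1_supported_in f A" and E: "bounded E"
      and AE: "\<And>\<xi>. \<xi> \<in> A \<Longrightarrow> matrix_powi (transpose M) (- j) *v \<xi> \<in> E"
      and "AE \<zeta> in lborel. \<zeta> \<in> E \<longrightarrow> \<theta> \<zeta> * symbol N a \<zeta> = 1"
      and "\<And>n. n \<noteq> 0 \<Longrightarrow> AE \<zeta> in lborel. \<zeta> \<in> E \<longrightarrow> \<theta> (\<zeta> - int_vec n) = 0"
    for f A E x
  proof -
    obtain g where g: "fun_has_fourier f g" "integrable lborel g" "AE \<xi> in lborel. \<xi> \<notin> A \<longrightarrow> g \<xi> = 0"
      using f(2) unfolding fourier_L1_supported_in_def by blast
    have "AE \<xi> in lborel. matrix_powi (transpose M) (- j) *v \<xi> \<notin> E \<longrightarrow> g \<xi> = 0"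
      using g(3) by eventually_elim (use AE in blast)
    from sampling_partial_sum_tendsto[OF M lu[rule_format] zero[rule_format] Ck g(2) E this that(5,6)] show ?thesis
      unfolding \<phi> fun_has_fourier_inversion[OF g(1) f(1) g(2), symmetric] .
  qed
  show ?thesis
  proof (intro conjI allI impI; (elim conjE)?)
    fix f x
    assume f: "continuous_on UNIV f"
      "fourier_L1_supported_in f {\<xi>. norm (matrix_powi (transpose M) (- j) *v \<xi>) < \<delta>}"
    obtain h ht where h: "fun_has_fourier \<phi> h" "has_fourier_function (assoc_distr N a) ht"
      "AE \<xi> in lborel. norm \<xi> < \<delta> \<longrightarrow> cnj (h \<xi>) * ht \<xi> = 1"
      "\<And>l. l \<noteq> 0 \<Longrightarrow> AE \<xi> in lborel. norm (int_vec l - \<xi>) < \<delta> \<longrightarrow> h \<xi> = 0"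
      using assms(4) unfolding strictly_compatible_def by blast
    have h\<theta>: "AE \<xi> in lborel. h \<xi> = \<theta> \<xi>"
      by (rule fun_has_fourier_inverse_fourier_AE[OF h(1)[unfolded \<phi>] \<theta>])
    have ht: "AE \<xi> in lborel. ht \<xi> = cnj (symbol N a \<xi>)"
      by (rule assoc_distr_fourier_AE[OF h(2)])
    show "(\<lambda>R. sampling_partial_sum M j N a \<phi> f R x) \<longlonglongrightarrow> f x"
    proof (rule sampling[OF f, where E="ball 0 \<delta>"])
      show "AE \<zeta> in lborel. \<zeta> \<in> ball 0 \<delta> \<longrightarrow> \<theta> \<zeta> * symbol N a \<zeta> = 1"
        using h(3) h\<theta> ht
      proof eventually_elim
        case (elim \<zeta>)
        have "\<theta> \<zeta> * symbol N a \<zeta> = 1" if "norm \<zeta> < \<delta>"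
        proof -
          have "cnj (\<theta> \<zeta> * symbol N a \<zeta>) = 1"
            using elim that by simp
          then show ?thesis by (metis complex_cnj_cnj complex_cnj_one)
        qed
        then show ?case by simp
      qed
      show "AE \<zeta> in lborel. \<zeta> \<in> ball 0 \<delta> \<longrightarrow> \<theta> (\<zeta> - int_vec n) = 0" if n: "n \<noteq> 0" for n
      proof -
        \<comment> \<open>For \<open>\<zeta>\<close> near 0 the point
          \<open>\<zeta> - int_vec n\<close> is near the lattice point of \<open>- n\<close>, so
          compatibility is applied there.\<close>
        have AE: "AE \<xi> in lborel. norm (int_vec (- n) - \<xi>) < \<delta> \<longrightarrow> \<theta> \<xi> = 0"
          using h(4)[of "- n"] h\<theta> n by (auto elim: eventually_elim2)
        have "int_vec (- n) - (\<zeta> - int_vec n) = - \<zeta>" for \<zeta> :: "real^'d"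
          by (simp add: int_vec_def vec_eq_iff)
        with AE_translate[OF AE, of "int_vec n"] show ?thesis
          by simp
      qed
    qed auto
  next
    fix f x
    assume dual: "cube_dual (assoc_distr N a) \<phi>" and f: "continuous_on UNIV f"
      "fourier_L1_supported_in f ((*v) (matrix_powi (transpose M) j) ` unit_cube)"
    obtain h ht where h: "fun_has_fourier \<phi> h" "has_fourier_function (assoc_distr N a) ht"
      "\<And>\<xi>. \<xi> \<notin> unit_cube \<Longrightarrow> h \<xi> = 0" "\<And>\<xi>. \<xi> \<in> unit_cube \<Longrightarrow> h \<xi> * cnj (ht \<xi>) = 1"
      using dual unfolding cube_dual_def by blast
    have h\<theta>: "AE \<xi> in lborel. h \<xi> = \<theta> \<xi>"
      by (rule fun_has_fourier_inverse_fourier_AE[OF h(1)[unfolded \<phi>] \<theta>])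
    have ht: "AE \<xi> in lborel. ht \<xi> = cnj (symbol N a \<xi>)"
      by (rule assoc_distr_fourier_AE[OF h(2)])
    show "(\<lambda>R. sampling_partial_sum M j N a \<phi> f R x) \<longlonglongrightarrow> f x"
    proof (rule sampling[OF f, where E=unit_cube])
      show "bounded unit_cube" by (simp add: unit_cube_def)
      show "matrix_powi (transpose M) (- j) *v \<xi> \<in> unit_cube"
        if "\<xi> \<in> (*v) (matrix_powi (transpose M) j) ` unit_cube" for \<xi>
      proof -
        from that obtain \<zeta> where "\<zeta> \<in> unit_cube" "\<xi> = matrix_powi (transpose M) j *v \<zeta>" by blast
        then show ?thesis
          using matrix_powi_mult_minus[OF MT, of "- j"] by (simp add: matrix_vector_mul_assoc)
      qed
      show "AE \<zeta> in lborel. \<zeta> \<in> unit_cube \<longrightarrow> \<theta> \<zeta> * symbol N a \<zeta> = 1"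
        using h\<theta> ht
      proof eventually_elim
        case (elim \<zeta>)
        then show ?case using h(4)[of \<zeta>] by simp
      qed
      show "AE \<zeta> in lborel. \<zeta> \<in> unit_cube \<longrightarrow> \<theta> (\<zeta> - int_vec n) = 0" if n: "n \<noteq> 0" for n
        using AE_translate[OF h\<theta>, of "int_vec n"] AE_component_notin_Ints[of "\<lambda>_. 1 / 2"]
      proof eventually_elim
        case (elim \<zeta>)
        show ?case
        proof
          assume "\<zeta> \<in> unit_cube"
          obtain i where i: "n $ i \<noteq> 0" using n by (auto simp: vec_eq_iff)
          have z: "- 1 / 2 \<le> \<zeta> $ i" "\<zeta> $ i \<le> 1 / 2"
            using \<open>\<zeta> \<in> unit_cube\<close> by (simp_all add: unit_cube_def mem_box_cart)
          \<comment> \<open>A point of the closed cube and a nonzero integer translate of it both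
            lie in the cube only if some coordinate is \<open>1 / 2\<close> or
            \<open>- 1 / 2\<close>. Either value makes \<open>1 / 2 - \<zeta> $ i\<close> an
            integer, so one null set excludes both faces.\<close>
          have "\<zeta> - int_vec n \<notin> unit_cube"
          proof
            assume "\<zeta> - int_vec n \<in> unit_cube"
            then have "- 1 / 2 \<le> \<zeta> $ i - of_int (n $ i)" "\<zeta> $ i - of_int (n $ i) \<le> 1 / 2"
              by (auto simp: unit_cube_def mem_box_cart int_vec_def dest!: spec[of _ i])
            moreover have "of_int (n $ i) \<le> (-1 :: real) \<or> (1 :: real) \<le> of_int (n $ i)"
              using i by linarith
            ultimately have "\<zeta> $ i = 1 / 2 \<or> \<zeta> $ i = - 1 / 2"
              using z by linarith
            then have "1 / 2 - \<zeta> $ i = 0 \<or> 1 / 2 - \<zeta> $ i = 1"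
              by linarith
            then have "1 / 2 - \<zeta> $ i \<in> \<int>"
              by (metis Ints_0 Ints_1)
            with elim(2) show False by blast
          qed
          with elim(1) h(3) show "\<theta> (\<zeta> - int_vec n) = 0" by metis
        qed
      qed
    qed
  qed
qed

end
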